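(* For every prime number $p\ge 2$ there exists an edge ideal $I_p$ such that, for some $i\geq 1$ and for every $h\geq 1$, $\beta_i^{\mathbb{Z}_p}(I_p^h)\neq\beta_i^{\mathbb{Q}}(I_p^h)$.
   Context: The edge ideal of a finite simple graph $G$ on vertices $1,\dots,n$ is $I(G)=(x_ix_j:\{i,j\}\in E(G))$ in the polynomial ring in $x_1,\dots,x_n$. A monomial ideal $I$ has a unique minimal system $G(I)$ of monic monomial generators, which makes sense over every coefficient field. For a field $k$, $\beta_i^k(I)=\dim_k\mathrm{Tor}_i^R(I,k)$ denotes the $i$-th (total) Betti number of the ideal generated by $G(I)$ in $R=k[x_1,\dots,x_n]$ (of $I$ as a module, not of $R/I$); powers are treated in the same way. $\mathbb{Z}_p$ denotes the field with $p$ elements. *)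

theory Defs
  imports
    "HOL-Library.Poly_Mapping"
    "HOL-Library.Cardinality"
    "HOL-Computational_Algebra.Primes"
    "HOL-Algebra.Ideal_Product"
    "Jordan_Normal_Form.Matrix_Kernel"
    "Jordan_Normal_Form.DL_Rank"
begin

section \<open>Polynomial rings\<close>

text \<open>
  A polynomial maps finitely many exponent vectors to nonzero coefficients. The type has
  variables indexed by all natural numbers; the ring $k[x_1,\dots,x_n]$ is the subring
  \<open>mpoly_ring n\<close>, whose carrier consists of the polynomials in which only
  $x_1,\dots,x_n$ occur.
\<close>

type_synonym 'k mpoly = "(nat \<Rightarrow>\<^sub>0 nat) \<Rightarrow>\<^sub>0 'k"

definition var :: "nat \<Rightarrow> 'k::field mpoly" where
  "var i = Poly_Mapping.single (Poly_Mapping.single i 1) 1"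

definition mpolys :: "nat \<Rightarrow> 'k::field mpoly set" where
  "mpolys n = {f. \<forall>m \<in> Poly_Mapping.keys f. Poly_Mapping.keys m \<subseteq> {1..n}}"

definition mpoly_ring :: "nat \<Rightarrow> 'k::field mpoly ring" where
  "mpoly_ring n = \<lparr>carrier = mpolys n, mult = (*), one = 1, zero = 0, add = (+)\<rparr>"

section \<open>Edge ideals\<close>

definition simple_graph :: "nat \<Rightarrow> nat set set \<Rightarrow> bool" where
  "simple_graph n E \<longleftrightarrow> (\<forall>e\<in>E. e \<subseteq> {1..n} \<and> card e = 2)"

definition edge_ideal :: "nat \<Rightarrow> nat set set \<Rightarrow> 'k::field mpoly set" where
  "edge_ideal n E = genideal (mpoly_ring n) {var i * var j | i j. {i, j} \<in> E}"

text \<open>Powers are taken in the library's monoid of ideals of a ring under the ideal product.\<close>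

definition ideal_power :: "nat \<Rightarrow> 'k::field mpoly set \<Rightarrow> nat \<Rightarrow> 'k mpoly set" where
  "ideal_power n I h = I [^]\<^bsub>ideals_set (mpoly_ring n)\<^esub> h"

section \<open>Free resolutions and Betti numbers\<close>

text \<open>
  Let $R = k[x_1,\dots,x_n]$. The free module $R^m$ is \<open>free_mod n m\<close>, and a linear map
  $R^c \to R^r$ is an $r \times c$ matrix with entries in $R$, acting on column vectors.
\<close>

definition free_mod :: "nat \<Rightarrow> nat \<Rightarrow> 'k::field mpoly vec set" where
  "free_mod n m = {v \<in> carrier_vec m. set\<^sub>v v \<subseteq> mpolys n}"

definition free_hom :: "nat \<Rightarrow> nat \<Rightarrow> nat \<Rightarrow> 'k::field mpoly mat set" where
  "free_hom n r c = {A \<in> carrier_mat r c. elements_mat A \<subseteq> mpolys n}"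

text \<open>
  A resolution $\cdots \to F_2 \to F_1 \to F_0 \to I \to 0$ with $F_j = R^{b_j}$ and
  $d_j : F_j \to F_{j-1}$. The augmentation $F_0 \to I$ is given by the vector \<open>g\<close> of
  images of the basis vectors, and $d_0$ is the map $F_0 \to 0$, a matrix without rows.
  It suffices to consider modules of finite rank: $R$ is noetherian, so
  every ideal has such a resolution.
\<close>

definition free_resolution ::
  "nat \<Rightarrow> 'k::field mpoly set \<Rightarrow> (nat \<Rightarrow> nat) \<Rightarrow> 'k mpoly vec \<Rightarrow> (nat \<Rightarrow> 'k mpoly mat) \<Rightarrow> bool"
where
  "free_resolution n I b g d \<longleftrightarrow>
     g \<in> free_mod n (b 0) \<and>
     d 0 \<in> free_hom n 0 (b 0) \<and>
     (\<forall>j. d (Suc j) \<in> free_hom n (b j) (b (Suc j))) \<and>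
     (\<lambda>v. g \<bullet> v) ` free_mod n (b 0) = I \<and>
     {v \<in> free_mod n (b 0). g \<bullet> v = 0} = (\<lambda>w. d 1 *\<^sub>v w) ` free_mod n (b 1) \<and>
     (\<forall>j\<ge>1. {v \<in> free_mod n (b j). d j *\<^sub>v v = 0\<^sub>v (b (j - 1))}
            = (\<lambda>w. d (Suc j) *\<^sub>v w) ` free_mod n (b (Suc j)))"

text \<open>
  The field $k$ is the $R$-module $R/(x_1,\dots,x_n)$, so $R^m \otimes_R k = k^m$, and
  tensoring a matrix with $k$ replaces each entry by its constant term.
\<close>

definition tensor_field :: "'k::field mpoly mat \<Rightarrow> 'k mat" where
  "tensor_field A = map_mat (\<lambda>f. Poly_Mapping.lookup f 0) A"

text \<open>
  The dimension of $H_i(F \otimes_R k) = \ker(d_i \otimes k) / \mathrm{im}(d_{i+1} \otimes k)$.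
  As $d_i d_{i+1} = 0$ in a resolution, the image lies in the kernel and the subtraction
  does not truncate.
\<close>

definition homology_dim :: "(nat \<Rightarrow> 'k::field mpoly mat) \<Rightarrow> nat \<Rightarrow> nat" where
  "homology_dim d i =
     kernel_dim (tensor_field (d i)) -
     vec_space.rank (dim_row (d (Suc i))) (tensor_field (d (Suc i)))"

text \<open>
  $\beta_i(I) = \dim_k \mathrm{Tor}_i^R(I, k)$, the $i$-th homology of $F \otimes_R k$ for a
  free resolution $F$ of $I$; it does not depend on the choice of $F$.
\<close>

definition betti :: "nat \<Rightarrow> 'k::field mpoly set \<Rightarrow> nat \<Rightarrow> nat" where
  "betti n I i = (THE t. \<exists>b g d. free_resolution n I b g d \<and> t = homology_dim d i)"

end

theory Submission
  imports Defs
begin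

text \<open>Let \<open>X\<close> be a flag triangulation of the mod-\<open>p\<close> Moore space, and let the graph consist of the
  non-edges of \<open>X\<close> together with an isolated edge \<open>yz\<close>. A monomial
  ideal has a free resolution by the unit cubes of the lattice of exponent vectors whose lowest
  vertex lies in the ideal, truncated to a large box. Tensored with a field, its differentials are
  integer matrices, so a Betti number is the number of cubes of a given dimension minus the ranks of
  two integer matrices, and these ranks cannot grow under reduction modulo \<open>p\<close>.

  It suffices that one of them drops. In the \<open>h\<close>-th power, the cubes with lowest vertex
  \<open>x\<^sub>\<sigma>(yz)\<^sup>h\<^sup>-\<^sup>1\<close> and directions \<open>V - \<sigma>\<close>, where \<open>\<sigma>\<close> is not a face of \<open>X\<close>, span a subcomplex that is the
  cochain complex of the full simplex on \<open>V\<close> relative to \<open>X\<close>. The \<open>p\<close>-torsion of the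
  cohomology of \<open>X\<close> gives an element \<open>v\<close> of this subcomplex such that \<open>pv\<close> is a boundary with integer
  coefficients. To see that \<open>v\<close> is not a boundary modulo \<open>p\<close>, not even in the whole complex,
  it is paired with the cone from the centre \<open>5\<close> of the disc over the strip of triangles between the rim
  of the disc and the 4-cycle: all missing faces of the tetrahedra of this cone involve \<open>5\<close>, which confines
  the cubes that contribute to those of the subcomplex.\<close>

section \<open>Matrices over a field\<close>

text \<open>Comparing ranks replaces every computation of Tor: one p-torsion class in one cokernel
  decides the inequality. The isolated edge makes the powers comparable: a product of
  \<open>h\<close> edges dividing x_\<sigma> (yz)^(h-1) uses yz at most \<open>h\<close> - 1 times,
  so some factor is a non-edge of X inside \<sigma>, and the pair (simplex, X) reappears in each
  power in the same homological degree. The obstacle is that cubes outside the subcomplex can have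
  facets in it: for \<open>h\<close> >= 2, if \<sigma> contains two disjoint non-edges, then
  x_\<sigma> y^(h-2) z^(h-1) lies in the power, and the extra direction y gives such a cube. A
  functional detecting the torsion must avoid these \<sigma>. The fundamental cycle of X modulo
  \<open>p\<close> consists of the disc and the strip; its cone from \<open>5\<close> is degenerate
  over the disc, and over the strip it yields only \<sigma> for which \<sigma> - {5} is a face, so
  that any two non-edges in \<sigma> share \<open>5\<close>.\<close>

lemma (in vec_space) ex_mat_of_basis:
  assumes B: "finite B" "B \<subseteq> carrier_vec n" "lin_indpt B"
  shows "\<exists>X \<in> carrier_mat n (card B).
           (\<forall>v \<in> carrier_vec (card B). X *\<^sub>v v = 0\<^sub>v n \<longrightarrow> v = 0\<^sub>v (card B)) \<and>
           (\<lambda>v. X *\<^sub>v v) ` carrier_vec (card B) = span B"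
proof -
  obtain bs where bs: "set bs = B" "distinct bs" using finite_distinct_list[OF B(1)] by blast
  have len: "length bs = card B" using bs distinct_card by fastforce
  define X where "X = mat_of_cols n bs"
  have X: "X \<in> carrier_mat n (card B)" unfolding X_def using len by auto
  have cols: "cols X = bs" unfolding X_def using bs B(2) by (auto intro: cols_mat_of_cols)
  have "\<forall>v \<in> carrier_vec (card B). X *\<^sub>v v = 0\<^sub>v n \<longrightarrow> v = 0\<^sub>v (card B)"
    using lin_depI[OF X] cols bs B(3) by auto
  moreover have "(\<lambda>v. X *\<^sub>v v) ` carrier_vec (card B) = span B"
  proof -
    have "span B = col_space X" unfolding col_space_def cols bs ..
    also have "\<dots> = {y\<in>carrier_vec (dim_row X). \<exists>x\<in>carrier_vec (dim_col X). X *\<^sub>v x = y}"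
      by (rule col_space_eq[OF X])
    finally show ?thesis using X by auto
  qed
  ultimately show ?thesis using X by blast
qed

text \<open>Dimensions are compared through injective matrices with a prescribed range; they stand
  in for bases, and quotient spaces are avoided altogether.\<close>

definition inj_mat :: "'a :: field mat \<Rightarrow> bool" where
  "inj_mat X \<longleftrightarrow> (\<forall>v \<in> carrier_vec (dim_col X). X *\<^sub>v v = 0\<^sub>v (dim_row X) \<longrightarrow> v = 0\<^sub>v (dim_col X))"

definition mat_range :: "'a :: comm_ring_1 mat \<Rightarrow> 'a vec set" where
  "mat_range X = (\<lambda>v. X *\<^sub>v v) ` carrier_vec (dim_col X)"

lemma mat_rangeI: "A \<in> carrier_mat n c \<Longrightarrow> x \<in> carrier_vec c \<Longrightarrow> A *\<^sub>v x \<in> mat_range A"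
  unfolding mat_range_def by auto

lemma mat_rangeE:
  assumes "z \<in> mat_range A" "A \<in> carrier_mat n c"
  obtains y where "y \<in> carrier_vec c" "z = A *\<^sub>v y"
  using assms unfolding mat_range_def by auto

lemma kernel_basis_mat:
  fixes A :: "'a :: field mat"
  assumes A: "A \<in> carrier_mat nr nc"
  obtains X where "X \<in> carrier_mat nc (kernel_dim A)" "inj_mat X" "mat_range X = mat_kernel A"
proof -
  interpret kernel nr nc A by (unfold_locales, rule A)
  obtain B where B: "finite B" "basis B" using kernel_basis_exists[OF A] by blast
  have sub: "B \<subseteq> mat_kernel A" and li: "lin_indpt B" and gen: "gen_set B"
    using B(2) unfolding Ker.basis_def by auto
  have "dim = card B" using Ker.dim_basis[OF B] .
  moreover have "NC.lin_indpt B" using li lindep_same[OF sub] by simp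
  moreover have "NC.span B = mat_kernel A" using gen span_same[OF sub] by simp
  moreover have "B \<subseteq> carrier_vec nc" using sub mat_kernel_carrier[OF A] by blast
  ultimately obtain X where X: "X \<in> carrier_mat nc (kernel_dim A)"
    "\<forall>v \<in> carrier_vec (kernel_dim A). X *\<^sub>v v = 0\<^sub>v nc \<longrightarrow> v = 0\<^sub>v (kernel_dim A)"
    "(\<lambda>v. X *\<^sub>v v) ` carrier_vec (kernel_dim A) = mat_kernel A"
    using NC.ex_mat_of_basis[of B] B(1) by auto
  then show ?thesis using that[of X] unfolding inj_mat_def mat_range_def by auto
qed

lemma mat_range_eq_col_space:
  fixes A :: "'a :: field mat"
  assumes "A \<in> carrier_mat nr nc"
  shows "mat_range A = vec_space.col_space nr A"
proof -
  have "vec_space.col_space nr A = {y\<in>carrier_vec (dim_row A). \<exists>x\<in>carrier_vec (dim_col A). A *\<^sub>v x = y}"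
    by (rule vec_space.col_space_eq[OF assms])
  then show ?thesis unfolding mat_range_def using assms by auto
qed

lemma range_basis_mat:
  fixes A :: "'a :: field mat"
  assumes A: "A \<in> carrier_mat nr nc"
  obtains X where "X \<in> carrier_mat nr (vec_space.rank nr A)" "inj_mat X" "mat_range X = mat_range A"
proof -
  interpret V: vec_space "TYPE('a)" nr .
  let ?S = "V.span (set (cols A))"
  have c: "set (cols A) \<subseteq> carrier_vec nr" using A cols_dim by blast
  have sm: "submodule class_ring ?S V.V" using V.span_is_submodule c by simp
  interpret S: vectorspace class_ring "V.vs ?S"
    using sm V.vectorspace_axioms by (intro V.subspace_is_vs) (simp add: subspace_def)
  have "S.fin_dim" using V.fin_dim_span_cols[OF A] by simp
  then obtain B where B: "finite B" "S.basis B" using S.finite_basis_exists by blast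
  have sub: "B \<subseteq> ?S" and li: "S.lin_indpt B" and gen: "S.span B = ?S"
    using B(2) unfolding S.basis_def by auto
  have "S.dim = card B" using S.dim_basis[OF B] .
  then have d: "V.rank A = card B" unfolding V.rank_def by simp
  have "V.lin_indpt B" using li V.span_li_not_depend(2)[OF sub sm] by simp
  moreover have "V.span B = ?S" using gen V.span_li_not_depend(1)[OF sub sm] by simp
  moreover have "B \<subseteq> carrier_vec nr" using sub V.span_is_subset2 c by auto
  moreover have "?S = mat_range A" using mat_range_eq_col_space[OF A] unfolding V.col_space_def by simp
  ultimately obtain X where X: "X \<in> carrier_mat nr (V.rank A)"
    "\<forall>v \<in> carrier_vec (V.rank A). X *\<^sub>v v = 0\<^sub>v nr \<longrightarrow> v = 0\<^sub>v (V.rank A)"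
    "(\<lambda>v. X *\<^sub>v v) ` carrier_vec (V.rank A) = mat_range A"
    using V.ex_mat_of_basis[of B] B(1) d by auto
  then show ?thesis using that[of X] unfolding inj_mat_def mat_range_def by auto
qed

lemma kernel_dim_add_rank:
  fixes A :: "'a :: field mat"
  assumes A: "A \<in> carrier_mat nr nc"
  shows "kernel_dim A + vec_space.rank nr A = nc"
proof -
  interpret K: kernel nr nc A by (unfold_locales, rule A)
  interpret V: vec_space "TYPE('a)" nr .
  interpret L: linear_map class_ring K.NC.V V.V "\<lambda>v. A *\<^sub>v v"
    using A by unfold_locales
      (auto simp: LinearCombinations.module_hom_def module_vec_simps mult_add_distrib_mat_vec[OF A] mult_mat_vec[OF A])
  have "L.im = V.span (set (cols A))"
    using mat_range_eq_col_space[OF A] A unfolding L.im_def mat_range_def V.col_space_def by simp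
  moreover have "L.ker = mat_kernel A"
    using A by (auto simp: L.ker_def mat_kernel[OF A])
  ultimately have "V.rank A + K.dim = K.NC.dim"
    using L.rank_nullity[OF K.NC.fin_dim] unfolding V.rank_def by simp
  then show ?thesis by (simp add: K.NC.dim_is_n)
qed

section \<open>Matrix equations and dimension counts\<close>

text \<open>The equation is solved column by column. The set \<open>X\<close> carries a side
  condition on the columns, so that over polynomials the solution can be kept inside
  \<open>mpolys n\<close>.\<close>

lemma ex_mat_mult_eq:
  assumes M: "M \<in> carrier_mat r s" and A: "A \<in> carrier_mat r c"
    and *: "\<And>j. j < c \<Longrightarrow> \<exists>x \<in> X. M *\<^sub>v x = col A j" and X: "X \<subseteq> carrier_vec s"
  shows "\<exists>C \<in> carrier_mat s c. (\<forall>j<c. col C j \<in> X) \<and> M * C = A"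
proof -
  obtain f where f: "\<And>j. j < c \<Longrightarrow> f j \<in> X \<and> M *\<^sub>v f j = col A j" using * by metis
  define C where "C = mat s c (\<lambda>(i,j). f j $ i)"
  have C: "C \<in> carrier_mat s c" unfolding C_def by simp
  have col: "col C j = f j" if "j < c" for j
    using f[OF that] X that unfolding C_def by (intro eq_vecI) auto
  have "M * C = A"
  proof (rule eq_matI)
    fix i j assume "i < dim_row A" "j < dim_col A"
    then show "(M * C) $$ (i, j) = A $$ (i, j)"
      using f[of j] M A C col[of j] col_mult2[OF M C, of j] index_col[of i "M * C" j] index_col[of i A j] by simp
  qed (use M A C in auto)
  then show ?thesis using C col f by (intro bexI[of _ C]) auto
qed

lemma inj_mat_mult_left:
  assumes "B * C = X" "inj_mat X" "B \<in> carrier_mat n r" "C \<in> carrier_mat r s"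
  shows "inj_mat C"
  unfolding inj_mat_def
proof (intro ballI impI)
  fix v assume v: "v \<in> carrier_vec (dim_col C)" "C *\<^sub>v v = 0\<^sub>v (dim_row C)"
  have "X *\<^sub>v v = B *\<^sub>v (C *\<^sub>v v)" using assms v by auto
  also have "\<dots> = 0\<^sub>v n" using v assms by auto
  finally show "v = 0\<^sub>v (dim_col C)" using assms v unfolding inj_mat_def by auto
qed

text \<open>If there were fewer rows than columns, padding with zero rows would give a singular
  square matrix, and a vector in its kernel would lie in the kernel of \<open>C\<close>.\<close>

lemma inj_mat_col_le_row:
  fixes C :: "'a :: field mat"
  assumes C: "C \<in> carrier_mat r s" and inj: "inj_mat C"
  shows "s \<le> r"
proof (rule ccontr)
  assume "\<not> s \<le> r"
  then have rs: "r < s" by simp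
  define D where "D = mat s s (\<lambda>(i,j). if i < r then C $$ (i,j) else 0)"
  have D: "D \<in> carrier_mat s s" unfolding D_def by simp
  have "transpose_mat D *\<^sub>v unit_vec s r = 0\<^sub>v s"
    using rs by (intro eq_vecI) (auto simp: D_def)
  moreover have "unit_vec s r \<noteq> (0\<^sub>v s :: 'a vec)" using rs by simp
  ultimately have "det (transpose_mat D) = 0"
    using det_0_iff_vec_prod_zero_field[of "transpose_mat D" s] D
    by (meson transpose_carrier_mat unit_vec_carrier)
  then have "det D = 0" using det_transpose[OF D] by simp
  then obtain v where v: "v \<in> carrier_vec s" "v \<noteq> 0\<^sub>v s" "D *\<^sub>v v = 0\<^sub>v s"
    using det_0_iff_vec_prod_zero_field[OF D] by auto
  have "C *\<^sub>v v = 0\<^sub>v r"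
  proof (rule eq_vecI)
    fix i assume i: "i < dim_vec (0\<^sub>v r :: 'a vec)"
    have "row D i = row C i" using i rs C D by (intro eq_vecI) (auto simp: D_def)
    then have "(C *\<^sub>v v) $ i = (D *\<^sub>v v) $ i" using i rs C D by simp
    then show "(C *\<^sub>v v) $ i = 0\<^sub>v r $ i" using v i rs by simp
  qed (use C in auto)
  then show False using inj v C unfolding inj_mat_def by auto
qed

lemma inj_mat_range_le:
  fixes X :: "'a :: field mat"
  assumes X: "X \<in> carrier_mat n s" and inj: "inj_mat X" and B: "B \<in> carrier_mat n r"
    and sub: "\<And>j. j < s \<Longrightarrow> col X j \<in> mat_range B"
  shows "s \<le> r"
proof -
  obtain C where "C \<in> carrier_mat r s" "B * C = X"
    using ex_mat_mult_eq[OF B X, of "carrier_vec r"] sub B unfolding mat_range_def by force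
  then show ?thesis using inj_mat_col_le_row inj_mat_mult_left inj B by blast
qed

lemma rank_ge_of_inj:
  fixes X :: "'a :: field mat"
  assumes X: "X \<in> carrier_mat n s" "inj_mat X" and A: "A \<in> carrier_mat n c"
    and sub: "\<And>j. j < s \<Longrightarrow> col X j \<in> mat_range A"
  shows "s \<le> vec_space.rank n A"
proof -
  obtain Y where "Y \<in> carrier_mat n (vec_space.rank n A)" "mat_range Y = mat_range A"
    using range_basis_mat[OF A] by metis
  then show ?thesis using inj_mat_range_le[OF X] sub by auto
qed

lemma rank_le_row:
  fixes A :: "'a :: field mat"
  assumes A: "A \<in> carrier_mat n c"
  shows "vec_space.rank n A \<le> n"
  by (rule range_basis_mat[OF A]) (rule inj_mat_col_le_row)

lemma vec_add_eq_zeroD: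
  fixes x y :: "'a :: ab_group_add vec"
  assumes "x \<in> carrier_vec n" "y \<in> carrier_vec n" "x + y = 0\<^sub>v n"
  shows "x = - y"
proof (rule eq_vecI)
  fix i assume "i < dim_vec (- y)"
  then have i: "i < n" using assms(2) by simp
  have "(x + y) $ i = 0" using assms(3) i by simp
  moreover have "(x + y) $ i = x $ i + y $ i" using i assms(2) by (intro index_add_vec) auto
  ultimately have "x $ i + y $ i = 0" by simp
  then show "x $ i = (- y) $ i" using i assms by (simp add: eq_neg_iff_add_eq_0)
qed (use assms in auto)

lemma mat_mult_unit_vec:
  fixes A :: "'a :: semiring_1 mat"
  assumes "A \<in> carrier_mat n c" "j < c"
  shows "A *\<^sub>v unit_vec c j = col A j"
  using assms by (intro eq_vecI) auto

text \<open>The hypotheses say that \<open>f\<close> induces an injection from ker D modulo im E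
  into ker D' modulo im E'. In coordinates of ker D', let \<open>G\<close> be the restriction of
  \<open>f\<close> to ker D and \<open>C\<close> the inclusion of im E'. A kernel vector of the
  block matrix \<open>W\<close> = [G | C] is a cycle of \<open>D\<close> that \<open>f\<close> sends
  into im E', hence lies in im E; so the kernel of \<open>W\<close> has dimension at most rank E,
  while the rank of \<open>W\<close> is at most dim ker D'.\<close>

lemma homology_dim_le_of_injective:
  fixes D :: "'a :: field mat"
  assumes D: "D \<in> carrier_mat r0 n" "E \<in> carrier_mat n m"
    and D': "D' \<in> carrier_mat r0' n'" "E' \<in> carrier_mat n' m'"
    and f: "f \<in> carrier_mat n' n"
    and DE: "mat_range E' \<subseteq> mat_kernel D'"
    and cyc: "\<And>z. z \<in> mat_kernel D \<Longrightarrow> f *\<^sub>v z \<in> mat_kernel D'"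
    and bnd: "\<And>z. z \<in> mat_kernel D \<Longrightarrow> f *\<^sub>v z \<in> mat_range E' \<Longrightarrow> z \<in> mat_range E"
  shows "kernel_dim D - vec_space.rank n E \<le> kernel_dim D' - vec_space.rank n' E'"
proof -
  define k k' l l' where "k = kernel_dim D" and "k' = kernel_dim D'"
    and "l = vec_space.rank n E" and "l' = vec_space.rank n' E'"
  obtain B where B: "B \<in> carrier_mat n k" "inj_mat B" "mat_range B = mat_kernel D"
    unfolding k_def by (rule kernel_basis_mat[OF D(1)])
  obtain B' where B': "B' \<in> carrier_mat n' k'" "inj_mat B'" "mat_range B' = mat_kernel D'"
    unfolding k'_def by (rule kernel_basis_mat[OF D'(1)])
  obtain R where R: "R \<in> carrier_mat n l" "inj_mat R" "mat_range R = mat_range E"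
    unfolding l_def by (rule range_basis_mat[OF D(2)])
  obtain R' where R': "R' \<in> carrier_mat n' l'" "inj_mat R'" "mat_range R' = mat_range E'"
    unfolding l'_def by (rule range_basis_mat[OF D'(2)])
  have colB: "col B j \<in> mat_kernel D" if "j < k" for j
    using B that unfolding B(3)[symmetric] mat_range_def
    by (intro image_eqI[of _ _ "unit_vec k j"]) auto
  have "\<exists>x \<in> carrier_vec k'. B' *\<^sub>v x = col (f * B) j" if "j < k" for j
  proof -
    have "col (f * B) j = f *\<^sub>v col B j" using f B that by (intro col_mult2) auto
    also have "\<dots> \<in> mat_range B'" using cyc[OF colB[OF that]] B'(3) by simp
    finally show ?thesis using B'(1) unfolding mat_range_def by auto
  qed
  then obtain G where G: "G \<in> carrier_mat k' k" "B' * G = f * B"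
    using ex_mat_mult_eq[OF B'(1), of "f * B" k "carrier_vec k'"] f B(1) by auto
  have "\<exists>x \<in> carrier_vec k'. B' *\<^sub>v x = col R' j" if "j < l'" for j
  proof -
    have "col R' j \<in> mat_range R'" using R' that unfolding mat_range_def
      by (intro image_eqI[of _ _ "unit_vec l' j"]) auto
    then have "col R' j \<in> mat_range B'" using DE B'(3) R'(3) by auto
    then show ?thesis using B'(1) unfolding mat_range_def by auto
  qed
  then obtain C where C: "C \<in> carrier_mat k' l'" "B' * C = R'"
    using ex_mat_mult_eq[OF B'(1) R'(1), of "carrier_vec k'"] by auto
  define W where "W = mat k' (k + l') (\<lambda>(i,j). if j < k then G $$ (i,j) else C $$ (i,j-k))"
  have W: "W \<in> carrier_mat k' (k + l')" unfolding W_def by simp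
  have Wv: "W *\<^sub>v (a @\<^sub>v b) = G *\<^sub>v a + C *\<^sub>v b" if ab: "a \<in> carrier_vec k" "b \<in> carrier_vec l'" for a b
  proof (rule eq_vecI)
    fix i assume "i < dim_vec (G *\<^sub>v a + C *\<^sub>v b)"
    then have i: "i < k'" using C by simp
    have "row W i = row G i @\<^sub>v row C i" using i G C by (intro eq_vecI) (auto simp: W_def)
    then have "row W i \<bullet> (a @\<^sub>v b) = row G i \<bullet> a + row C i \<bullet> b"
      using ab G C i scalar_prod_append[of "row G i" k "row C i" l' a b] by auto
    then show "(W *\<^sub>v (a @\<^sub>v b)) $ i = (G *\<^sub>v a + C *\<^sub>v b) $ i" using i W G C by simp
  qed (use W C in auto)
  obtain K where K: "K \<in> carrier_mat (k + l') (kernel_dim W)" "inj_mat K" "mat_range K = mat_kernel W"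
    by (rule kernel_basis_mat[OF W])
  have "kernel_dim W \<le> l"
  proof -
    define q where "q = kernel_dim W"
    define K1 where "K1 = mat k q (\<lambda>(i,j). K $$ (i,j))"
    define K2 where "K2 = mat l' q (\<lambda>(i,j). K $$ (k + i,j))"
    have K12: "K1 \<in> carrier_mat k q" "K2 \<in> carrier_mat l' q" unfolding K1_def K2_def by auto
    have Kq: "K \<in> carrier_mat (k + l') q" using K q_def by simp
    have Kv: "K *\<^sub>v v = (K1 *\<^sub>v v) @\<^sub>v (K2 *\<^sub>v v)" if "v \<in> carrier_vec q" for v
    proof (rule eq_vecI)
      fix i assume i: "i < dim_vec ((K1 *\<^sub>v v) @\<^sub>v (K2 *\<^sub>v v))"
      then have i': "i < k + l'" using K12 by simp
      show "(K *\<^sub>v v) $ i = ((K1 *\<^sub>v v) @\<^sub>v (K2 *\<^sub>v v)) $ i"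
        using i' Kq K12 that by (auto simp: K1_def K2_def mult_mat_vec_def scalar_prod_def intro!: sum.cong)
    qed (use Kq K12 in auto)
    have key: "G *\<^sub>v (K1 *\<^sub>v v) + C *\<^sub>v (K2 *\<^sub>v v) = 0\<^sub>v k'" if v: "v \<in> carrier_vec q" for v
    proof -
      have "K *\<^sub>v v \<in> mat_kernel W" using K(3) v Kq unfolding mat_range_def by auto
      then have "W *\<^sub>v (K *\<^sub>v v) = 0\<^sub>v k'" using mat_kernelD[OF W] by simp
      then show ?thesis using Kv[OF v] Wv[of "K1 *\<^sub>v v" "K2 *\<^sub>v v"] K12 v by auto
    qed
    have key2: "f *\<^sub>v (B *\<^sub>v (K1 *\<^sub>v v)) + R' *\<^sub>v (K2 *\<^sub>v v) = 0\<^sub>v n'" if v: "v \<in> carrier_vec q" for v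
    proof -
      have a: "K1 *\<^sub>v v \<in> carrier_vec k" "K2 *\<^sub>v v \<in> carrier_vec l'" using K12 v by auto
      have "f *\<^sub>v (B *\<^sub>v (K1 *\<^sub>v v)) = (f * B) *\<^sub>v (K1 *\<^sub>v v)" using f B a by simp
      also have "\<dots> = B' *\<^sub>v (G *\<^sub>v (K1 *\<^sub>v v))" using B' G a assoc_mult_mat_vec by metis
      finally have 1: "f *\<^sub>v (B *\<^sub>v (K1 *\<^sub>v v)) = B' *\<^sub>v (G *\<^sub>v (K1 *\<^sub>v v))" .
      have 2: "R' *\<^sub>v (K2 *\<^sub>v v) = B' *\<^sub>v (C *\<^sub>v (K2 *\<^sub>v v))" using B' C a assoc_mult_mat_vec by metis
      have "B' *\<^sub>v (G *\<^sub>v (K1 *\<^sub>v v)) + B' *\<^sub>v (C *\<^sub>v (K2 *\<^sub>v v)) = B' *\<^sub>v (G *\<^sub>v (K1 *\<^sub>v v) + C *\<^sub>v (K2 *\<^sub>v v))"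
        using B' G C a by (intro mult_add_distrib_mat_vec[symmetric]) auto
      then show ?thesis unfolding 1 2 using key[OF v] B' by auto
    qed
    \<comment> \<open>The first block of a kernel vector of \<open>W\<close> determines the second,
      because \<open>R'\<close> is injective; so projecting to the first block loses
      nothing.\<close>
    have "inj_mat (B * K1)"
      unfolding inj_mat_def
    proof (intro ballI impI)
      fix v assume "v \<in> carrier_vec (dim_col (B * K1))" and z: "(B * K1) *\<^sub>v v = 0\<^sub>v (dim_row (B * K1))"
      then have v: "v \<in> carrier_vec q" using K12 by simp
      have z': "B *\<^sub>v (K1 *\<^sub>v v) = 0\<^sub>v n" using z B K12 v by auto
      then have "K1 *\<^sub>v v = 0\<^sub>v k" using B K12 v unfolding inj_mat_def by auto
      moreover have "R' *\<^sub>v (K2 *\<^sub>v v) = 0\<^sub>v n'"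
      proof -
        have "R' *\<^sub>v (K2 *\<^sub>v v) \<in> carrier_vec n'" using R' K12 v by auto
        moreover have "f *\<^sub>v 0\<^sub>v n = 0\<^sub>v n'" using f by (intro eq_vecI) auto
        ultimately show ?thesis using key2[OF v] z' by simp
      qed
      then have "K2 *\<^sub>v v = 0\<^sub>v l'" using R' K12 v unfolding inj_mat_def by auto
      ultimately have "K *\<^sub>v v = 0\<^sub>v (k + l')" unfolding Kv[OF v] by (intro eq_vecI) auto
      then show "v = 0\<^sub>v (dim_col (B * K1))" using K(2) Kq K12 v unfolding inj_mat_def by auto
    qed
    moreover have "col (B * K1) j \<in> mat_range R" if j: "j < q" for j
    proof -
      have u: "unit_vec q j \<in> carrier_vec q" by simp
      define z where "z = B *\<^sub>v (K1 *\<^sub>v unit_vec q j)"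
      have zc: "col (B * K1) j = z" unfolding z_def using B K12 j
        by (subst col_mult2[of B n k K1 q j]) (auto simp: mat_mult_unit_vec)
      have zk: "z \<in> mat_kernel D" unfolding z_def B(3)[symmetric] mat_range_def using B K12 by auto
      have zn: "z \<in> carrier_vec n" unfolding z_def using B K12 by auto
      have "f *\<^sub>v z = R' *\<^sub>v (- (K2 *\<^sub>v unit_vec q j))"
      proof -
        have 1: "R' *\<^sub>v (- (K2 *\<^sub>v unit_vec q j)) = - (R' *\<^sub>v (K2 *\<^sub>v unit_vec q j))"
          using R' K12 by (intro eq_vecI) (auto simp: mult_mat_vec_def scalar_prod_def sum_negf)
        have c: "f *\<^sub>v z \<in> carrier_vec n'" "R' *\<^sub>v (K2 *\<^sub>v unit_vec q j) \<in> carrier_vec n'"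
          using f zn R' K12 by auto
        have s: "f *\<^sub>v z + R' *\<^sub>v (K2 *\<^sub>v unit_vec q j) = 0\<^sub>v n'" using key2[OF u] unfolding z_def .
        show ?thesis unfolding 1 using vec_add_eq_zeroD[OF c s] .
      qed
      then have "f *\<^sub>v z \<in> mat_range R'" using R' K12 unfolding mat_range_def by auto
      then show ?thesis using bnd[OF zk] R'(3) R(3) zc by simp
    qed
    ultimately show ?thesis
      using inj_mat_range_le[of "B * K1" n q R l] B K12 R q_def by auto
  qed
  moreover have "kernel_dim W + vec_space.rank k' W = k + l'" using kernel_dim_add_rank[OF W] .
  moreover have "vec_space.rank k' W \<le> k'" by (rule rank_le_row[OF W])
  ultimately show ?thesis unfolding k_def k'_def l_def l'_def by linarith
qed


lemma rank_le_kernel_dim: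
  fixes A :: "'a :: field mat"
  assumes A: "A \<in> carrier_mat r n" and B: "B \<in> carrier_mat n c" and z: "A * B = 0\<^sub>m r c"
  shows "vec_space.rank n B \<le> kernel_dim A"
proof -
  obtain X where X: "X \<in> carrier_mat n (vec_space.rank n B)" "inj_mat X" "mat_range X = mat_range B"
    by (rule range_basis_mat[OF B])
  obtain Y where Y: "Y \<in> carrier_mat n (kernel_dim A)" "mat_range Y = mat_kernel A"
    by (rule kernel_basis_mat[OF A])
  have "col X j \<in> mat_range Y" if "j < vec_space.rank n B" for j
  proof -
    have "col X j \<in> mat_range X" using mat_mult_unit_vec[OF X(1) that] mat_rangeI[OF X(1) unit_vec_carrier] by metis
    then obtain y where y: "y \<in> carrier_vec c" "col X j = B *\<^sub>v y" unfolding X(3) by (rule mat_rangeE[OF _ B])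
    have "A *\<^sub>v (B *\<^sub>v y) = 0\<^sub>v r"
      unfolding assoc_mult_mat_vec[OF A B y(1), symmetric] z using y(1) by (intro eq_vecI) auto
    then show ?thesis unfolding Y(2) y(2) using B y(1) by (intro mat_kernelI[OF A]) auto
  qed
  then show ?thesis by (rule inj_mat_range_le[OF X(1,2) Y(1)])
qed

section \<open>Ranks of integer matrices modulo a prime\<close>

context
  fixes p :: nat
  assumes prime_p: "prime p" and card_k: "CARD('k :: field) = p"
begin

text \<open>Translation by 1 permutes the field and hence fixes the sum of all elements, which
  forces \<open>p\<close> times 1 to vanish.\<close>

lemma CHAR_eq_card: "CHAR('k) = p"
proof -
  have fin: "finite (UNIV :: 'k set)" using prime_p card_k by (metis card.infinite not_prime_0)
  have "(\<Sum>x\<in>(UNIV :: 'k set). x + 1) = (\<Sum>x\<in>(UNIV :: 'k set). x)"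
    by (rule sum.reindex_bij_witness[of _ "\<lambda>x. x - 1" "\<lambda>x. x + 1"]) auto
  then have "of_nat p = (0 :: 'k)" by (simp add: sum.distrib card_k)
  then have "CHAR('k) dvd p" by (simp add: of_nat_eq_0_iff_char_dvd)
  then show ?thesis using prime_p CHAR_not_1[where ?'a = 'k] by (metis One_nat_def prime_nat_iff)
qed

lemma of_int_eq_0_iff_dvd: "(of_int x :: 'k) = 0 \<longleftrightarrow> int p dvd x"
  using of_int_eq_0_iff_char_dvd[where ?'a = 'k, of x] by (simp add: CHAR_eq_card)

text \<open>The residues below \<open>p\<close> are distinct in the field and already exhaust it by
  counting. This is what allows matrices over \<open>'k\<close> to be lifted to the
  integers.\<close>

lemma surj_of_int: "surj (of_int :: int \<Rightarrow> 'k)"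
proof -
  have "inj_on (of_nat :: nat \<Rightarrow> 'k) {..<p}"
  proof (rule inj_onI)
    fix x y assume "x \<in> {..<p}" "y \<in> {..<p}" "(of_nat x :: 'k) = of_nat y"
    moreover from this have "(of_int (int x - int y) :: 'k) = 0" by simp
    then have "int p dvd int x - int y" by (simp only: of_int_eq_0_iff_dvd)
    ultimately show "x = y" using zdvd_imp_le[of "int p" "int x - int y"] zdvd_imp_le[of "int p" "int y - int x"]
      by (cases x y rule: linorder_cases) (auto simp: dvd_diff_commute)
  qed
  then have "card ((of_nat :: nat \<Rightarrow> 'k) ` {..<p}) = CARD('k)" by (simp add: card_image card_k)
  moreover have "finite (UNIV :: 'k set)" using prime_p card_k by (metis card.infinite not_prime_0)
  ultimately have "(of_nat :: nat \<Rightarrow> 'k) ` {..<p} = UNIV" by (intro card_subset_eq) auto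
  moreover have "range (of_nat :: nat \<Rightarrow> 'k) \<subseteq> range of_int" by (metis image_subsetI of_int_of_nat_eq rangeI)
  ultimately show ?thesis by (metis image_mono subset_UNIV top.extremum_uniqueI)
qed

text \<open>Descent: clear denominators in a rational kernel vector and take a nonzero integral one
  of least absolute sum. Its entries are not all divisible by \<open>p\<close>, since dividing would
  give a smaller one, so it reduces to a nonzero kernel vector modulo \<open>p\<close>.\<close>

lemma inj_mat_rat_of_mod:
  fixes X :: "int mat"
  assumes X: "X \<in> carrier_mat n s" and inj: "inj_mat (map_mat of_int X :: 'k mat)"
  shows "inj_mat (map_mat of_int X :: rat mat)"
proof (rule ccontr)
  assume "\<not> ?thesis"
  then obtain v :: "rat vec" where v: "v \<in> carrier_vec s" "v \<noteq> 0\<^sub>v s" and z: "map_mat of_int X *\<^sub>v v = 0\<^sub>v n"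
    using X unfolding inj_mat_def by auto
  define N where "N = (\<Prod>i<s. snd (quotient_of (v $ i)))"
  have N: "N > 0" unfolding N_def by (intro prod_pos) (simp add: quotient_of_denom_pos')
  have "\<exists>t :: int. of_int t = of_int N * v $ i" if "i < s" for i
  proof -
    obtain a b where ab: "quotient_of (v $ i) = (a, b)" by fastforce
    define P where "P = (\<Prod>j\<in>{..<s}-{i}. snd (quotient_of (v $ j)))"
    have "N = snd (quotient_of (v $ i)) * P"
      unfolding N_def P_def using that by (intro prod.remove) auto
    then have 1: "of_int N = (of_int b * of_int P :: rat)" by (simp add: ab)
    have 2: "v $ i = of_int a / of_int b" using quotient_of_div[OF ab] .
    have 3: "of_int b \<noteq> (0 :: rat)" using quotient_of_denom_pos[OF ab] by simp
    have "of_int (P * a) = of_int N * v $ i" unfolding 1 2 using 3 by simp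
    then show ?thesis by blast
  qed
  then obtain t :: "nat \<Rightarrow> int" where t: "\<And>i. i < s \<Longrightarrow> of_int (t i) = of_int N * v $ i" by metis
  let ?P = "\<lambda>u :: nat \<Rightarrow> int. (\<exists>i<s. u i \<noteq> 0) \<and> (\<forall>r<n. (\<Sum>i<s. X $$ (r,i) * u i) = 0)"
  have "?P t"
  proof
    obtain i where "i < s" "v $ i \<noteq> 0" using v by (metis carrier_vecD eq_vecI index_zero_vec)
    then show "\<exists>i<s. t i \<noteq> 0" using t[of i] N by (intro exI[of _ i]) auto
    show "\<forall>r<n. (\<Sum>i<s. X $$ (r,i) * t i) = 0"
    proof (intro allI impI)
      fix r assume r: "r < n"
      have "of_int (\<Sum>i<s. X $$ (r,i) * t i) = of_int N * (\<Sum>i<s. of_int (X $$ (r,i)) * v $ i)"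
        by (simp add: t sum_distrib_left mult_ac)
      also have "(\<Sum>i<s. of_int (X $$ (r,i)) * v $ i) = (map_mat of_int X *\<^sub>v v) $ r"
        using r X v by (simp add: scalar_prod_def lessThan_atLeast0)
      also have "\<dots> = 0" using z r by simp
      finally show "(\<Sum>i<s. X $$ (r,i) * t i) = 0" by (metis mult_zero_right of_int_eq_0_iff)
    qed
  qed
  then obtain u where u: "?P u" and min: "\<And>u'. ?P u' \<Longrightarrow> (\<Sum>i<s. nat \<bar>u i\<bar>) \<le> (\<Sum>i<s. nat \<bar>u' i\<bar>)"
    using ex_has_least_nat[of ?P t "\<lambda>u. \<Sum>i<s. nat \<bar>u i\<bar>"] by blast
  have "\<exists>i<s. \<not> int p dvd u i"
  proof (rule ccontr)
    assume "\<not> ?thesis"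
    then have d: "u i = int p * (u i div int p)" if "i < s" for i using that by auto
    have p1: "p > 1" using prime_p prime_gt_1_nat by blast
    let ?u = "\<lambda>i. u i div int p"
    have "?P ?u"
    proof
      obtain i where "i < s" "u i \<noteq> 0" using u by blast
      moreover from this have "?u i \<noteq> 0" by (metis d mult_zero_right)
      ultimately show "\<exists>i<s. ?u i \<noteq> 0" by blast
      show "\<forall>r<n. (\<Sum>i<s. X $$ (r,i) * ?u i) = 0"
      proof (intro allI impI)
        fix r assume "r < n"
        then have "0 = (\<Sum>i<s. X $$ (r,i) * u i)" using u by simp
        also have "\<dots> = (\<Sum>i<s. X $$ (r,i) * (int p * ?u i))" by (intro sum.cong refl) (metis d lessThan_iff)
        also have "\<dots> = int p * (\<Sum>i<s. X $$ (r,i) * ?u i)" by (simp add: sum_distrib_left mult_ac)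
        finally show "(\<Sum>i<s. X $$ (r,i) * ?u i) = 0" using p1 by simp
      qed
    qed
    then have le: "(\<Sum>i<s. nat \<bar>u i\<bar>) \<le> (\<Sum>i<s. nat \<bar>?u i\<bar>)" by (rule min)
    have aux: "nat \<bar>int p * z\<bar> = p * nat \<bar>z\<bar>" for z :: int by (simp add: abs_mult nat_mult_distrib)
    have eq: "nat \<bar>u i\<bar> = p * nat \<bar>?u i\<bar>" if "i < s" for i
      using arg_cong[OF d[OF that], of "\<lambda>z. nat \<bar>z\<bar>"] unfolding aux .
    define g where "g = (\<lambda>i. nat \<bar>?u i\<bar>)"
    have "(\<Sum>i<s. nat \<bar>u i\<bar>) = (\<Sum>i<s. p * g i)"
      using eq unfolding g_def by (intro sum.cong refl) blast
    also have "\<dots> = p * sum g {..<s}" by (simp only: sum_distrib_left)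
    finally have "p * sum g {..<s} \<le> sum g {..<s}" using le unfolding g_def by (simp only:)
    moreover have "sum g {..<s} > 0"
    proof -
      obtain i where i: "i < s" "?u i \<noteq> 0" using \<open>?P ?u\<close> by blast
      then have "0 < g i" unfolding g_def by (simp only: zero_less_nat_eq zero_less_abs_iff simp_thms)
      then show ?thesis using i(1) by (intro sum_pos2[of _ i]) auto
    qed
    ultimately show False using p1 by simp
  qed
  then obtain i where i: "i < s" "\<not> int p dvd u i" by blast
  define w :: "'k vec" where "w = vec s (\<lambda>i. of_int (u i))"
  have "map_mat of_int X *\<^sub>v w = 0\<^sub>v n"
  proof (rule eq_vecI)
    fix r assume r: "r < dim_vec (0\<^sub>v n :: 'k vec)"
    have "(map_mat of_int X *\<^sub>v w) $ r = (\<Sum>i<s. of_int (X $$ (r,i)) * of_int (u i))"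
      using r X by (simp add: scalar_prod_def lessThan_atLeast0 w_def)
    also have "\<dots> = of_int (\<Sum>i<s. X $$ (r,i) * u i)" by simp
    also have "(\<Sum>i<s. X $$ (r,i) * u i) = 0" using u r by auto
    also have "of_int 0 = (0 :: 'k)" by simp
    finally show "(map_mat of_int X *\<^sub>v w) $ r = 0\<^sub>v n $ r" using r by simp
  qed (use X in auto)
  moreover have "w \<in> carrier_vec s" unfolding w_def by simp
  ultimately have "w = 0\<^sub>v s" using inj[unfolded inj_mat_def, rule_format, of w] X by simp
  then have "w $ i = 0" using i(1) by simp
  moreover have "w $ i = of_int (u i)" unfolding w_def by (rule index_vec[OF i(1)])
  ultimately have "(of_int (u i) :: 'k) = 0" by (rule back_subst[where P = "\<lambda>x. x = 0"])
  then have "int p dvd u i" by (rule of_int_eq_0_iff_dvd[THEN iffD1])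
  with i(2) show False by contradiction
qed


lemma int_mat_lift:
  fixes C :: "'k mat"
  assumes C: "C \<in> carrier_mat r s"
  obtains E :: "int mat" where "E \<in> carrier_mat r s" "map_mat of_int E = C"
proof -
  obtain f :: "'k \<Rightarrow> int" where f: "\<And>x. of_int (f x) = x" using surj_of_int by (metis surjD)
  have "map_mat f C \<in> carrier_mat r s" "map_mat of_int (map_mat f C) = C"
    using C by (auto intro!: eq_matI simp: f)
  then show ?thesis by (rule that)
qed

text \<open>The basis modulo \<open>p\<close> is lifted in the form \<open>A * E\<close>, not entry
  by entry, so that over the rationals its columns still lie in the range of
  \<open>A\<close>.\<close>

lemma int_range_basis:
  fixes A :: "int mat"
  assumes A: "A \<in> carrier_mat n c"
  obtains E where "E \<in> carrier_mat c (vec_space.rank n (map_mat of_int A :: 'k mat))"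
    "inj_mat (map_mat of_int (A * E) :: 'k mat)"
proof -
  let ?A = "map_mat of_int A :: 'k mat"
  let ?r = "vec_space.rank n ?A"
  have A': "?A \<in> carrier_mat n c" using A by simp
  obtain X where X: "X \<in> carrier_mat n ?r" "inj_mat X" "mat_range X = mat_range ?A"
    by (rule range_basis_mat[OF A'])
  have "\<exists>x \<in> carrier_vec c. ?A *\<^sub>v x = col X j" if "j < ?r" for j
  proof -
    have "col X j = X *\<^sub>v unit_vec ?r j" using mat_mult_unit_vec[OF X(1) that] by simp
    then have "col X j \<in> mat_range ?A" using X unfolding X(3)[symmetric] mat_range_def by auto
    then show ?thesis using A' unfolding mat_range_def by auto
  qed
  then obtain C where C: "C \<in> carrier_mat c ?r" "?A * C = X"
    using ex_mat_mult_eq[OF A' X(1), of "carrier_vec c"] by auto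
  obtain E :: "int mat" where E: "E \<in> carrier_mat c ?r" "map_mat of_int E = C"
    by (rule int_mat_lift[OF C(1)])
  have "map_mat of_int (A * E) = X"
    using C(2) E of_int_hom.mat_hom_mult[OF A E(1), where ?'a = 'k] by simp
  then show ?thesis using that[OF E(1)] X(2) by simp
qed

lemma rank_mod_le_rank_rat:
  fixes A :: "int mat"
  assumes A: "A \<in> carrier_mat n c"
  shows "vec_space.rank n (map_mat of_int A :: 'k mat) \<le> vec_space.rank n (map_mat of_int A :: rat mat)"
proof -
  let ?r = "vec_space.rank n (map_mat of_int A :: 'k mat)"
  obtain E where E: "E \<in> carrier_mat c ?r" "inj_mat (map_mat of_int (A * E) :: 'k mat)"
    by (rule int_range_basis[OF A])
  have AE: "A * E \<in> carrier_mat n ?r" using A E by simp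
  let ?X = "map_mat of_int (A * E) :: rat mat"
  have "inj_mat ?X" by (rule inj_mat_rat_of_mod[OF AE E(2)])
  moreover have "col ?X j \<in> mat_range (map_mat of_int A :: rat mat)" if "j < ?r" for j
  proof -
    have "col ?X j = map_mat of_int A *\<^sub>v col (map_mat of_int E) j"
      unfolding of_int_hom.mat_hom_mult[OF A E(1)] using A E that by (intro col_mult2) auto
    moreover have "col (map_mat of_int E) j \<in> carrier_vec c" using E(1) by (intro col_carrier_vec) (use that in auto)
    ultimately show ?thesis using A by (auto intro!: mat_rangeI)
  qed
  ultimately show ?thesis using AE A by (intro rank_ge_of_inj[of ?X]) auto
qed

text \<open>The vector \<open>v\<close> is a torsion class of the cokernel of \<open>A\<close> that survives modulo \<open>p\<close>, as
  detected by the functional \<open>\<phi>\<close>.\<close>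

lemma rank_mod_less_rank_rat:
  fixes A :: "int mat"
  assumes A: "A \<in> carrier_mat n c" and w: "w \<in> carrier_vec c" and v: "v \<in> carrier_vec n"
    and Aw: "A *\<^sub>v w = int p \<cdot>\<^sub>v v"
    and \<phi>: "\<phi> \<in> carrier_vec n" "\<And>j. j < c \<Longrightarrow> \<phi> \<bullet> map_vec of_int (col A j) = (0 :: 'k)"
    and \<phi>v: "\<phi> \<bullet> map_vec of_int v \<noteq> 0"
  shows "vec_space.rank n (map_mat of_int A :: 'k mat) < vec_space.rank n (map_mat of_int A :: rat mat)"
proof -
  let ?A = "map_mat of_int A :: 'k mat"
  let ?r = "vec_space.rank n ?A"
  obtain E where E: "E \<in> carrier_mat c ?r" "inj_mat (map_mat of_int (A * E) :: 'k mat)"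
    by (rule int_range_basis[OF A])
  define Y where "Y = A * E"
  have AE: "Y \<in> carrier_mat n ?r" using A E unfolding Y_def by simp
  have hom: "map_mat of_int (A * E) = ?A * map_mat of_int E"
    by (rule of_int_hom.mat_hom_mult[OF A E(1)])
  \<comment> \<open>\<open>X\<close> is a basis of the column space modulo \<open>p\<close> with
    \<open>v\<close> appended. As \<phi> kills the columns of \<open>A\<close> but not
    \<open>v\<close>, the columns of \<open>X\<close> are independent modulo \<open>p\<close>, hence
    over the rationals; there \<open>v\<close> is the image of \<open>w\<close> divided by
    \<open>p\<close>, so all of them lie in the range of \<open>A\<close>.\<close>
  define X where "X = mat n (Suc ?r) (\<lambda>(i,j). if j < ?r then Y $$ (i,j) else v $ i)"
  have X: "X \<in> carrier_mat n (Suc ?r)" unfolding X_def by simp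
  let ?X = "map_mat of_int X :: 'k mat"
  have colX: "col ?X j = col (map_mat of_int Y) j" if "j < ?r" for j
    using that AE by (intro eq_vecI) (auto simp: X_def)
  have colXr: "col ?X ?r = map_vec of_int v" using v by (intro eq_vecI) (auto simp: X_def)
  have A0: "transpose_mat ?A *\<^sub>v \<phi> = 0\<^sub>v c"
  proof (rule eq_vecI)
    fix j assume "j < dim_vec (0\<^sub>v c :: 'k vec)"
    then have j: "j < c" by simp
    have "col ?A j = map_vec of_int (col A j)" using j A by (intro eq_vecI) auto
    moreover have "map_vec of_int (col A j) \<bullet> \<phi> = \<phi> \<bullet> map_vec of_int (col A j)"
      using A \<phi>(1) by (intro comm_scalar_prod[of _ n]) auto
    ultimately show "(transpose_mat ?A *\<^sub>v \<phi>) $ j = 0\<^sub>v c $ j" using \<phi>(2)[OF j] j A by simp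
  qed (use A in auto)
  have phi_col: "\<phi> \<bullet> col ?X j = 0" if "j < ?r" for j
  proof -
    have "col ?X j = ?A *\<^sub>v col (map_mat of_int E) j"
      unfolding colX[OF that] Y_def hom using A E that by (intro col_mult2) auto
    then have "\<phi> \<bullet> col ?X j = (transpose_mat ?A *\<^sub>v \<phi>) \<bullet> col (map_mat of_int E) j"
      using A E \<phi>(1) that by (subst transpose_vec_mult_scalar[of _ n c]) auto
    then show ?thesis unfolding A0 using E that by simp
  qed
  have "inj_mat ?X"
    unfolding inj_mat_def
  proof (intro ballI impI)
    fix u assume "u \<in> carrier_vec (dim_col ?X)" and z: "?X *\<^sub>v u = 0\<^sub>v (dim_row ?X)"
    then have u: "u \<in> carrier_vec (Suc ?r)" using X by simp
    have "0 = \<phi> \<bullet> (?X *\<^sub>v u)" unfolding z using \<phi>(1) X by simp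
    also have "\<dots> = (transpose_mat ?X *\<^sub>v \<phi>) \<bullet> u"
      using X u \<phi>(1) by (subst transpose_vec_mult_scalar[of _ n "Suc ?r"]) auto
    also have "\<dots> = (\<Sum>j<Suc ?r. (\<phi> \<bullet> col ?X j) * u $ j)"
      using X u \<phi>(1) by (auto simp: scalar_prod_def lessThan_atLeast0 mult_ac intro!: sum.cong)
    also have "\<dots> = (\<phi> \<bullet> map_vec of_int v) * u $ ?r"
      using phi_col by (simp add: colXr)
    finally have ur: "u $ ?r = 0" using \<phi>v by simp
    define u' where "u' = vec ?r (\<lambda>j. u $ j)"
    have u': "u' \<in> carrier_vec ?r" unfolding u'_def by simp
    have "map_mat of_int Y *\<^sub>v u' = (0\<^sub>v n :: 'k vec)"
    proof (rule eq_vecI)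
      fix i assume "i < dim_vec (0\<^sub>v n :: 'k vec)"
      then have i: "i < n" by simp
      have "0 = (?X *\<^sub>v u) $ i" unfolding z using i X by simp
      also have "\<dots> = (\<Sum>j<Suc ?r. ?X $$ (i,j) * u $ j)"
        using i X u by (simp add: scalar_prod_def lessThan_atLeast0)
      also have "\<dots> = (\<Sum>j<?r. of_int (Y $$ (i,j)) * u' $ j)"
        using i ur by (auto simp: X_def u'_def intro!: sum.cong)
      also have "\<dots> = (map_mat of_int Y *\<^sub>v u') $ i"
        using i AE u' by (simp add: scalar_prod_def lessThan_atLeast0)
      finally show "(map_mat of_int Y *\<^sub>v u') $ i = 0\<^sub>v n $ i" using i by simp
    qed (use AE in auto)
    then have "u' = 0\<^sub>v ?r" using E(2)[folded Y_def, unfolded inj_mat_def, rule_format, of u'] u' AE by simp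
    then have "u $ j = 0" if "j < ?r" for j using that unfolding u'_def by (metis index_vec index_zero_vec(1))
    then have "u $ j = 0" if "j < Suc ?r" for j using that ur by (cases "j = ?r") auto
    then show "u = 0\<^sub>v (dim_col ?X)" using X u by (intro eq_vecI) auto
  qed
  then have injQ: "inj_mat (map_mat of_int X :: rat mat)" by (rule inj_mat_rat_of_mod[OF X])
  let ?XQ = "map_mat of_int X :: rat mat" and ?AQ = "map_mat of_int A :: rat mat"
  have "col ?XQ j \<in> mat_range ?AQ" if j: "j < Suc ?r" for j
  proof (cases "j < ?r")
    case True
    have "col ?XQ j = col (map_mat of_int Y) j"
      using True AE by (intro eq_vecI) (auto simp: X_def)
    also have "\<dots> = ?AQ *\<^sub>v col (map_mat of_int E) j"
      unfolding Y_def of_int_hom.mat_hom_mult[OF A E(1)] using A E True by (intro col_mult2) auto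
    finally have "col ?XQ j = ?AQ *\<^sub>v col (map_mat of_int E) j" .
    moreover have "col (map_mat of_int E) j \<in> carrier_vec c" using E(1) by (intro col_carrier_vec) (use True in auto)
    ultimately show ?thesis using A by (auto intro!: mat_rangeI)
  next
    case False
    then have j: "j = ?r" using that by simp
    have p0: "rat_of_nat p \<noteq> 0" using prime_p by auto
    have "col ?XQ j = map_vec of_int v" using v j by (intro eq_vecI) (auto simp: X_def)
    also have "\<dots> = ?AQ *\<^sub>v ((1 / of_nat p) \<cdot>\<^sub>v map_vec of_int w)"
    proof (rule eq_vecI)
      fix i assume "i < dim_vec (?AQ *\<^sub>v ((1 / of_nat p) \<cdot>\<^sub>v map_vec of_int w))"
      then have i: "i < n" using A by simp
      have "of_nat p * rat_of_int (v $ i) = of_int ((int p \<cdot>\<^sub>v v) $ i)" using i v by simp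
      also have "\<dots> = of_int ((A *\<^sub>v w) $ i)" unfolding Aw ..
      also have "\<dots> = (\<Sum>j<c. of_int (A $$ (i,j)) * of_int (w $ j))"
        using i A w by (simp add: scalar_prod_def lessThan_atLeast0)
      finally have *: "of_nat p * rat_of_int (v $ i) = (\<Sum>j<c. of_int (A $$ (i,j)) * of_int (w $ j))" .
      have "(?AQ *\<^sub>v ((1 / of_nat p) \<cdot>\<^sub>v map_vec of_int w)) $ i =
        (\<Sum>j<c. of_int (A $$ (i,j)) * (1 / of_nat p * of_int (w $ j)))"
        using i A w by (simp add: scalar_prod_def lessThan_atLeast0)
      also have "\<dots> = 1 / of_nat p * (\<Sum>j<c. of_int (A $$ (i,j)) * of_int (w $ j))"
        by (simp add: sum_distrib_left mult_ac)
      also have "\<dots> = of_int (v $ i)" unfolding *[symmetric] using p0 by simp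
      finally show "(map_vec of_int v) $ i = (?AQ *\<^sub>v ((1 / of_nat p) \<cdot>\<^sub>v map_vec of_int w)) $ i"
        using i v by simp
    qed (use A v in auto)
    finally show ?thesis using A w unfolding mat_range_def by auto
  qed
  then have "Suc ?r \<le> vec_space.rank n ?AQ"
    using X A injQ by (intro rank_ge_of_inj[of ?XQ n "Suc ?r"]) auto
  then show ?thesis by simp
qed

end

section \<open>Independence of Betti numbers of the resolution\<close>

lemma mpolys_zero [simp]: "0 \<in> mpolys n" and mpolys_one [simp]: "1 \<in> mpolys n"
  by (auto simp: mpolys_def)

lemma mpolys_add [intro]: "f \<in> mpolys n \<Longrightarrow> g \<in> mpolys n \<Longrightarrow> f + g \<in> mpolys n"
  using keys_add[of f g] unfolding mpolys_def by blast

lemma mpolys_uminus [intro]: "f \<in> mpolys n \<Longrightarrow> - f \<in> mpolys n"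
  unfolding mpolys_def by (simp add: Poly_Mapping.keys_minus in_keys_iff)

lemma mpolys_minus [intro]: "f \<in> mpolys n \<Longrightarrow> g \<in> mpolys n \<Longrightarrow> f - g \<in> mpolys n"
  using mpolys_add[of f n "- g"] mpolys_uminus[of g n] by simp

lemma mpolys_mult [intro]:
  assumes "f \<in> mpolys n" "g \<in> mpolys n"
  shows "f * g \<in> mpolys n"
  unfolding mpolys_def
proof (intro CollectI ballI)
  fix m assume "m \<in> Poly_Mapping.keys (f * g)"
  then obtain a b where "a \<in> Poly_Mapping.keys f" "b \<in> Poly_Mapping.keys g" "m = a + b"
    using keys_mult by blast
  then show "Poly_Mapping.keys m \<subseteq> {1..n}"
    using assms keys_add[of a b] unfolding mpolys_def by blast
qed

lemma mpolys_sum [intro]: "(\<And>i. i \<in> S \<Longrightarrow> f i \<in> mpolys n) \<Longrightarrow> sum f S \<in> mpolys n"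
  by (induction S rule: infinite_finite_induct) auto

lemma free_homI:
  assumes "A \<in> carrier_mat r c" "\<And>i j. i < r \<Longrightarrow> j < c \<Longrightarrow> A $$ (i,j) \<in> mpolys n"
  shows "A \<in> free_hom n r c"
  using assms unfolding free_hom_def by (auto simp: elements_mat_def)

lemma free_homD:
  assumes "A \<in> free_hom n r c"
  shows "A \<in> carrier_mat r c" "\<And>i j. i < r \<Longrightarrow> j < c \<Longrightarrow> A $$ (i,j) \<in> mpolys n"
  using assms unfolding free_hom_def by (fastforce simp: elements_mat_def)+

lemma free_modI:
  assumes "v \<in> carrier_vec m" "\<And>i. i < m \<Longrightarrow> v $ i \<in> mpolys n"
  shows "v \<in> free_mod n m"
  using assms unfolding free_mod_def by (auto simp: vec_set_def)

lemma free_modD: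
  assumes "v \<in> free_mod n m"
  shows "v \<in> carrier_vec m" "\<And>i. i < m \<Longrightarrow> v $ i \<in> mpolys n"
  using assms unfolding free_mod_def by (auto simp: vec_set_def subset_iff)

lemma free_hom_mult [intro]:
  assumes "A \<in> free_hom n r s" "B \<in> free_hom n s c"
  shows "A * B \<in> free_hom n r c"
proof (rule free_homI)
  show "A * B \<in> carrier_mat r c" using free_homD(1)[OF assms(1)] free_homD(1)[OF assms(2)] by simp
  fix i j assume "i < r" "j < c"
  then show "(A * B) $$ (i,j) \<in> mpolys n"
    using free_homD[OF assms(1)] free_homD[OF assms(2)]
    by (auto simp: scalar_prod_def intro!: mpolys_sum mpolys_mult)
qed

lemma free_hom_minus [intro]:
  assumes "A \<in> free_hom n r s" "B \<in> free_hom n r s"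
  shows "A - B \<in> free_hom n r s"
  using free_homD[OF assms(1)] free_homD[OF assms(2)] by (intro free_homI) auto

lemma free_hom_one [simp]: "1\<^sub>m r \<in> free_hom n r r"
  by (intro free_homI) auto

lemma free_hom_mult_vec [intro]:
  assumes "A \<in> free_hom n r s" "v \<in> free_mod n s"
  shows "A *\<^sub>v v \<in> free_mod n r"
proof (rule free_modI)
  show "A *\<^sub>v v \<in> carrier_vec r" using free_homD(1)[OF assms(1)] free_modD(1)[OF assms(2)] by simp
  fix i assume "i < r"
  then show "(A *\<^sub>v v) $ i \<in> mpolys n"
    using free_homD[OF assms(1)] free_modD[OF assms(2)] by (auto simp: scalar_prod_def intro!: mpolys_sum mpolys_mult)
qed

lemma free_hom_col:
  assumes "A \<in> free_hom n r s" "j < s"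
  shows "col A j \<in> free_mod n r"
  using free_homD[OF assms(1)] assms(2) by (intro free_modI) auto

lemma free_hom_lift:
  assumes E: "E \<in> free_hom n r s" and A: "A \<in> free_hom n r c"
    and cols: "\<And>j. j < c \<Longrightarrow> col A j \<in> (\<lambda>w. E *\<^sub>v w) ` free_mod n s"
  obtains X where "X \<in> free_hom n s c" "E * X = A"
proof -
  have "\<exists>x \<in> free_mod n s. E *\<^sub>v x = col A j" if "j < c" for j
    using cols[OF that] by auto
  moreover have "free_mod n s \<subseteq> (carrier_vec s :: 'a mpoly vec set)" by (auto dest: free_modD)
  ultimately obtain C where C: "C \<in> carrier_mat s c" "\<forall>j<c. col C j \<in> free_mod n s" "E * C = A"
    using ex_mat_mult_eq[OF free_homD(1)[OF E] free_homD(1)[OF A], of "free_mod n s"] by auto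
  have "C \<in> free_hom n s c"
  proof (rule free_homI[OF C(1)])
    fix i j assume "i < s" "j < c"
    then show "C $$ (i,j) \<in> mpolys n" using C(1,2) free_modD(2)[of "col C j" n s i] by auto
  qed
  then show ?thesis using C(3) that by blast
qed

text \<open>An augmented resolution \<open>\<dots> \<rightarrow> F\<^sub>1 \<rightarrow> F\<^sub>0 \<rightarrow> R\<close>, where the image of
  \<open>E 0 : F\<^sub>0 \<rightarrow> R\<close> is the ideal. The rank of \<open>F\<^sub>j\<close> is \<open>B (Suc j)\<close>, and \<open>B 0 = 1\<close>.\<close>

locale augmented_resolution =
  fixes n :: nat and I :: "'k::field mpoly set" and B :: "nat \<Rightarrow> nat" and E :: "nat \<Rightarrow> 'k mpoly mat"
  assumes B0: "B 0 = 1"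
    and hom: "\<And>j. E j \<in> free_hom n (B j) (B (Suc j))"
    and aug: "{v $ 0 | v. v \<in> (\<lambda>w. E 0 *\<^sub>v w) ` free_mod n (B 1)} = I"
    and exact: "\<And>j. {v \<in> free_mod n (B (Suc j)). E j *\<^sub>v v = 0\<^sub>v (B j)}
                 = (\<lambda>w. E (Suc j) *\<^sub>v w) ` free_mod n (B (Suc (Suc j)))"
begin

lemma carrier: "E j \<in> carrier_mat (B j) (B (Suc j))"
  using free_homD(1)[OF hom] .

lemma comp_zero: "E j * E (Suc j) = 0\<^sub>m (B j) (B (Suc (Suc j)))"
proof (rule mat_col_eqI)
  fix i assume "i < dim_col (0\<^sub>m (B j) (B (Suc (Suc j))) :: 'k mpoly mat)"
  then have i: "i < B (Suc (Suc j))" by simp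
  have "unit_vec (B (Suc (Suc j))) i \<in> free_mod n (B (Suc (Suc j)))"
    by (intro free_modI) (auto simp: unit_vec_def)
  then have "E (Suc j) *\<^sub>v unit_vec (B (Suc (Suc j))) i \<in> {v \<in> free_mod n (B (Suc j)). E j *\<^sub>v v = 0\<^sub>v (B j)}"
    unfolding exact by blast
  then have "E j *\<^sub>v col (E (Suc j)) i = 0\<^sub>v (B j)"
    using mat_mult_unit_vec[OF carrier i] by simp
  then show "col (E j * E (Suc j)) i = col (0\<^sub>m (B j) (B (Suc (Suc j)))) i"
    using col_mult2[OF carrier carrier i] i by simp
qed (use carrier in auto)

lemma lift:
  assumes A: "A \<in> free_hom n (B (Suc j)) c" and z: "E j * A = 0\<^sub>m (B j) c"
  obtains X where "X \<in> free_hom n (B (Suc (Suc j))) c" "E (Suc j) * X = A"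
proof (rule free_hom_lift[OF hom A])
  fix i assume i: "i < c"
  have "E j *\<^sub>v col A i = col (E j * A) i" using col_mult2[OF carrier free_homD(1)[OF A] i] by simp
  also have "\<dots> = 0\<^sub>v (B j)" unfolding z using i by simp
  finally show "col A i \<in> (\<lambda>w. E (Suc j) *\<^sub>v w) ` free_mod n (B (Suc (Suc j)))"
    unfolding exact[symmetric] using free_hom_col[OF A i] by simp
qed (use that in blast)

end

text \<open>With \<open>g\<close> as a one-row matrix in position 0, exactness at the first free
  module becomes an instance of the general condition; all indices shift by one.\<close>

lemma augmented_resolution_of_free_resolution:
  fixes I :: "'k::field mpoly set"
  assumes "free_resolution n I b g d"
  shows "augmented_resolution n I (case_nat 1 b) (case_nat (mat 1 (b 0) (\<lambda>(i,j). g $ j)) (\<lambda>j. d (Suc j)))"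
proof -
  note r = assms[unfolded free_resolution_def]
  let ?G = "mat 1 (b 0) (\<lambda>(i,j). g $ j)"
  have g: "g \<in> free_mod n (b 0)" using r by blast
  have G: "?G *\<^sub>v v = vec 1 (\<lambda>_. g \<bullet> v)" if "v \<in> free_mod n (b 0)" for v
    using free_modD(1)[OF that] free_modD(1)[OF g] by (intro eq_vecI) (auto simp: scalar_prod_def)
  show ?thesis
  proof
    fix j
    show "case_nat ?G (\<lambda>j. d (Suc j)) j \<in> free_hom n (case_nat 1 b j) (case_nat 1 b (Suc j))"
      using r free_modD(2)[OF g] by (cases j) (auto intro!: free_homI)
  next
    have "{v $ 0 |v. v \<in> (\<lambda>w. ?G *\<^sub>v w) ` free_mod n (b 0)} = (\<lambda>v. g \<bullet> v) ` free_mod n (b 0)"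
      using G by force
    then show "{v $ 0 |v. v \<in> (*\<^sub>v) (case_nat ?G (\<lambda>j. d (Suc j)) 0) ` free_mod n (case_nat 1 b 1)} = I"
      using r by simp
  next
    fix j
    show "{v \<in> free_mod n (case_nat 1 b (Suc j)). case_nat ?G (\<lambda>j. d (Suc j)) j *\<^sub>v v = 0\<^sub>v (case_nat 1 b j)} =
         (*\<^sub>v) (case_nat ?G (\<lambda>j. d (Suc j)) (Suc j)) ` free_mod n (case_nat 1 b (Suc (Suc j)))"
    proof (cases j)
      case 0
      have "?G *\<^sub>v v = 0\<^sub>v 1 \<longleftrightarrow> g \<bullet> v = 0" if "v \<in> free_mod n (b 0)" for v
        unfolding G[OF that] by (simp add: vec_eq_iff)
      then show ?thesis using r 0 by auto
    next
      case (Suc i)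
      have "{v \<in> free_mod n (b (Suc i)). d (Suc i) *\<^sub>v v = 0\<^sub>v (b (Suc i - 1))}
            = (\<lambda>w. d (Suc (Suc i)) *\<^sub>v w) ` free_mod n (b (Suc (Suc i)))"
        using conjunct2[OF conjunct2[OF conjunct2[OF conjunct2[OF conjunct2[OF r]]]], rule_format, of "Suc i"] by simp
      then show ?thesis using Suc by simp
    qed
  qed simp
qed

text \<open>The comparison theorem: free modules lift through exact complexes, one degree at a
  time.\<close>

lemma ex_chain_map:
  assumes F: "augmented_resolution n I B E" and F': "augmented_resolution n I B' E'"
  obtains f where "\<And>j. f j \<in> free_hom n (B' (Suc j)) (B (Suc j))" "E' 0 * f 0 = E 0"
    "\<And>j. E' (Suc j) * f (Suc j) = f j * E (Suc j)"
proof -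
  interpret F: augmented_resolution n I B E by (rule F)
  interpret F': augmented_resolution n I B' E' by (rule F')
  \<comment> \<open>The last conjunct is the invariant of the recursion: it places the columns of
    \<open>f * E (Suc j)\<close> in the kernel of \<open>E' j\<close>, where exactness lifts
    them.\<close>
  let ?P = "\<lambda>j f. f \<in> free_hom n (B' (Suc j)) (B (Suc j)) \<and> (j = 0 \<longrightarrow> E' 0 * f = E 0) \<and>
    E' j * (f * E (Suc j)) = 0\<^sub>m (B' j) (B (Suc (Suc j)))"
  let ?Q = "\<lambda>j f f'. E' (Suc j) * f' = f * E (Suc j)"
  have "\<exists>f. ?P 0 f"
  proof -
    have "\<exists>X. X \<in> free_hom n (B' (Suc 0)) (B (Suc 0)) \<and> E' 0 * X = E 0"
    proof (rule free_hom_lift)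
      show "E' 0 \<in> free_hom n 1 (B' (Suc 0))" "E 0 \<in> free_hom n 1 (B (Suc 0))"
        using F.hom[of 0] F'.hom[of 0] F.B0 F'.B0 by simp_all
      fix i assume i: "i < B (Suc 0)"
      let ?u = "unit_vec (B (Suc 0)) i"
      have u: "?u \<in> free_mod n (B 1)" by (intro free_modI) (auto simp: unit_vec_def)
      have col: "col (E 0) i = E 0 *\<^sub>v ?u" using mat_mult_unit_vec[OF F.carrier i] by simp
      then have "col (E 0) i $ 0 \<in> I" unfolding F.aug[symmetric] using u by blast
      then obtain w where w: "w \<in> free_mod n (B' 1)" "(E' 0 *\<^sub>v w) $ 0 = col (E 0) i $ 0"
        unfolding F'.aug[symmetric] by force
      have "E' 0 *\<^sub>v w = col (E 0) i"
        using w(2) F.carrier[of 0] F'.carrier[of 0] F.B0 F'.B0 by (intro eq_vecI) auto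
      then show "col (E 0) i \<in> (\<lambda>w. E' 0 *\<^sub>v w) ` free_mod n (B' (Suc 0))"
        using w(1) by (intro image_eqI[of _ _ w]) auto
    qed blast
    then obtain X where X: "X \<in> free_hom n (B' (Suc 0)) (B (Suc 0))" "E' 0 * X = E 0" by blast
    have "E' 0 * (X * E (Suc 0)) = E 0 * E (Suc 0)"
      using assoc_mult_mat[OF F'.carrier free_homD(1)[OF X(1)] F.carrier] X(2) by simp
    then show ?thesis using X F.comp_zero[of 0] F.B0 F'.B0 by auto
  qed
  moreover have "\<exists>f'. ?P (Suc j) f' \<and> ?Q j f f'" if P: "?P j f" for j f
  proof -
    have fE: "f * E (Suc j) \<in> free_hom n (B' (Suc j)) (B (Suc (Suc j)))" using P F.hom by blast
    obtain f' where f': "f' \<in> free_hom n (B' (Suc (Suc j))) (B (Suc (Suc j)))" "E' (Suc j) * f' = f * E (Suc j)"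
      using P by (auto intro: F'.lift[OF fE])
    have "E' (Suc j) * (f' * E (Suc (Suc j))) = (f * E (Suc j)) * E (Suc (Suc j))"
      using assoc_mult_mat[OF F'.carrier free_homD(1)[OF f'(1)] F.carrier] f'(2) by simp
    also have "\<dots> = f * (E (Suc j) * E (Suc (Suc j)))"
      using P by (intro assoc_mult_mat[OF _ F.carrier F.carrier]) (auto dest: free_homD(1))
    also have "\<dots> = 0\<^sub>m (B' (Suc j)) (B (Suc (Suc (Suc j))))"
      unfolding F.comp_zero using P by (intro right_mult_zero_mat) (auto dest: free_homD(1))
    finally show ?thesis using f' by auto
  qed
  ultimately obtain f where "\<And>j. ?P j (f j) \<and> ?Q j (f j) (f (Suc j))"
    using dependent_nat_choice[of ?P ?Q] by blast
  then show ?thesis using that[of f] by blast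
qed

text \<open>A chain endomorphism that covers the zero map of the ideal is null-homotopic; at each
  step the error \<open>u (Suc j) - s * E (Suc j)\<close> is a cycle and can be lifted.\<close>

lemma ex_homotopy:
  assumes F: "augmented_resolution n I B E"
    and u: "\<And>j. u j \<in> free_hom n (B (Suc j)) (B (Suc j))" "E 0 * u 0 = 0\<^sub>m (B 0) (B (Suc 0))"
      "\<And>j. E (Suc j) * u (Suc j) = u j * E (Suc j)"
  obtains s where "\<And>j. s j \<in> free_hom n (B (Suc (Suc j))) (B (Suc j))"
    "\<And>j. E (Suc (Suc j)) * s (Suc j) = u (Suc j) - s j * E (Suc j)"
proof -
  interpret F: augmented_resolution n I B E by (rule F)
  have uc: "u j \<in> carrier_mat (B (Suc j)) (B (Suc j))" for j using free_homD(1)[OF u(1)] .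
  let ?P = "\<lambda>j s. s \<in> free_hom n (B (Suc (Suc j))) (B (Suc j)) \<and>
    E (Suc j) * (u (Suc j) - s * E (Suc j)) = 0\<^sub>m (B (Suc j)) (B (Suc (Suc j)))"
  let ?Q = "\<lambda>j s s'. E (Suc (Suc j)) * s' = u (Suc j) - s * E (Suc j)"
  have "\<exists>s. ?P 0 s"
  proof -
    obtain s where s: "s \<in> free_hom n (B (Suc (Suc 0))) (B (Suc 0))" "E (Suc 0) * s = u 0"
      using F.lift[OF u(1)[of 0] u(2)] by blast
    have sc: "s \<in> carrier_mat (B (Suc (Suc 0))) (B (Suc 0))" using free_homD(1)[OF s(1)] .
    have "E (Suc 0) * (u (Suc 0) - s * E (Suc 0)) = E (Suc 0) * u (Suc 0) - E (Suc 0) * (s * E (Suc 0))"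
      by (rule mult_minus_distrib_mat[OF F.carrier uc mult_carrier_mat[OF sc F.carrier]])
    also have "E (Suc 0) * (s * E (Suc 0)) = u 0 * E (Suc 0)"
      using assoc_mult_mat[OF F.carrier sc F.carrier] s(2) by simp
    also have "E (Suc 0) * u (Suc 0) - u 0 * E (Suc 0) = 0\<^sub>m (B (Suc 0)) (B (Suc (Suc 0)))"
      unfolding u(3) by (intro minus_r_inv_mat mult_carrier_mat[OF uc F.carrier])
    finally show ?thesis using s(1) by blast
  qed
  moreover have "\<exists>s'. ?P (Suc j) s' \<and> ?Q j s s'" if P: "?P j s" for j s
  proof -
    have sc: "s \<in> carrier_mat (B (Suc (Suc j))) (B (Suc j))" using P free_homD(1) by blast
    have "u (Suc j) - s * E (Suc j) \<in> free_hom n (B (Suc (Suc j))) (B (Suc (Suc j)))" using P F.hom u by blast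
    then obtain s' where s': "s' \<in> free_hom n (B (Suc (Suc (Suc j)))) (B (Suc (Suc j)))"
      "E (Suc (Suc j)) * s' = u (Suc j) - s * E (Suc j)" using F.lift P by metis
    have sc': "s' \<in> carrier_mat (B (Suc (Suc (Suc j)))) (B (Suc (Suc j)))" using free_homD(1)[OF s'(1)] .
    have c: "E (Suc j) \<in> carrier_mat (B (Suc j)) (B (Suc (Suc j)))"
      "E (Suc (Suc j)) \<in> carrier_mat (B (Suc (Suc j))) (B (Suc (Suc (Suc j))))"
      "u (Suc j) \<in> carrier_mat (B (Suc (Suc j))) (B (Suc (Suc j)))"
      using F.carrier uc by auto
    have "E (Suc (Suc j)) * (u (Suc (Suc j)) - s' * E (Suc (Suc j))) =
        E (Suc (Suc j)) * u (Suc (Suc j)) - E (Suc (Suc j)) * (s' * E (Suc (Suc j)))"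
      by (rule mult_minus_distrib_mat[OF F.carrier uc mult_carrier_mat[OF sc' F.carrier]])
    also have "E (Suc (Suc j)) * (s' * E (Suc (Suc j))) = (u (Suc j) - s * E (Suc j)) * E (Suc (Suc j))"
      using assoc_mult_mat[OF F.carrier sc' F.carrier] s'(2) by simp
    also have "\<dots> = u (Suc j) * E (Suc (Suc j)) - (s * E (Suc j)) * E (Suc (Suc j))"
      using c sc by (intro minus_mult_distrib_mat) auto
    also have "(s * E (Suc j)) * E (Suc (Suc j)) = s * (E (Suc j) * E (Suc (Suc j)))"
      using assoc_mult_mat[OF sc F.carrier F.carrier] .
    also have "\<dots> = 0\<^sub>m (B (Suc (Suc j))) (B (Suc (Suc (Suc j))))"
      unfolding F.comp_zero using sc by (intro right_mult_zero_mat)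
    also have "u (Suc j) * E (Suc (Suc j)) - \<dots> = u (Suc j) * E (Suc (Suc j))"
      using c by (intro eq_matI) auto
    also have "E (Suc (Suc j)) * u (Suc (Suc j)) - \<dots> = 0\<^sub>m (B (Suc (Suc j))) (B (Suc (Suc (Suc j))))"
      unfolding u(3) using c by (intro minus_r_inv_mat) auto
    finally show ?thesis using s' by blast
  qed
  ultimately obtain s where "\<And>j. ?P j (s j) \<and> ?Q j (s j) (s (Suc j))"
    using dependent_nat_choice[of ?P ?Q] by blast
  then show ?thesis using that[of s] by blast
qed

lemma lookup_mult_zero:
  fixes f g :: "'k::field mpoly"
  shows "Poly_Mapping.lookup (f * g) 0 = Poly_Mapping.lookup f 0 * Poly_Mapping.lookup g 0"
proof -
  have "(\<Sum>q. Poly_Mapping.lookup g q when (0 :: nat \<Rightarrow>\<^sub>0 nat) = l + q) = (Poly_Mapping.lookup g 0 when l = 0)" for l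
  proof (cases "l = 0")
    case False
    then obtain x where "Poly_Mapping.lookup l x \<noteq> 0" by (auto simp: poly_mapping_eq_iff fun_eq_iff)
    then have "0 \<noteq> l + q" for q by (metis add_is_0 lookup_add lookup_zero)
    then show ?thesis using False by simp
  qed simp
  then have "Poly_Mapping.lookup (f * g) 0 =
      (\<Sum>l. Poly_Mapping.lookup f l * Poly_Mapping.lookup g 0 when l = 0)"
    by (simp add: lookup_mult mult_when)
  then show ?thesis by simp
qed

lemma tensor_field_mult:
  assumes A: "A \<in> carrier_mat r s" and B: "B \<in> carrier_mat s c"
  shows "tensor_field (A * B) = tensor_field A * tensor_field B"
  using A B by (intro eq_matI) (auto simp: tensor_field_def scalar_prod_def lookup_sum lookup_mult_zero)

lemma tensor_field_carrier [simp]: "tensor_field A \<in> carrier_mat r c \<longleftrightarrow> A \<in> carrier_mat r c"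
  unfolding tensor_field_def by simp

lemma tensor_field_minus:
  assumes A: "A \<in> carrier_mat r c" and B: "B \<in> carrier_mat r c"
  shows "tensor_field (A - B) = tensor_field A - tensor_field B"
  using A B by (intro eq_matI) (auto simp: tensor_field_def lookup_minus)

lemma tensor_field_one: "tensor_field (1\<^sub>m r) = 1\<^sub>m r"
  by (intro eq_matI) (auto simp: tensor_field_def)

lemma tensor_field_zero: "tensor_field (0\<^sub>m r c) = 0\<^sub>m r c"
  by (intro eq_matI) (auto simp: tensor_field_def)

text \<open>Take chain maps \<open>f\<close> and \<open>h\<close> between the two resolutions in
  opposite directions over the identity of the ideal. Since \<open>h f\<close> is homotopic to the
  identity, \<open>f\<close> stays injective on homology after tensoring. Exchanging the resolutions
  gives equality.\<close>

lemma homology_dim_le: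
  fixes I :: "'k::field mpoly set"
  assumes r: "free_resolution n I b g d" and r': "free_resolution n I b' g' d'"
  shows "homology_dim d (Suc j) \<le> homology_dim d' (Suc j)"
proof -
  define B E where "B = case_nat 1 b" and "E = case_nat (mat 1 (b 0) (\<lambda>(i,j). g $ j)) (\<lambda>j. d (Suc j))"
  define B' E' where "B' = case_nat 1 b'" and "E' = case_nat (mat 1 (b' 0) (\<lambda>(i,j). g' $ j)) (\<lambda>j. d' (Suc j))"
  interpret F: augmented_resolution n I B E
    unfolding B_def E_def by (rule augmented_resolution_of_free_resolution[OF r])
  interpret F': augmented_resolution n I B' E'
    unfolding B'_def E'_def by (rule augmented_resolution_of_free_resolution[OF r'])
  obtain f where f: "\<And>j. f j \<in> free_hom n (B' (Suc j)) (B (Suc j))" "E' 0 * f 0 = E 0"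
    "\<And>j. E' (Suc j) * f (Suc j) = f j * E (Suc j)"
    using ex_chain_map[OF F.augmented_resolution_axioms F'.augmented_resolution_axioms] by blast
  obtain h where h: "\<And>j. h j \<in> free_hom n (B (Suc j)) (B' (Suc j))" "E 0 * h 0 = E' 0"
    "\<And>j. E (Suc j) * h (Suc j) = h j * E' (Suc j)"
    using ex_chain_map[OF F'.augmented_resolution_axioms F.augmented_resolution_axioms] by blast
  note fc = free_homD(1)[OF f(1)] and hc = free_homD(1)[OF h(1)]
  define u where "u j = h j * f j - 1\<^sub>m (B (Suc j))" for j
  have hf: "h j * f j \<in> carrier_mat (B (Suc j)) (B (Suc j))" for j using mult_carrier_mat[OF hc fc] .
  have u1: "u j \<in> free_hom n (B (Suc j)) (B (Suc j))" for j unfolding u_def using f(1) h(1) by (meson free_hom_minus free_hom_mult free_hom_one)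
  have Eu: "E j * u j = E j * (h j * f j) - E j" for j
    unfolding u_def mult_minus_distrib_mat[OF F.carrier hf one_carrier_mat] right_mult_one_mat[OF F.carrier] ..
  have uE: "u j * E (Suc j) = h j * f j * E (Suc j) - E (Suc j)" for j
    unfolding u_def minus_mult_distrib_mat[OF hf one_carrier_mat F.carrier] using left_mult_one_mat[OF F.carrier[of "Suc j"]] by simp
  have u2: "E 0 * u 0 = 0\<^sub>m (B 0) (B (Suc 0))"
    unfolding Eu assoc_mult_mat[OF F.carrier hc fc, symmetric] h(2) f(2) by (rule minus_r_inv_mat[OF F.carrier])
  have u3: "E (Suc j) * u (Suc j) = u j * E (Suc j)" for j
    unfolding Eu uE assoc_mult_mat[OF F.carrier hc fc, symmetric] h(3) assoc_mult_mat[OF hc F'.carrier fc] f(3)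
      assoc_mult_mat[OF hc fc F.carrier] ..
  obtain s where s: "\<And>j. s j \<in> free_hom n (B (Suc (Suc j))) (B (Suc j))"
    "\<And>j. E (Suc (Suc j)) * s (Suc j) = u (Suc j) - s j * E (Suc j)"
    using ex_homotopy[OF F.augmented_resolution_axioms u1 u2 u3] by blast
  note sc = free_homD(1)[OF s(1)] and uc = free_homD(1)[OF u1]
  let ?T = "tensor_field :: 'k mpoly mat \<Rightarrow> 'k mat"
  let ?i = "Suc j"
  have Tc: "?T (E k) \<in> carrier_mat (B k) (B (Suc k))" "?T (E' k) \<in> carrier_mat (B' k) (B' (Suc k))"
    "?T (f k) \<in> carrier_mat (B' (Suc k)) (B (Suc k))" "?T (h k) \<in> carrier_mat (B (Suc k)) (B' (Suc k))"
    "?T (s k) \<in> carrier_mat (B (Suc (Suc k))) (B (Suc k))" for k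
    using F.carrier F'.carrier fc hc sc by auto
  have "kernel_dim (?T (E ?i)) - vec_space.rank (B (Suc ?i)) (?T (E (Suc ?i))) \<le>
    kernel_dim (?T (E' ?i)) - vec_space.rank (B' (Suc ?i)) (?T (E' (Suc ?i)))"
  proof (rule homology_dim_le_of_injective[OF Tc(1) Tc(1) Tc(2) Tc(2) Tc(3)])
    show "mat_range (?T (E' (Suc ?i))) \<subseteq> mat_kernel (?T (E' ?i))"
    proof
      fix z assume "z \<in> mat_range (?T (E' (Suc ?i)))"
      then obtain y where y: "y \<in> carrier_vec (B' (Suc (Suc ?i)))" "z = ?T (E' (Suc ?i)) *\<^sub>v y"
        by (rule mat_rangeE[OF _ Tc(2)])
      have "?T (E' ?i) *\<^sub>v z = ?T (E' ?i * E' (Suc ?i)) *\<^sub>v y"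
        unfolding y(2) tensor_field_mult[OF F'.carrier F'.carrier] using assoc_mult_mat_vec[OF Tc(2) Tc(2) y(1)] by simp
      also have "\<dots> = 0\<^sub>v (B' ?i)" unfolding F'.comp_zero tensor_field_zero using y(1) by (intro eq_vecI) auto
      finally show "z \<in> mat_kernel (?T (E' ?i))"
        using y Tc(2) mult_mat_vec_carrier[OF Tc(2) y(1)] by (intro mat_kernelI[OF Tc(2)]) auto
    qed
    fix z assume "z \<in> mat_kernel (?T (E ?i))"
    note z = mat_kernelD[OF Tc(1) this]
    have fz: "?T (f ?i) *\<^sub>v z \<in> carrier_vec (B' (Suc ?i))" using mult_mat_vec_carrier[OF Tc(3) z(1)] .
    have "?T (E' ?i) *\<^sub>v (?T (f ?i) *\<^sub>v z) = ?T (E' ?i * f ?i) *\<^sub>v z"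
      unfolding tensor_field_mult[OF F'.carrier fc] using assoc_mult_mat_vec[OF Tc(2) Tc(3) z(1)] by simp
    also have "\<dots> = ?T (f j) *\<^sub>v (?T (E ?i) *\<^sub>v z)"
      unfolding f(3) tensor_field_mult[OF fc F.carrier] using assoc_mult_mat_vec[OF Tc(3) Tc(1) z(1)] by simp
    also have "\<dots> = 0\<^sub>v (B' ?i)" unfolding z(2) using Tc(3)[of j] by (intro eq_vecI) auto
    finally show "?T (f ?i) *\<^sub>v z \<in> mat_kernel (?T (E' ?i))" by (intro mat_kernelI[OF Tc(2) fz])
    assume "?T (f ?i) *\<^sub>v z \<in> mat_range (?T (E' (Suc ?i)))"
    then obtain y where y: "y \<in> carrier_vec (B' (Suc (Suc ?i)))" "?T (f ?i) *\<^sub>v z = ?T (E' (Suc ?i)) *\<^sub>v y"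
      by (rule mat_rangeE[OF _ Tc(2)])
    have "?T (u ?i) = ?T (h ?i) * ?T (f ?i) - 1\<^sub>m (B (Suc ?i))"
      unfolding u_def tensor_field_minus[OF hf one_carrier_mat] tensor_field_mult[OF hc fc] tensor_field_one ..
    then have "?T (u ?i) *\<^sub>v z = (?T (h ?i) * ?T (f ?i)) *\<^sub>v z - 1\<^sub>m (B (Suc ?i)) *\<^sub>v z"
      using minus_mult_distrib_mat_vec[OF mult_carrier_mat[OF Tc(4) Tc(3)] one_carrier_mat z(1)] by simp
    also have "(?T (h ?i) * ?T (f ?i)) *\<^sub>v z = ?T (h ?i) *\<^sub>v (?T (E' (Suc ?i)) *\<^sub>v y)"
      unfolding assoc_mult_mat_vec[OF Tc(4) Tc(3) z(1)] y(2) ..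
    also have "\<dots> = ?T (h ?i * E' (Suc ?i)) *\<^sub>v y"
      unfolding tensor_field_mult[OF hc F'.carrier] using assoc_mult_mat_vec[OF Tc(4) Tc(2) y(1)] by simp
    also have "\<dots> = ?T (E (Suc ?i)) *\<^sub>v (?T (h (Suc ?i)) *\<^sub>v y)"
      unfolding h(3)[symmetric] tensor_field_mult[OF F.carrier hc] using assoc_mult_mat_vec[OF Tc(1) Tc(4) y(1)] .
    finally have 1: "?T (u ?i) *\<^sub>v z = ?T (E (Suc ?i)) *\<^sub>v (?T (h (Suc ?i)) *\<^sub>v y) - z" using z(1) by simp
    have sE: "s j * E ?i \<in> carrier_mat (B (Suc ?i)) (B (Suc ?i))" by (rule mult_carrier_mat[OF sc F.carrier])
    have "?T (E (Suc ?i)) *\<^sub>v (?T (s ?i) *\<^sub>v z) = ?T (E (Suc ?i) * s ?i) *\<^sub>v z"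
      unfolding tensor_field_mult[OF F.carrier sc] using assoc_mult_mat_vec[OF Tc(1) Tc(5) z(1)] by simp
    also have "\<dots> = ?T (u ?i) *\<^sub>v z - ?T (s j * E ?i) *\<^sub>v z"
      unfolding s(2) tensor_field_minus[OF uc sE] using uc sE z(1)
      by (intro minus_mult_distrib_mat_vec) auto
    also have "?T (s j * E ?i) *\<^sub>v z = ?T (s j) *\<^sub>v (?T (E ?i) *\<^sub>v z)"
      unfolding tensor_field_mult[OF sc F.carrier] using assoc_mult_mat_vec[OF Tc(5) Tc(1) z(1)] .
    also have "\<dots> = 0\<^sub>v (B (Suc ?i))" unfolding z(2) using Tc(5)[of j] by (intro eq_vecI) auto
    finally have 2: "?T (E (Suc ?i)) *\<^sub>v (?T (s ?i) *\<^sub>v z) = ?T (E (Suc ?i)) *\<^sub>v (?T (h (Suc ?i)) *\<^sub>v y) - z - 0\<^sub>v (B (Suc ?i))"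
      unfolding 1 .
    have c: "?T (s ?i) *\<^sub>v z \<in> carrier_vec (B (Suc (Suc ?i)))" "?T (h (Suc ?i)) *\<^sub>v y \<in> carrier_vec (B (Suc (Suc ?i)))"
      using mult_mat_vec_carrier[OF Tc(5) z(1)] mult_mat_vec_carrier[OF Tc(4) y(1)] by auto
    define p q where "p = ?T (s ?i) *\<^sub>v z" and "q = ?T (h (Suc ?i)) *\<^sub>v y"
    have pq: "p \<in> carrier_vec (B (Suc (Suc ?i)))" "q \<in> carrier_vec (B (Suc (Suc ?i)))" using c unfolding p_def q_def .
    \<comment> \<open>On the cycle \<open>z\<close>, the map \<open>u\<close> is the boundary of
      \<open>p\<close> by the homotopy and the boundary of \<open>q\<close> minus \<open>z\<close>
      by composition.\<close>
    have "z = ?T (E (Suc ?i)) *\<^sub>v q - ?T (E (Suc ?i)) *\<^sub>v p"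
    proof (rule eq_vecI)
      fix i assume "i < dim_vec (?T (E (Suc ?i)) *\<^sub>v q - ?T (E (Suc ?i)) *\<^sub>v p)"
      then have i: "i < B (Suc ?i)" using Tc(1)[of "Suc ?i"] by simp
      have "(?T (E (Suc ?i)) *\<^sub>v p) $ i = (?T (E (Suc ?i)) *\<^sub>v q - z - 0\<^sub>v (B (Suc ?i))) $ i"
        using 2 unfolding p_def q_def by (rule arg_cong)
      then have "(?T (E (Suc ?i)) *\<^sub>v p) $ i = (?T (E (Suc ?i)) *\<^sub>v q) $ i - z $ i"
        using i z(1) Tc(1)[of "Suc ?i"] by (simp del: index_mult_mat_vec)
      then show "z $ i = (?T (E (Suc ?i)) *\<^sub>v q - ?T (E (Suc ?i)) *\<^sub>v p) $ i"
        using i Tc(1)[of "Suc ?i"] by (simp del: index_mult_mat_vec)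
    qed (use z Tc(1)[of "Suc ?i"] in auto)
    also have "\<dots> = ?T (E (Suc ?i)) *\<^sub>v (q - p)"
      using mult_minus_distrib_mat_vec[OF Tc(1) pq(2) pq(1)] by simp
    finally show "z \<in> mat_range (?T (E (Suc ?i)))" using mat_rangeI[OF Tc(1), of "q - p"] pq by simp
  qed
  moreover have "E ?i = d ?i" "E (Suc ?i) = d (Suc ?i)" "E' ?i = d' ?i" "E' (Suc ?i) = d' (Suc ?i)"
    unfolding E_def E'_def by simp_all
  moreover have "B (Suc ?i) = dim_row (d (Suc ?i))" "B' (Suc ?i) = dim_row (d' (Suc ?i))"
    using F.carrier[of "Suc ?i"] F'.carrier[of "Suc ?i"] calculation by auto
  ultimately show ?thesis unfolding homology_dim_def by simp
qed

text \<open>Any two resolutions bound each other by \<open>homology_dim_le\<close>, so the definite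
  description in \<open>betti\<close> denotes the value of the given one.\<close>

theorem betti_eq_homology_dim:
  assumes r: "free_resolution n I b g d" and i: "i \<ge> 1"
  shows "betti n I i = homology_dim d i"
proof -
  obtain j where j: "i = Suc j" using i by (cases i) auto
  show ?thesis unfolding betti_def j
    using r homology_dim_le by (intro the_equality) (blast intro: antisym)+
qed

section \<open>Cubical chains on exponent vectors\<close>

abbreviation (input) lookup where "lookup \<equiv> Poly_Mapping.lookup"
abbreviation (input) single where "single \<equiv> Poly_Mapping.single"
abbreviation (input) keys where "keys \<equiv> Poly_Mapping.keys"
abbreviation (input) update where "update \<equiv> Poly_Mapping.update"

text \<open>The sign refers to the complement of \<open>\<tau>\<close>, so that after tensoring with the field the boundary
  maps become simplicial coboundary maps on complements.\<close>

definition isgn :: "nat \<Rightarrow> nat \<Rightarrow> nat set \<Rightarrow> int" where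
  "isgn n j \<tau> = (\<Prod>k\<in>{1..n} - \<tau> - {j}. if k < j then -1 else 1)"

lemma isgn_square [simp]: "isgn n j \<tau> * isgn n j \<tau> = 1"
  unfolding isgn_def prod.distrib[symmetric] by (intro prod.neutral) auto

lemma isgn_insert_right:
  assumes "k \<in> {1..n}" "k \<notin> \<tau>" "j \<noteq> k"
  shows "isgn n j \<tau> = (if k < j then -1 else 1) * isgn n j (insert k \<tau>)"
proof -
  have "isgn n j \<tau> = (if k < j then -1 else 1) * (\<Prod>l\<in>{1..n} - \<tau> - {j} - {k}. if l < j then -1 else 1)"
    unfolding isgn_def using assms by (intro prod.remove) auto
  moreover have "{1..n} - \<tau> - {j} - {k} = {1..n} - insert k \<tau> - {j}" by auto
  ultimately show ?thesis unfolding isgn_def by simp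
qed

lemma isgn_anticommute:
  assumes "j \<in> {1..n}" "k \<in> {1..n}" "j \<noteq> k" "j \<notin> \<tau>" "k \<notin> \<tau>"
  shows "isgn n j \<tau> * isgn n k (insert j \<tau>) = - (isgn n k \<tau> * isgn n j (insert k \<tau>))"
  using isgn_insert_right[of k n \<tau> j] isgn_insert_right[of j n \<tau> k] assms by (cases "j < k") auto

lemma isgn_anticommute':
  assumes "j \<in> {1..n}" "k \<in> {1..n}" "j \<noteq> k" "j \<notin> \<tau>" "k \<notin> \<tau>"
  shows "isgn n k (insert j \<tau>) * isgn n j (insert k \<tau>) = - (isgn n j \<tau> * isgn n k \<tau>)"
  using isgn_insert_right[of k n \<tau> j] isgn_insert_right[of j n \<tau> k] assms by (cases "j < k") auto

text \<open>The cube \<open>(m, \<tau>)\<close> has the vertices \<open>m + 1\<^sub>\<sigma>\<close>, \<open>\<sigma> \<subseteq> \<tau>\<close>, in the lattice of exponent vectors.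
  A cubical chain assigns a coefficient to every cube.\<close>

type_synonym 'a chain = "(nat \<Rightarrow>\<^sub>0 nat) \<Rightarrow> nat set \<Rightarrow> 'a"

text \<open>Chains are coefficient functions, so the boundary is read off at the facet: in direction
  \<open>j\<close>, a cube is the upper facet of the cube starting one step below and the lower
  facet of the cube starting at \<open>m\<close>. The guard excludes the truncated case of
  \<open>lookup m j - 1\<close>.\<close>

definition vdiff :: "nat \<Rightarrow> 'a::comm_ring_1 chain \<Rightarrow> 'a chain" where
  "vdiff j c m \<tau> = (if 0 < lookup m j then c (update j (lookup m j - 1) m) \<tau> else 0) - c m \<tau>"

definition bd :: "nat \<Rightarrow> 'a::comm_ring_1 chain \<Rightarrow> 'a chain" where
  "bd n c m \<tau> = (\<Sum>j\<in>{1..n} - \<tau>. of_int (isgn n j \<tau>) * vdiff j c m (insert j \<tau>))"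

text \<open>The projection onto the wall where coordinate \<open>j\<close> equals \<open>a\<close>;
  cubes extending in direction \<open>j\<close> collapse to zero. The chain \<open>push_htpy\<close>
  below is the prism swept out on the way.\<close>

definition push :: "nat \<Rightarrow> nat \<Rightarrow> 'a::comm_ring_1 chain \<Rightarrow> 'a chain" where
  "push j a c m \<tau> = (if j \<notin> \<tau> \<and> lookup m j = a then \<Sum>t\<le>a. c (update j t m) \<tau> else 0)"

definition push_htpy :: "nat \<Rightarrow> nat \<Rightarrow> nat \<Rightarrow> 'a::comm_ring_1 chain \<Rightarrow> 'a chain" where
  "push_htpy n j a c m \<tau> = (if j \<in> \<tau> \<and> lookup m j < a
     then of_int (isgn n j (\<tau> - {j})) * (\<Sum>t\<le>lookup m j. c (update j t m) (\<tau> - {j})) else 0)"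

lemma update_same [simp]: "update j t (update j u m) = update j t m"
  by (intro poly_mapping_eqI) (simp add: lookup_update)

lemma update_swap: "j \<noteq> k \<Longrightarrow> update j t (update k u m) = update k u (update j t m)"
  by (intro poly_mapping_eqI) (auto simp: lookup_update)

lemma update_lookup [simp]: "update j (lookup m j) m = m"
  by (intro poly_mapping_eqI) (simp add: lookup_update)

lemma vdiff_swap: "vdiff j (vdiff k c) m \<tau> = vdiff k (vdiff j c) m \<tau>"
  by (cases "j = k") (auto simp: vdiff_def lookup_update update_swap)

text \<open>The halves with k < j and j < k are exchanged and cancel; no division by 2 occurs, so
  characteristic 2 is covered.\<close>

lemma sum_antisym_pairs:
  fixes g :: "nat \<Rightarrow> nat \<Rightarrow> 'a::comm_ring_1"
  assumes fin: "finite A" and anti: "\<And>j k. j \<in> A \<Longrightarrow> k \<in> A \<Longrightarrow> j \<noteq> k \<Longrightarrow> g j k = - g k j"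
  shows "(\<Sum>j\<in>A. \<Sum>k\<in>A - {j}. g j k) = 0"
proof -
  have "(\<Sum>j\<in>A. \<Sum>k\<in>A - {j}. g j k) = (\<Sum>j\<in>A. (\<Sum>k\<in>{k\<in>A. k < j}. g j k) + (\<Sum>k\<in>{k\<in>A. j < k}. g j k))"
  proof (intro sum.cong refl)
    fix j assume "j \<in> A"
    have e: "A - {j} = {k\<in>A. k < j} \<union> {k\<in>A. j < k}" by auto
    show "(\<Sum>k\<in>A - {j}. g j k) = (\<Sum>k\<in>{k\<in>A. k < j}. g j k) + (\<Sum>k\<in>{k\<in>A. j < k}. g j k)"
      unfolding e by (rule sum.union_disjoint) (use fin in auto)
  qed
  also have "\<dots> = (\<Sum>j\<in>A. \<Sum>k\<in>{k\<in>A. k < j}. g j k) + (\<Sum>j\<in>A. \<Sum>k\<in>{k\<in>A. j < k}. g j k)"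
    by (rule sum.distrib)
  also have "(\<Sum>j\<in>A. \<Sum>k\<in>{k\<in>A. j < k}. g j k) = (\<Sum>k\<in>A. \<Sum>j\<in>{j\<in>A. j < k}. g j k)"
    by (rule sum.swap_restrict[OF fin fin])
  also have "\<dots> = (\<Sum>k\<in>A. \<Sum>j\<in>{j\<in>A. j < k}. - g k j)"
    by (intro sum.cong refl anti) auto
  also have "\<dots> = - (\<Sum>k\<in>A. \<Sum>j\<in>{j\<in>A. j < k}. g k j)" by (simp only: sum_negf)
  finally show ?thesis by (simp only: right_minus)
qed

text \<open>Differences in two directions commute, while the signs anticommute.\<close>

lemma bd_bd: "bd n (bd n c) m \<tau> = 0"
proof -
  let ?A = "{1..n} - \<tau>"
  have "bd n (bd n c) m \<tau> = (\<Sum>j\<in>?A. \<Sum>k\<in>?A - {j}.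
      of_int (isgn n j \<tau> * isgn n k (insert j \<tau>)) * vdiff j (vdiff k c) m (insert k (insert j \<tau>)))"
  proof -
    have "vdiff j (bd n c) m (insert j \<tau>) =
        (\<Sum>k\<in>?A - {j}. of_int (isgn n k (insert j \<tau>)) * vdiff j (vdiff k c) m (insert k (insert j \<tau>)))" for j
    proof -
      have "?A - {j} = {1..n} - insert j \<tau>" by auto
      then show ?thesis by (simp add: vdiff_def[of j] bd_def sum_subtractf right_diff_distrib)
    qed
    then show ?thesis by (simp add: bd_def[of n "bd n c"] sum_distrib_left mult.assoc)
  qed
  also have "\<dots> = 0"
  proof (rule sum_antisym_pairs)
    fix j k assume jk: "j \<in> ?A" "k \<in> ?A" "j \<noteq> k"
    have "of_int (isgn n j \<tau> * isgn n k (insert j \<tau>)) = (- of_int (isgn n k \<tau> * isgn n j (insert k \<tau>)) :: 'a)"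
      using isgn_anticommute[of j n k \<tau>] jk by (metis DiffD1 DiffD2 of_int_minus)
    then show "of_int (isgn n j \<tau> * isgn n k (insert j \<tau>)) * vdiff j (vdiff k c) m (insert k (insert j \<tau>)) =
      - (of_int (isgn n k \<tau> * isgn n j (insert k \<tau>)) * vdiff k (vdiff j c) m (insert j (insert k \<tau>)))"
      by (simp add: vdiff_swap[of j k] insert_commute)
  qed simp
  finally show ?thesis .
qed

lemma bd_add: "bd n (\<lambda>m \<tau>. c m \<tau> + e m \<tau>) m \<tau> = bd n c m \<tau> + bd n e m \<tau>"
  unfolding bd_def sum.distrib[symmetric] by (intro sum.cong refl) (auto simp: vdiff_def algebra_simps)

lemma bd_uminus: "bd n (\<lambda>m \<tau>. - c m \<tau>) m \<tau> = - bd n c m \<tau>"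
  unfolding bd_def sum_negf[symmetric] by (intro sum.cong refl) (auto simp: vdiff_def algebra_simps)

lemma sum_atMost_telescope_pred:
  fixes f :: "nat \<Rightarrow> 'a::ab_group_add"
  shows "(\<Sum>t\<le>N. (if 0 < t then f (t - 1) else 0) - f t) = - f N"
  by (induction N) auto

text \<open>The prism is a chain homotopy from the identity to the projection. If \<tau> lacks
  \<open>j\<close>, only direction \<open>j\<close> contributes, and two consecutive partial sums
  differ by \<open>c m \<tau>\<close>. If \<tau> contains \<open>j\<close>, the other directions
  cancel by the signs, and direction \<open>j\<close> telescopes. The support condition says that
  \<open>c\<close> lies below the wall.\<close>

lemma push_htpy_bd:
  assumes j: "j \<in> {1..n}" and supp: "c m \<tau> \<noteq> 0 \<Longrightarrow> lookup m j + (if j \<in> \<tau> then 1 else 0) \<le> a"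
  shows "bd n (push_htpy n j a c) m \<tau> + push_htpy n j a (bd n c) m \<tau> = push j a c m \<tau> - c m \<tau>"
proof (cases "j \<in> \<tau>")
  case False
  let ?h = "push_htpy n j a c"
  have z: "vdiff k ?h m (insert k \<tau>) = 0" if "k \<noteq> j" for k
    using False that by (simp add: vdiff_def push_htpy_def)
  have "bd n ?h m \<tau> = (\<Sum>k\<in>{j}. of_int (isgn n k \<tau>) * vdiff k ?h m (insert k \<tau>))"
    unfolding bd_def using j False z by (intro sum.mono_neutral_right) auto
  also have "\<dots> = of_int (isgn n j \<tau>) * vdiff j ?h m (insert j \<tau>)" by simp
  also have "vdiff j ?h m (insert j \<tau>) = of_int (isgn n j \<tau>) *
      ((if 0 < lookup m j \<and> lookup m j - 1 < a then \<Sum>t\<le>lookup m j - 1. c (update j t m) \<tau> else 0)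
        - (if lookup m j < a then \<Sum>t\<le>lookup m j. c (update j t m) \<tau> else 0))"
    using False by (simp add: vdiff_def push_htpy_def lookup_update algebra_simps)
  finally have b: "bd n ?h m \<tau> = (if 0 < lookup m j \<and> lookup m j - 1 < a then \<Sum>t\<le>lookup m j - 1. c (update j t m) \<tau> else 0)
        - (if lookup m j < a then \<Sum>t\<le>lookup m j. c (update j t m) \<tau> else 0)"
    by (simp add: mult.assoc[symmetric] of_int_mult[symmetric])
  have "push_htpy n j a (bd n c) m \<tau> = 0" using False by (simp add: push_htpy_def)
  moreover have "(\<Sum>t\<le>lookup m j. c (update j t m) \<tau>) =
      (if 0 < lookup m j then \<Sum>t\<le>lookup m j - 1. c (update j t m) \<tau> else 0) + c m \<tau>"
  proof (cases "lookup m j")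
    case 0
    have "update j 0 m = m" using update_lookup[of j m] unfolding 0 .
    then show ?thesis using 0 by simp
  next
    case (Suc N)
    have "update j (Suc N) m = m" using update_lookup[of j m] unfolding Suc .
    then show ?thesis using Suc by simp
  qed
  ultimately show ?thesis unfolding b push_def using False supp
    by (cases "lookup m j" a rule: linorder_cases) auto
next
  case True
  define \<sigma> where "\<sigma> = \<tau> - {j}"
  have \<tau>: "\<tau> = insert j \<sigma>" "j \<notin> \<sigma>" using True unfolding \<sigma>_def by auto
  show ?thesis
  proof (cases "lookup m j < a")
    case False
    then have "c m \<tau> = 0" using supp True by fastforce
    moreover have "vdiff k (push_htpy n j a c) m (insert k \<tau>) = 0" if "k \<notin> \<tau>" for k
      using False that True by (auto simp: vdiff_def push_htpy_def lookup_update)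
    ultimately show ?thesis using False True by (simp add: push_def push_htpy_def bd_def)
  next
    case lt: True
    let ?A = "{1..n} - \<tau>" and ?N = "lookup m j"
    have "bd n (push_htpy n j a c) m \<tau> = (\<Sum>k\<in>?A. of_int (isgn n k \<tau> * isgn n j (insert k \<sigma>)) *
        (\<Sum>t\<le>?N. vdiff k c (update j t m) (insert k \<sigma>)))"
      unfolding bd_def
    proof (intro sum.cong refl)
      fix k assume k: "k \<in> ?A"
      then have kj: "k \<noteq> j" using True by auto
      have e: "insert k \<tau> - {j} = insert k \<sigma>" using kj unfolding \<sigma>_def by auto
      have "vdiff k (push_htpy n j a c) m (insert k \<tau>) =
        of_int (isgn n j (insert k \<sigma>)) * (\<Sum>t\<le>?N. vdiff k c (update j t m) (insert k \<sigma>))"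
        using kj lt True by (simp add: vdiff_def push_htpy_def lookup_update e sum_subtractf right_diff_distrib update_swap)
      then show "of_int (isgn n k \<tau>) * vdiff k (push_htpy n j a c) m (insert k \<tau>) =
        of_int (isgn n k \<tau> * isgn n j (insert k \<sigma>)) * (\<Sum>t\<le>?N. vdiff k c (update j t m) (insert k \<sigma>))"
        by (simp add: mult.assoc)
    qed
    also have "\<dots> = (\<Sum>k\<in>?A. - (of_int (isgn n j \<sigma> * isgn n k \<sigma>) * (\<Sum>t\<le>?N. vdiff k c (update j t m) (insert k \<sigma>))))"
    proof (intro sum.cong refl)
      fix k assume k: "k \<in> ?A"
      have "isgn n k \<tau> * isgn n j (insert k \<sigma>) = - (isgn n j \<sigma> * isgn n k \<sigma>)"
        using isgn_anticommute'[of j n k \<sigma>] j k \<tau> by auto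
      then show "of_int (isgn n k \<tau> * isgn n j (insert k \<sigma>)) * (\<Sum>t\<le>?N. vdiff k c (update j t m) (insert k \<sigma>)) =
        - (of_int (isgn n j \<sigma> * isgn n k \<sigma>) * (\<Sum>t\<le>?N. vdiff k c (update j t m) (insert k \<sigma>)))"
        by (simp only: of_int_minus mult_minus_left)
    qed
    finally have 1: "bd n (push_htpy n j a c) m \<tau> =
       - (\<Sum>k\<in>?A. of_int (isgn n j \<sigma> * isgn n k \<sigma>) * (\<Sum>t\<le>?N. vdiff k c (update j t m) (insert k \<sigma>)))"
      by (simp add: sum_negf)
    have "push_htpy n j a (bd n c) m \<tau> = of_int (isgn n j \<sigma>) * (\<Sum>t\<le>?N. bd n c (update j t m) \<sigma>)"
      using True lt by (simp add: push_htpy_def \<sigma>_def)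
    also have "(\<Sum>t\<le>?N. bd n c (update j t m) \<sigma>) =
        (\<Sum>t\<le>?N. \<Sum>k\<in>{1..n} - \<sigma>. of_int (isgn n k \<sigma>) * vdiff k c (update j t m) (insert k \<sigma>))"
      unfolding bd_def ..
    also have "\<dots> = (\<Sum>k\<in>{1..n} - \<sigma>. of_int (isgn n k \<sigma>) * (\<Sum>t\<le>?N. vdiff k c (update j t m) (insert k \<sigma>)))"
      by (subst sum.swap) (simp add: sum_distrib_left)
    also have "\<dots> = of_int (isgn n j \<sigma>) * (\<Sum>t\<le>?N. vdiff j c (update j t m) (insert j \<sigma>)) +
        (\<Sum>k\<in>?A. of_int (isgn n k \<sigma>) * (\<Sum>t\<le>?N. vdiff k c (update j t m) (insert k \<sigma>)))"
    proof -
      have e: "?A = {1..n} - \<sigma> - {j}" using True unfolding \<sigma>_def by blast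
      show ?thesis unfolding e by (rule sum.remove) (use j \<tau>(2) in auto)
    qed
    also have "(\<Sum>t\<le>?N. vdiff j c (update j t m) (insert j \<sigma>)) = - c m \<tau>"
      using sum_atMost_telescope_pred[of "\<lambda>t. c (update j t m) \<tau>" ?N]
      by (simp add: vdiff_def lookup_update \<tau>(1)[symmetric] cong: if_cong)
    finally have "push_htpy n j a (bd n c) m \<tau> = of_int (isgn n j \<sigma> * isgn n j \<sigma>) * (- c m \<tau>) +
        (\<Sum>k\<in>?A. of_int (isgn n j \<sigma> * isgn n k \<sigma>) * (\<Sum>t\<le>?N. vdiff k c (update j t m) (insert k \<sigma>)))"
      by (simp only: distrib_left of_int_mult mult.assoc sum_distrib_left)
    then show ?thesis unfolding 1 using True by (simp add: push_def)
  qed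
qed

section \<open>Contracting the region of a monomial ideal\<close>

text \<open>These are the sets of exponent vectors of the monomials in a monomial ideal.\<close>

definition upward_closed :: "nat \<Rightarrow> (nat \<Rightarrow>\<^sub>0 nat) set \<Rightarrow> bool" where
  "upward_closed n M \<longleftrightarrow> (\<forall>m\<in>M. keys m \<subseteq> {1..n} \<and> (\<forall>r. keys r \<subseteq> {1..n} \<longrightarrow> m + r \<in> M))"

lemma upward_closedD:
  assumes "upward_closed n M" "m \<in> M"
  shows "keys m \<subseteq> {1..n}" "keys r \<subseteq> {1..n} \<Longrightarrow> m + r \<in> M"
  using assms unfolding upward_closed_def by auto

lemma upward_closed_update:
  assumes M: "upward_closed n M" "update j t m \<in> M" and "t \<le> lookup m j" "j \<in> {1..n}"
  shows "m \<in> M"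
proof -
  have "m = update j t m + single j (lookup m j - t)"
    using assms(3) by (intro poly_mapping_eqI) (auto simp: lookup_add lookup_update lookup_single when_def)
  moreover have "keys (single j (lookup m j - t)) \<subseteq> {1..n}" using assms(4) by simp
  ultimately show ?thesis using upward_closedD(2)[OF M] by metis
qed

definition cubical_chain :: "nat \<Rightarrow> (nat \<Rightarrow>\<^sub>0 nat) set \<Rightarrow> (nat \<Rightarrow> nat) \<Rightarrow> nat \<Rightarrow> 'a::comm_ring_1 chain \<Rightarrow> bool" where
  "cubical_chain n M a i c \<longleftrightarrow> (\<forall>m \<tau>. c m \<tau> \<noteq> 0 \<longrightarrow>
     m \<in> M \<and> \<tau> \<subseteq> {1..n} \<and> card \<tau> = i \<and> (\<forall>j\<in>{1..n}. lookup m j + (if j \<in> \<tau> then 1 else 0) \<le> a j))"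

lemma cubical_chainD:
  assumes "cubical_chain n M a i c" "c m \<tau> \<noteq> 0"
  shows "m \<in> M" "\<tau> \<subseteq> {1..n}" "card \<tau> = i"
    "\<And>j. j \<in> {1..n} \<Longrightarrow> lookup m j + (if j \<in> \<tau> then 1 else 0) \<le> a j"
  using assms unfolding cubical_chain_def by auto

lemma cubical_chain_diff:
  assumes "cubical_chain n M a i c" "cubical_chain n M a i e"
  shows "cubical_chain n M a i (\<lambda>m \<tau>. c m \<tau> + - e m \<tau>)"
  unfolding cubical_chain_def
proof (intro allI impI)
  fix m \<tau> assume "c m \<tau> + - e m \<tau> \<noteq> 0"
  then have "c m \<tau> \<noteq> 0 \<or> e m \<tau> \<noteq> 0" by auto
  then show "m \<in> M \<and> \<tau> \<subseteq> {1..n} \<and> card \<tau> = i \<and>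
      (\<forall>j\<in>{1..n}. lookup m j + (if j \<in> \<tau> then 1 else 0) \<le> a j)"
    using assms unfolding cubical_chain_def by blast
qed

text \<open>Sweeping increases coordinates only, so the moved cubes keep their lowest vertex in the
  ideal. The same reason serves the prism below.\<close>

lemma cubical_chain_push:
  assumes M: "upward_closed n M" and c: "cubical_chain n M a i c" and j: "j \<in> {1..n}"
  shows "cubical_chain n M a i (push j (a j) c)"
  unfolding cubical_chain_def
proof (intro allI impI)
  fix m \<tau> assume nz: "push j (a j) c m \<tau> \<noteq> 0"
  then have jt: "j \<notin> \<tau>" "lookup m j = a j" unfolding push_def by (auto split: if_splits)
  then obtain t where t: "t \<le> a j" "c (update j t m) \<tau> \<noteq> 0"
    using nz unfolding push_def by (metis (mono_tags, lifting) atMost_iff sum.neutral)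
  note d = cubical_chainD[OF c t(2)]
  have "m \<in> M" using upward_closed_update[OF M d(1)] t jt j by simp
  moreover have "lookup m k + (if k \<in> \<tau> then 1 else 0) \<le> a k" if "k \<in> {1..n}" for k
    using d(4)[OF that] jt by (cases "k = j") (auto simp: lookup_update)
  ultimately show "m \<in> M \<and> \<tau> \<subseteq> {1..n} \<and> card \<tau> = i \<and>
      (\<forall>k\<in>{1..n}. lookup m k + (if k \<in> \<tau> then 1 else 0) \<le> a k)"
    using d by blast
qed

lemma cubical_chain_push_htpy:
  assumes M: "upward_closed n M" and c: "cubical_chain n M a i c" and j: "j \<in> {1..n}"
  shows "cubical_chain n M a (Suc i) (push_htpy n j (a j) c)"
  unfolding cubical_chain_def
proof (intro allI impI)
  fix m \<tau> assume nz: "push_htpy n j (a j) c m \<tau> \<noteq> 0"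
  then have jt: "j \<in> \<tau>" "lookup m j < a j" unfolding push_htpy_def by (auto split: if_splits)
  then have "(\<Sum>t\<le>lookup m j. c (update j t m) (\<tau> - {j})) \<noteq> 0" using nz unfolding push_htpy_def by auto
  then obtain t where t: "t \<le> lookup m j" "c (update j t m) (\<tau> - {j}) \<noteq> 0"
    by (metis (mono_tags, lifting) atMost_iff sum.neutral)
  note d = cubical_chainD[OF c t(2)]
  have "m \<in> M" using upward_closed_update[OF M d(1)] t jt j by simp
  moreover have "lookup m k + (if k \<in> \<tau> then 1 else 0) \<le> a k" if "k \<in> {1..n}" for k
    using d(4)[OF that] jt by (cases "k = j") (auto simp: lookup_update)
  moreover have "\<tau> \<subseteq> {1..n}" using d(2) j by auto
  moreover have "card \<tau> = Suc i" using d(3) jt(1) \<open>\<tau> \<subseteq> {1..n}\<close>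
    by (metis card.remove finite_atLeastAtMost finite_subset)
  ultimately show "m \<in> M \<and> \<tau> \<subseteq> {1..n} \<and> card \<tau> = Suc i \<and>
      (\<forall>k\<in>{1..n}. lookup m k + (if k \<in> \<tau> then 1 else 0) \<le> a k)"
    by blast
qed

text \<open>Pushing a chain in the coordinate directions one after the other moves it, up to
  boundaries, to the top corner \<open>a\<close> of the staircase region; no cube of positive dimension
  fits there.\<close>

lemma push_to_corner:
  fixes c :: "'a::comm_ring_1 chain"
  assumes M: "upward_closed n M" and c: "cubical_chain n M a i c" and cyc: "\<And>m \<tau>. bd n c m \<tau> = 0"
    and l: "l \<le> n"
  shows "\<exists>c' e. cubical_chain n M a i c' \<and> cubical_chain n M a (Suc i) e \<and>
    (\<forall>m \<tau>. c m \<tau> = c' m \<tau> + bd n e m \<tau>) \<and>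
    (\<forall>m \<tau>. c' m \<tau> \<noteq> 0 \<longrightarrow> (\<forall>k\<in>{1..l}. k \<notin> \<tau> \<and> lookup m k = a k))"
  using l
proof (induction l)
  case 0
  have "cubical_chain n M a (Suc i) (\<lambda>m \<tau>. 0 :: 'a)" unfolding cubical_chain_def by simp
  moreover have "bd n (\<lambda>m \<tau>. 0 :: 'a) m \<tau> = 0" for m \<tau> by (simp add: bd_def vdiff_def)
  ultimately show ?case using c by (intro exI[of _ c] exI[of _ "\<lambda>m \<tau>. 0"]) simp
next
  case (Suc l)
  obtain c' e where IH': "cubical_chain n M a i c'" "cubical_chain n M a (Suc i) e"
    "\<forall>m \<tau>. c m \<tau> = c' m \<tau> + bd n e m \<tau>"
    "\<forall>m \<tau>. c' m \<tau> \<noteq> 0 \<longrightarrow> (\<forall>k\<in>{1..l}. k \<notin> \<tau> \<and> lookup m k = a k)"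
    using Suc.IH[OF Suc_leD[OF Suc.prems]] by (elim exE conjE) (rule that; assumption)
  note IH = IH'(1,2) IH'(3)[rule_format] IH'(4)[rule_format]
  let ?j = "Suc l"
  let ?c = "push ?j (a ?j) c'" and ?h = "push_htpy n ?j (a ?j) c'"
  have j: "?j \<in> {1..n}" using Suc.prems by simp
  have "bd n c' m \<tau> = 0" for m \<tau>
  proof -
    have "c = (\<lambda>m \<tau>. c' m \<tau> + bd n e m \<tau>)" using IH(3) by (intro ext) simp
    then have "bd n c m \<tau> = bd n c' m \<tau> + bd n (bd n e) m \<tau>" by (simp only: bd_add)
    then show ?thesis unfolding cyc bd_bd by simp
  qed
  then have z: "push_htpy n ?j (a ?j) (bd n c') m \<tau> = 0" for m \<tau> by (simp add: push_htpy_def)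
  have h: "bd n ?h m \<tau> = ?c m \<tau> - c' m \<tau>" for m \<tau>
  proof -
    have "bd n ?h m \<tau> + push_htpy n ?j (a ?j) (bd n c') m \<tau> = ?c m \<tau> - c' m \<tau>"
      by (rule push_htpy_bd[OF j]) (rule cubical_chainD(4)[OF IH(1) _ j])
    then show ?thesis unfolding z by simp
  qed
  let ?e = "\<lambda>m \<tau>. e m \<tau> + - ?h m \<tau>"
  have "cubical_chain n M a (Suc i) ?e"
    by (rule cubical_chain_diff[OF IH(2) cubical_chain_push_htpy[OF M IH(1) j]])
  moreover have "c m \<tau> = ?c m \<tau> + bd n ?e m \<tau>" for m \<tau>
    unfolding bd_add bd_uminus h IH(3)[of m \<tau>] by simp
  moreover have "k \<notin> \<tau> \<and> lookup m k = a k" if nz: "?c m \<tau> \<noteq> 0" and k: "k \<in> {1..Suc l}" for m \<tau> k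
  proof -
    have jt: "?j \<notin> \<tau>" "lookup m ?j = a ?j" using nz unfolding push_def by (auto split: if_splits)
    then obtain t where "c' (update ?j t m) \<tau> \<noteq> 0"
      using nz unfolding push_def by (metis (mono_tags, lifting) sum.neutral)
    then have "k \<noteq> ?j \<Longrightarrow> k \<notin> \<tau> \<and> lookup (update ?j t m) k = a k"
      using IH'(4) k by (metis atLeastAtMost_iff le_SucE)
    then show ?thesis using jt by (cases "k = ?j") (auto simp: lookup_update)
  qed
  ultimately show ?case using cubical_chain_push[OF M IH(1) j]
    by (intro exI[of _ ?c] exI[of _ ?e] conjI allI impI ballI) blast+
qed

lemma cubical_exact:
  fixes c :: "'a::comm_ring_1 chain"
  assumes M: "upward_closed n M" and c: "cubical_chain n M a (Suc i) c" and cyc: "\<And>m \<tau>. bd n c m \<tau> = 0"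
  obtains e where "cubical_chain n M a (Suc (Suc i)) e" "c = bd n e"
proof -
  obtain c' e where e: "cubical_chain n M a (Suc i) c'" "cubical_chain n M a (Suc (Suc i)) e"
    "\<forall>m \<tau>. c m \<tau> = c' m \<tau> + bd n e m \<tau>"
    "\<forall>m \<tau>. c' m \<tau> \<noteq> 0 \<longrightarrow> (\<forall>k\<in>{1..n}. k \<notin> \<tau> \<and> lookup m k = a k)"
    using push_to_corner[OF M c cyc order_refl] by (elim exE conjE) (rule that; assumption)
  have "c' m \<tau> = 0" for m \<tau>
  proof (rule ccontr)
    assume nz: "c' m \<tau> \<noteq> 0"
    have "\<tau> = {}" using cubical_chainD(2)[OF e(1) nz] e(4)[rule_format, OF nz] by auto
    then show False using cubical_chainD(3)[OF e(1) nz] by simp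
  qed
  then have "c = bd n e" using e(3) by (intro ext) simp
  then show ?thesis using that e(2) by blast
qed

definition box :: "nat \<Rightarrow> (nat \<Rightarrow> nat) \<Rightarrow> (nat \<Rightarrow>\<^sub>0 nat) set" where
  "box n a = {m. keys m \<subseteq> {1..n} \<and> (\<forall>j\<in>{1..n}. lookup m j \<le> a j)}"

lemma poly_mapping_eq_on_keys:
  assumes "keys m \<subseteq> A" "keys m' \<subseteq> A" "\<And>j. j \<in> A \<Longrightarrow> lookup m j = lookup m' j"
  shows "m = m'"
proof (rule poly_mapping_eqI)
  fix j show "lookup m j = lookup m' j"
    using assms by (metis in_keys_iff subsetD)
qed

lemma finite_box: "finite (box n a)"
proof (rule finite_imageD)
  show "inj_on (\<lambda>m. restrict (lookup m) {1..n}) (box n a)"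
  proof (rule inj_onI)
    fix x y assume "x \<in> box n a" "y \<in> box n a"
      and e: "restrict (lookup x) {1..n} = restrict (lookup y) {1..n}"
    moreover have "lookup x j = lookup y j" if "j \<in> {1..n}" for j
      using fun_cong[OF e, of j] that by simp
    ultimately show "x = y" by (intro poly_mapping_eq_on_keys[of x "{1..n}" y]) (auto simp: box_def)
  qed
  have "(\<lambda>m. restrict (lookup m) {1..n}) ` box n a \<subseteq> (\<Pi>\<^sub>E j\<in>{1..n}. {..a j})"
    by (auto simp: box_def)
  then show "finite ((\<lambda>m. restrict (lookup m) {1..n}) ` box n a)"
    by (rule finite_subset) (intro finite_PiE, auto)
qed

text \<open>Each edge has two endpoints with opposite signs. Edges in direction \<open>j\<close>
  start strictly below the wall, so the shift by one is a bijection within the box and the two sums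
  agree.\<close>

lemma sum_box_bd:
  fixes e :: "'a::comm_ring_1 chain"
  assumes e: "cubical_chain n M a (Suc 0) e"
  shows "(\<Sum>m\<in>box n a. bd n e m {}) = 0"
proof -
  have *: "(\<Sum>m\<in>box n a. vdiff j e m {j}) = 0" if j: "j \<in> {1..n}" for j
  proof -
    have bound: "lookup m j + 1 \<le> a j" if "e m {j} \<noteq> 0" for m
      using cubical_chainD(4)[OF e that j] by simp
    have "(\<Sum>m\<in>box n a. if 0 < lookup m j then e (update j (lookup m j - 1) m) {j} else 0) =
        (\<Sum>m\<in>{m\<in>box n a. 0 < lookup m j}. e (update j (lookup m j - 1) m) {j})"
      by (rule sum.inter_filter[symmetric, OF finite_box])
    also have "\<dots> = (\<Sum>m\<in>{m\<in>box n a. lookup m j < a j}. e m {j})"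
    proof (rule sum.reindex_bij_witness[of _ "\<lambda>m. update j (lookup m j + 1) m" "\<lambda>m. update j (lookup m j - 1) m"])
      have k: "keys (update j t m) \<subseteq> {1..n}" if "keys m \<subseteq> {1..n}" for t m
        using that j by (auto simp: in_keys_iff lookup_update subset_iff split: if_splits)
      fix m assume "m \<in> {m\<in>box n a. 0 < lookup m j}"
      then have m: "keys m \<subseteq> {1..n}" "\<And>k. k \<in> {1..n} \<Longrightarrow> lookup m k \<le> a k" "0 < lookup m j" by (auto simp: box_def)
      show "update j (lookup (update j (lookup m j - 1) m) j + 1) (update j (lookup m j - 1) m) = m"
        using m(3) by (simp add: lookup_update)
      show "update j (lookup m j - 1) m \<in> {m\<in>box n a. lookup m j < a j}"
      proof -
        have "lookup m j - 1 < a j" using m(2)[OF j] m(3) by linarith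
        moreover have "lookup (update j (lookup m j - 1) m) i \<le> a i" if "i \<in> {1..n}" for i
          using m(2)[OF that] by (auto simp: lookup_update)
        ultimately show ?thesis using k[OF m(1)] unfolding box_def by (simp add: lookup_update)
      qed
    next
      have k: "keys (update j t m) \<subseteq> {1..n}" if "keys m \<subseteq> {1..n}" for t m
        using that j by (auto simp: in_keys_iff lookup_update subset_iff split: if_splits)
      fix m assume "m \<in> {m\<in>box n a. lookup m j < a j}"
      then have m: "keys m \<subseteq> {1..n}" "\<And>k. k \<in> {1..n} \<Longrightarrow> lookup m k \<le> a k" "lookup m j < a j" by (auto simp: box_def)
      show "update j (lookup (update j (lookup m j + 1) m) j - 1) (update j (lookup m j + 1) m) = m"
        by (simp add: lookup_update)
      show "update j (lookup m j + 1) m \<in> {m\<in>box n a. 0 < lookup m j}"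
      proof -
        have "lookup (update j (lookup m j + 1) m) i \<le> a i" if "i \<in> {1..n}" for i
          using m(2)[OF that] m(3) by (auto simp: lookup_update)
        then show ?thesis using k[OF m(1)] unfolding box_def by (simp add: lookup_update)
      qed
    qed simp
    also have "\<dots> = (\<Sum>m\<in>box n a. e m {j})"
      using finite_box bound by (intro sum.mono_neutral_left) (auto simp: Suc_le_eq)
    finally show ?thesis by (simp add: vdiff_def sum_subtractf)
  qed
  have "(\<Sum>m\<in>box n a. bd n e m {}) = (\<Sum>j\<in>{1..n}. of_int (isgn n j {}) * (\<Sum>m\<in>box n a. vdiff j e m {j}))"
    unfolding bd_def by (subst sum.swap) (simp add: sum_distrib_left)
  also have "\<dots> = 0" using * by (intro sum.neutral) simp
  finally show ?thesis .
qed

text \<open>After all pushes a multiple of the single corner vertex remains, and the augmentation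
  reads off the multiple.\<close>

lemma cubical_exact_0:
  fixes c :: "'a::comm_ring_1 chain"
  assumes M: "upward_closed n M" and c: "cubical_chain n M a 0 c" and aug: "(\<Sum>m\<in>box n a. c m {}) = 0"
  obtains e where "cubical_chain n M a (Suc 0) e" "c = bd n e"
proof -
  have c0: "\<tau> = {}" if "c m \<tau> \<noteq> 0" for m and \<tau> :: "nat set"
  proof -
    have "finite \<tau>" using cubical_chainD(2)[OF c that] finite_subset by blast
    then show ?thesis using cubical_chainD(3)[OF c that] by simp
  qed
  have cyc: "bd n c m \<tau> = 0" for m \<tau>
  proof -
    have "c m' (insert j \<tau>) = 0" for j m' using c0 by blast
    then show ?thesis by (simp add: bd_def vdiff_def)
  qed
  obtain c' e where e: "cubical_chain n M a 0 c'" "cubical_chain n M a (Suc 0) e"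
    "\<forall>m \<tau>. c m \<tau> = c' m \<tau> + bd n e m \<tau>"
    "\<forall>m \<tau>. c' m \<tau> \<noteq> 0 \<longrightarrow> (\<forall>k\<in>{1..n}. k \<notin> \<tau> \<and> lookup m k = a k)"
    using push_to_corner[OF M c cyc order_refl] by (elim exE conjE) (rule that; assumption)
  have "c' m \<tau> = 0" for m \<tau>
  proof (rule ccontr)
    assume nz: "c' m \<tau> \<noteq> 0"
    have \<tau>: "\<tau> = {}" using cubical_chainD(2)[OF e(1) nz] e(4)[rule_format, OF nz] by auto
    have km: "keys m \<subseteq> {1..n}" using upward_closedD(1)[OF M cubical_chainD(1)[OF e(1) nz]] .
    have mb: "m \<in> box n a" using km e(4)[rule_format, OF nz] unfolding box_def by auto
    have "c' m' {} = 0" if "m' \<noteq> m" for m'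
    proof (rule ccontr)
      assume nz': "c' m' {} \<noteq> 0"
      have "m' = m"
        using upward_closedD(1)[OF M cubical_chainD(1)[OF e(1) nz']] km
        by (rule poly_mapping_eq_on_keys) (use e(4)[rule_format, OF nz] e(4)[rule_format, OF nz'] in auto)
      then show False using that by simp
    qed
    then have "(\<Sum>m\<in>box n a. c' m {}) = c' m {}"
      using mb finite_box by (subst sum.remove[of _ m]) (auto intro!: sum.neutral)
    moreover have "(\<Sum>m\<in>box n a. c' m {}) = 0"
      using aug sum_box_bd[OF e(2)] e(3) by (simp add: sum.distrib)
    ultimately show False using nz \<tau> by simp
  qed
  then have "c = bd n e" using e(3) by (intro ext) simp
  then show ?thesis using that e(2) by blast
qed

section \<open>The cubical resolution of a monomial ideal\<close>

definition ind :: "nat set \<Rightarrow> nat \<Rightarrow>\<^sub>0 nat" where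
  "ind \<tau> = (\<Sum>j\<in>\<tau>. single j 1)"

lemma lookup_ind: "finite \<tau> \<Longrightarrow> lookup (ind \<tau>) j = (if j \<in> \<tau> then 1 else 0)"
  unfolding ind_def by (auto simp: lookup_sum lookup_single when_def)

lemma keys_ind: "finite \<tau> \<Longrightarrow> keys (ind \<tau>) = \<tau>"
  by (auto simp: in_keys_iff lookup_ind split: if_splits)

lemma lookup_times_single_add:
  fixes p :: "'k::field mpoly"
  shows "lookup (single m 1 * p) (m + k) = lookup p k"
proof -
  have "(\<Sum>q. lookup p q when m + k = l + q) = lookup p k" if "l = m" for l
    using that by (simp add: when_def eq_commute[of k])
  then have "lookup (single m 1) l * (\<Sum>q. lookup p q when m + k = l + q) = (lookup p k when l = m)" for l
    by (cases "l = m") (auto simp: lookup_single)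
  then show ?thesis by (simp add: lookup_mult)
qed

lemma lookup_times_single_0:
  fixes p :: "'k::field mpoly"
  assumes "\<And>k. e \<noteq> m + k"
  shows "lookup (single m 1 * p) e = 0"
proof (rule ccontr)
  assume "lookup (single m 1 * p) e \<noteq> 0"
  then have "e \<in> keys (single m 1 * p)" by (simp add: in_keys_iff)
  then show False using keys_mult[of "single m 1" p] assms by (auto split: if_splits)
qed

lemma lookup_times_single:
  fixes p :: "'k::field mpoly"
  shows "lookup (single m 1 * p) e = (if \<forall>j. lookup m j \<le> lookup e j then lookup p (e - m) else 0)"
proof (cases "\<forall>j. lookup m j \<le> lookup e j")
  case True
  then have "e = m + (e - m)" by (intro poly_mapping_eqI) (simp add: lookup_add lookup_minus)
  then show ?thesis using True lookup_times_single_add[of m p "e - m"] by simp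
next
  case False
  then have "e \<noteq> m + k" for k by (auto simp: lookup_add)
  then have "lookup (single m 1 * p) e = 0" by (rule lookup_times_single_0)
  then show ?thesis using False by presburger
qed

lemma single_update_lookup:
  fixes m :: "nat \<Rightarrow>\<^sub>0 nat"
  assumes "0 < lookup m j"
  shows "m = update j (lookup m j - 1) m + single j 1"
proof (rule poly_mapping_eqI)
  fix k show "lookup m k = lookup (update j (lookup m j - 1) m + single j 1) k"
    using assms by (cases "k = j") (simp_all add: lookup_add lookup_update lookup_single when_def)
qed

text \<open>The assumption \<open>trunc\<close> says that the ideal is generated by monomials with
  all exponents at most \<open>K\<close>. It makes the cubes inside the box of side
  \<open>K\<close>, finite in number, sufficient for a resolution.\<close>

locale monomial_box =
  fixes n :: nat and M :: "(nat \<Rightarrow>\<^sub>0 nat) set" and K :: nat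
  assumes M: "upward_closed n M"
    and trunc: "\<And>m. m \<in> M \<Longrightarrow> \<exists>m'\<in>M. \<forall>j. lookup m' j = min (lookup m j) K"
begin

definition cubes :: "nat \<Rightarrow> ((nat \<Rightarrow>\<^sub>0 nat) \<times> nat set) set" where
  "cubes i = {(m, \<tau>). m \<in> M \<and> \<tau> \<subseteq> {1..n} \<and> card \<tau> = i \<and>
     (\<forall>j\<in>{1..n}. lookup m j + (if j \<in> \<tau> then 1 else 0) \<le> K)}"

lemma finite_cubes: "finite (cubes i)"
proof (rule finite_subset)
  show "cubes i \<subseteq> box n (\<lambda>_. K) \<times> Pow {1..n}"
    using upward_closedD(1)[OF M] unfolding cubes_def box_def by fastforce
qed (use finite_box in auto)

definition cube :: "nat \<Rightarrow> nat \<Rightarrow> (nat \<Rightarrow>\<^sub>0 nat) \<times> nat set" where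
  "cube i = (SOME f. bij_betw f {..<card (cubes i)} (cubes i))"

lemma cube_bij: "bij_betw (cube i) {..<card (cubes i)} (cubes i)"
proof -
  obtain f where "bij_betw f {0..<card (cubes i)} (cubes i)"
    using ex_bij_betw_nat_finite[OF finite_cubes] by blast
  then show ?thesis unfolding cube_def using someI[of "\<lambda>f. bij_betw f {..<card (cubes i)} (cubes i)" f]
    by (simp add: lessThan_atLeast0)
qed

lemma cube_in: "r < card (cubes i) \<Longrightarrow> cube i r \<in> cubes i"
  using cube_bij[of i] unfolding bij_betw_def by auto

definition cube_index :: "nat \<Rightarrow> (nat \<Rightarrow>\<^sub>0 nat) \<times> nat set \<Rightarrow> nat" where
  "cube_index i = the_inv_into {..<card (cubes i)} (cube i)"

lemma cube_index_less: "q \<in> cubes i \<Longrightarrow> cube_index i q < card (cubes i)"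
  unfolding cube_index_def using cube_bij[of i] the_inv_into_into[of "cube i" "{..<card (cubes i)}" q "{..<card (cubes i)}"]
  by (auto simp: bij_betw_def)

lemma cube_cube_index: "q \<in> cubes i \<Longrightarrow> cube i (cube_index i q) = q"
  unfolding cube_index_def using cube_bij[of i] by (intro f_the_inv_into_f) (auto simp: bij_betw_def)

lemma cube_index_cube: "r < card (cubes i) \<Longrightarrow> cube_index i (cube i r) = r"
  unfolding cube_index_def using cube_bij[of i] by (intro the_inv_into_f_f) (auto simp: bij_betw_def)

definition chain_of :: "nat \<Rightarrow> 'a::zero vec \<Rightarrow> 'a chain" where
  "chain_of i v m \<tau> = (if (m, \<tau>) \<in> cubes i then v $ cube_index i (m, \<tau>) else 0)"

definition vec_of :: "nat \<Rightarrow> 'a chain \<Rightarrow> 'a vec" where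
  "vec_of i c = vec (card (cubes i)) (\<lambda>r. case cube i r of (m, \<tau>) \<Rightarrow> c m \<tau>)"

lemma chain_of_vec_of: "(m, \<tau>) \<in> cubes i \<Longrightarrow> chain_of i (vec_of i c) m \<tau> = c m \<tau>"
  unfolding chain_of_def vec_of_def using cube_index_less cube_cube_index by simp

lemma vec_eq_chain_of:
  assumes "v \<in> carrier_vec (card (cubes i))" "w \<in> carrier_vec (card (cubes i))"
    "\<And>m \<tau>. (m, \<tau>) \<in> cubes i \<Longrightarrow> chain_of i v m \<tau> = chain_of i w m \<tau>"
  shows "v = w"
proof (rule eq_vecI)
  fix r assume "r < dim_vec w"
  then have r: "r < card (cubes i)" using assms(2) by simp
  obtain m \<tau> where q: "cube i r = (m, \<tau>)" by fastforce
  have "(m, \<tau>) \<in> cubes i" using cube_in[OF r] q by simp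
  then show "v $ r = w $ r" using assms(3)[of m \<tau>] cube_index_cube[OF r] q unfolding chain_of_def by simp
qed (use assms in auto)

lemma sum_cubes_eq:
  "(\<Sum>r<card (cubes i). f (cube i r)) = (\<Sum>q\<in>cubes i. f q)"
  by (rule sum.reindex_bij_betw[OF cube_bij])

text \<open>Together with \<open>upper_cube\<close> this keeps the facets of a cube in the truncated
  region; the upper facet stays in the ideal because \<open>M\<close> is upward closed.\<close>

lemma lower_cube:
  assumes "(m, insert j \<tau>) \<in> cubes (Suc i)" "j \<in> {1..n} - \<tau>"
  shows "(m, \<tau>) \<in> cubes i"
proof -
  have "finite \<tau>" using assms(1) unfolding cubes_def by (auto intro: finite_subset)
  moreover have "lookup m k + (if k \<in> \<tau> then 1 else 0) \<le> K" if "k \<in> {1..n}" for k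
  proof -
    have "lookup m k + (if k \<in> insert j \<tau> then 1 else 0) \<le> K" using assms(1) that unfolding cubes_def by blast
    then show ?thesis by (auto split: if_splits)
  qed
  ultimately show ?thesis using assms unfolding cubes_def by auto
qed

lemma upper_cube:
  assumes "(update j (lookup m j - 1) m, insert j \<tau>) \<in> cubes (Suc i)" "j \<in> {1..n} - \<tau>" "0 < lookup m j"
  shows "(m, \<tau>) \<in> cubes i"
proof -
  let ?m = "update j (lookup m j - 1) m"
  have "m \<in> M" by (rule upward_closed_update[OF M, of j "lookup m j - 1"]) (use assms in \<open>auto simp: cubes_def\<close>)
  moreover have "finite \<tau>" using assms(1) unfolding cubes_def by (auto intro: finite_subset)
  moreover have "lookup m k + (if k \<in> \<tau> then 1 else 0) \<le> K" if "k \<in> {1..n}" for k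
  proof -
    have "lookup ?m k + (if k \<in> insert j \<tau> then 1 else 0) \<le> K" using assms(1) that unfolding cubes_def by blast
    then show ?thesis using assms(2,3) by (cases "k = j") (auto simp: lookup_update split: if_splits)
  qed
  ultimately show ?thesis using assms unfolding cubes_def by auto
qed

definition wbd :: "(nat \<Rightarrow> 'a::comm_ring_1) \<Rightarrow> 'a chain \<Rightarrow> 'a chain" where
  "wbd X c m \<tau> = (\<Sum>j\<in>{1..n} - \<tau>. of_int (isgn n j \<tau>) *
     ((if 0 < lookup m j then c (update j (lookup m j - 1) m) (insert j \<tau>) else 0) - X j * c m (insert j \<tau>)))"

text \<open>A facet \<open>(m, \<tau>)\<close> or \<open>(m + 1\<^sub>j, \<tau>)\<close> of the cube \<open>(m, \<tau> \<union> {j})\<close> enters the boundary with the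
  quotient of the labels \<open>x\<^sup>(\<^sup>m\<^sup>+\<^sup>1\<^sup>)\<close> of the two cubes, which is \<open>X j = x\<^sub>j\<close> for the first and 1 for the second.
  The values \<open>X = 0\<close> and \<open>X = 1\<close> give the complex tensored with the field and its strands.\<close>

definition facet_coeff :: "(nat \<Rightarrow> 'a::comm_ring_1) \<Rightarrow> (nat \<Rightarrow>\<^sub>0 nat) \<times> nat set \<Rightarrow> (nat \<Rightarrow>\<^sub>0 nat) \<times> nat set \<Rightarrow> 'a" where
  "facet_coeff X q' q = (\<Sum>j\<in>{1..n} - snd q'. if snd q = insert j (snd q') then
     of_int (isgn n j (snd q')) * ((if fst q' = fst q + single j 1 then 1 else 0) - (if fst q' = fst q then X j else 0))
     else 0)"

definition dmat :: "(nat \<Rightarrow> 'a::comm_ring_1) \<Rightarrow> nat \<Rightarrow> 'a mat" where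
  "dmat X i = mat (card (cubes i)) (card (cubes (Suc i))) (\<lambda>(r, c). facet_coeff X (cube i r) (cube (Suc i) c))"

lemma dmat_carrier [simp]: "dmat X i \<in> carrier_mat (card (cubes i)) (card (cubes (Suc i)))"
  unfolding dmat_def by simp

lemma chain_of_dmat_mult:
  fixes X :: "nat \<Rightarrow> 'a::comm_ring_1"
  assumes v: "v \<in> carrier_vec (card (cubes (Suc i)))" and q: "(m, \<tau>) \<in> cubes i"
  shows "chain_of i (dmat X i *\<^sub>v v) m \<tau> = wbd X (chain_of (Suc i) v) m \<tau>"
proof -
  let ?C = "\<lambda>q. chain_of (Suc i) v (fst q) (snd q)"
  have vC: "v $ c = ?C (cube (Suc i) c)" if "c < card (cubes (Suc i))" for c
    using cube_in[OF that] cube_index_cube[OF that] unfolding chain_of_def by simp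
  have "chain_of i (dmat X i *\<^sub>v v) m \<tau> = (\<Sum>c<card (cubes (Suc i)). facet_coeff X (m, \<tau>) (cube (Suc i) c) * v $ c)"
    using q v cube_index_less[OF q] cube_cube_index[OF q]
    by (simp add: chain_of_def dmat_def scalar_prod_def lessThan_atLeast0)
  also have "\<dots> = (\<Sum>c<card (cubes (Suc i)). facet_coeff X (m, \<tau>) (cube (Suc i) c) * ?C (cube (Suc i) c))"
    using vC by (intro sum.cong refl) simp
  also have "\<dots> = (\<Sum>q\<in>cubes (Suc i). facet_coeff X (m, \<tau>) q * ?C q)"
    by (rule sum_cubes_eq)
  also have "\<dots> = (\<Sum>q\<in>cubes (Suc i). \<Sum>j\<in>{1..n} - \<tau>. of_int (isgn n j \<tau>) *
      ((if 0 < lookup m j then if q = (update j (lookup m j - 1) m, insert j \<tau>) then ?C q else 0 else 0) -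
       X j * (if q = (m, insert j \<tau>) then ?C q else 0)))"
  proof (intro sum.cong refl)
    fix q :: "(nat \<Rightarrow>\<^sub>0 nat) \<times> nat set"
    obtain m' \<sigma> where [simp]: "q = (m', \<sigma>)" by fastforce
    have iff: "m = m' + single j 1 \<longleftrightarrow> 0 < lookup m j \<and> m' = update j (lookup m j - 1) m" for j
    proof
      assume e: "m = m' + single j 1"
      then have "lookup m j = lookup m' j + 1" by (simp add: lookup_add)
      moreover have "update j (lookup m' j) m = m'" unfolding e
        by (intro poly_mapping_eqI) (auto simp: lookup_add lookup_update lookup_single when_def)
      ultimately show "0 < lookup m j \<and> m' = update j (lookup m j - 1) m" by simp
    next
      assume "0 < lookup m j \<and> m' = update j (lookup m j - 1) m"
      then show "m = m' + single j 1" using single_update_lookup[of m j] by simp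
    qed
    show "facet_coeff X (m, \<tau>) q * ?C q = (\<Sum>j\<in>{1..n} - \<tau>. of_int (isgn n j \<tau>) *
      ((if 0 < lookup m j then if q = (update j (lookup m j - 1) m, insert j \<tau>) then ?C q else 0 else 0) -
       X j * (if q = (m, insert j \<tau>) then ?C q else 0)))"
      unfolding facet_coeff_def sum_distrib_right
    proof (rule sum.cong)
      fix j
      define P where "P \<longleftrightarrow> fst (m, \<tau>) = fst q + single j 1"
      have "(if 0 < lookup m j then if q = (update j (lookup m j - 1) m, insert j \<tau>) then ?C q else 0 else 0) =
          (if P \<and> \<sigma> = insert j \<tau> then ?C q else 0)"
        using iff[of j] unfolding P_def by (simp only: fst_conv prod.inject \<open>q = (m', \<sigma>)\<close>) auto
      then show "(if snd q = insert j (snd (m, \<tau>)) then of_int (isgn n j (snd (m, \<tau>))) *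
          ((if fst (m, \<tau>) = fst q + single j 1 then 1 else 0) - (if fst (m, \<tau>) = fst q then X j else 0)) else 0) * ?C q =
        of_int (isgn n j \<tau>) *
         ((if 0 < lookup m j then if q = (update j (lookup m j - 1) m, insert j \<tau>) then ?C q else 0 else 0) -
          X j * (if q = (m, insert j \<tau>) then ?C q else 0))"
        unfolding P_def[symmetric] by (simp only:) (auto simp: algebra_simps)
    qed simp
  qed
  also have "\<dots> = (\<Sum>j\<in>{1..n} - \<tau>. of_int (isgn n j \<tau>) *
      ((if 0 < lookup m j then \<Sum>q\<in>cubes (Suc i). if q = (update j (lookup m j - 1) m, insert j \<tau>) then ?C q else 0 else 0) -
       X j * (\<Sum>q\<in>cubes (Suc i). if q = (m, insert j \<tau>) then ?C q else 0)))"
    by (subst sum.swap) (intro sum.cong refl, auto simp: sum_subtractf sum_distrib_left right_diff_distrib)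
  also have "\<dots> = wbd X (chain_of (Suc i) v) m \<tau>"
    unfolding wbd_def using finite_cubes by (intro sum.cong refl) (auto simp: sum.delta chain_of_def)
  finally show ?thesis .
qed

section \<open>Multigraded strands of the cubical complex\<close>

definition deg :: "(nat \<Rightarrow>\<^sub>0 nat) \<Rightarrow> nat set \<Rightarrow> nat \<Rightarrow>\<^sub>0 nat" where
  "deg m \<tau> = m + ind \<tau>"

text \<open>The basis element of a cube has the exponent vector of its top vertex as multidegree;
  \<open>strand i v a\<close> is the component of \<open>v\<close> in multidegree \<open>a\<close>.
  The guard is essential, since subtraction of exponent vectors truncates.\<close>

definition strand :: "nat \<Rightarrow> 'k::field mpoly vec \<Rightarrow> (nat \<Rightarrow>\<^sub>0 nat) \<Rightarrow> 'k chain" where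
  "strand i v a m \<tau> = (if \<forall>j. lookup (deg m \<tau>) j \<le> lookup a j then lookup (chain_of i v m \<tau>) (a - deg m \<tau>) else 0)"

lemma cubes_finite: "(m, \<tau>) \<in> cubes i \<Longrightarrow> finite \<tau>"
  unfolding cubes_def by (auto intro: finite_subset)

lemma lookup_deg: "finite \<tau> \<Longrightarrow> lookup (deg m \<tau>) j = lookup m j + (if j \<in> \<tau> then 1 else 0)"
  unfolding deg_def by (simp add: lookup_add lookup_ind)

lemma strand_nonzero:
  assumes "strand i v a m \<tau> \<noteq> 0"
  shows "(m, \<tau>) \<in> cubes i" "\<And>j. lookup (deg m \<tau>) j \<le> lookup a j" "a - deg m \<tau> \<in> keys (chain_of i v m \<tau>)"
  using assms unfolding strand_def chain_of_def by (auto split: if_splits simp: in_keys_iff)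

lemma strand_chain: "cubical_chain n M (\<lambda>j. min (lookup a j) K) i (strand i v a)"
  unfolding cubical_chain_def
proof (intro allI impI)
  fix m \<tau> assume "strand i v a m \<tau> \<noteq> 0"
  note s = strand_nonzero[OF this]
  show "m \<in> M \<and> \<tau> \<subseteq> {1..n} \<and> card \<tau> = i \<and>
      (\<forall>j\<in>{1..n}. lookup m j + (if j \<in> \<tau> then 1 else 0) \<le> min (lookup a j) K)"
    using s(1) s(2)[unfolded lookup_deg[OF cubes_finite[OF s(1)]]] unfolding cubes_def by auto
qed

lemma isgn_cases: "isgn n j \<tau> = 1 \<or> isgn n j \<tau> = -1"
  using isgn_square[of n j \<tau>] zmult_eq_1_iff by blast

lemma lookup_isgn_times:
  fixes f :: "'k::field mpoly"
  shows "lookup (of_int (isgn n j \<tau>) * f) k = of_int (isgn n j \<tau>) * lookup f k"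
  using isgn_cases[of j \<tau>] by auto

text \<open>In a fixed multidegree the coefficient monomial of a cube is determined by its top
  vertex, so the weights \<open>var j\<close> disappear and the matrix acts as the unweighted
  boundary over the field.\<close>

lemma strand_dmat_mult:
  fixes v :: "'k::field mpoly vec"
  assumes v: "v \<in> carrier_vec (card (cubes (Suc i)))"
  shows "strand i (dmat var i *\<^sub>v v) a m \<tau> = bd n (strand (Suc i) v a) m \<tau>"
proof (cases "(m, \<tau>) \<in> cubes i")
  case False
  have "vdiff j (strand (Suc i) v a) m (insert j \<tau>) = 0" if "j \<in> {1..n} - \<tau>" for j
  proof -
    have "strand (Suc i) v a m (insert j \<tau>) = 0"
      using lower_cube[OF _ that] False strand_nonzero(1) by blast
    moreover have "strand (Suc i) v a (update j (lookup m j - 1) m) (insert j \<tau>) = 0" if "0 < lookup m j"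
      using upper_cube[OF _ \<open>j \<in> {1..n} - \<tau>\<close> that] False strand_nonzero(1) by blast
    ultimately show ?thesis by (simp add: vdiff_def)
  qed
  then show ?thesis using False strand_nonzero(1) unfolding bd_def by (metis (no_types, lifting) mult_zero_right sum.neutral)
next
  case True
  note fin = cubes_finite[OF True]
  have d1: "deg (update j (lookup m j - 1) m) (insert j \<tau>) = deg m \<tau>" if "j \<in> {1..n} - \<tau>" "0 < lookup m j" for j
    using that fin by (intro poly_mapping_eqI) (auto simp: lookup_deg lookup_update)
  have d2: "deg m (insert j \<tau>) = deg m \<tau> + single j 1" if "j \<in> {1..n} - \<tau>" for j
    using that fin by (intro poly_mapping_eqI) (auto simp: lookup_deg lookup_add lookup_single when_def)
  show ?thesis
  proof (cases "\<forall>j. lookup (deg m \<tau>) j \<le> lookup a j")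
    case le: False
    have "vdiff j (strand (Suc i) v a) m (insert j \<tau>) = 0" if j: "j \<in> {1..n} - \<tau>" for j
    proof -
      obtain l where "\<not> lookup (deg m \<tau>) l \<le> lookup a l" using le by blast
      then have "\<not> lookup (deg m (insert j \<tau>)) l \<le> lookup a l" unfolding d2[OF j] by (simp add: lookup_add)
      then have "strand (Suc i) v a m (insert j \<tau>) = 0" unfolding strand_def by auto
      moreover have "strand (Suc i) v a (update j (lookup m j - 1) m) (insert j \<tau>) = 0" if "0 < lookup m j"
        using le unfolding strand_def d1[OF j that] by presburger
      ultimately show ?thesis by (simp add: vdiff_def)
    qed
    then have "bd n (strand (Suc i) v a) m \<tau> = 0" unfolding bd_def by (intro sum.neutral) simp
    then show ?thesis using le unfolding strand_def[of i] by presburger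
  next
    case le: True
    let ?k = "a - deg m \<tau>" and ?c = "chain_of (Suc i) v"
    have "strand i (dmat var i *\<^sub>v v) a m \<tau> = lookup (wbd var ?c m \<tau>) ?k"
      using le chain_of_dmat_mult[OF v True, of var] unfolding strand_def by simp
    also have "\<dots> = (\<Sum>j\<in>{1..n} - \<tau>. of_int (isgn n j \<tau>) *
        ((if 0 < lookup m j then lookup (?c (update j (lookup m j - 1) m) (insert j \<tau>)) ?k else 0) -
          lookup (var j * ?c m (insert j \<tau>)) ?k))"
      unfolding wbd_def lookup_sum lookup_isgn_times by (intro sum.cong refl) (auto simp: lookup_minus)
    also have "\<dots> = bd n (strand (Suc i) v a) m \<tau>"
      unfolding bd_def
    proof (intro sum.cong refl)
      fix j assume j: "j \<in> {1..n} - \<tau>"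
      have "lookup (?c (update j (lookup m j - 1) m) (insert j \<tau>)) ?k =
          strand (Suc i) v a (update j (lookup m j - 1) m) (insert j \<tau>)" if "0 < lookup m j"
        using le unfolding strand_def d1[OF j that] by simp
      moreover have "lookup (var j * ?c m (insert j \<tau>)) ?k = strand (Suc i) v a m (insert j \<tau>)"
      proof -
        have iff: "(\<forall>l. lookup (single j 1) l \<le> lookup ?k l) \<longleftrightarrow> (\<forall>l. lookup (deg m (insert j \<tau>)) l \<le> lookup a l)"
        proof -
          have "lookup (single j 1) l \<le> lookup ?k l \<longleftrightarrow> lookup (deg m (insert j \<tau>)) l \<le> lookup a l" for l
            using le[rule_format, of l] unfolding d2[OF j] by (simp add: lookup_add lookup_minus) linarith
          then show ?thesis by simp
        qed
        have e: "?k - single j 1 = a - deg m (insert j \<tau>)"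
          unfolding d2[OF j] by (intro poly_mapping_eqI) (simp add: lookup_add lookup_minus)
        show ?thesis unfolding var_def lookup_times_single iff e strand_def ..
      qed
      ultimately show "of_int (isgn n j \<tau>) *
        ((if 0 < lookup m j then lookup (?c (update j (lookup m j - 1) m) (insert j \<tau>)) ?k else 0) -
          lookup (var j * ?c m (insert j \<tau>)) ?k) = of_int (isgn n j \<tau>) * vdiff j (strand (Suc i) v a) m (insert j \<tau>)"
        by (simp add: vdiff_def)
    qed
    finally show ?thesis .
  qed
qed

end

definition mono_ideal :: "nat \<Rightarrow> (nat \<Rightarrow>\<^sub>0 nat) set \<Rightarrow> 'k::field mpoly set" where
  "mono_ideal n M = {f \<in> mpolys n. keys f \<subseteq> M}"

lemma sum_single_lookup: "(\<Sum>a\<in>keys f. single a (lookup f a)) = f"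
proof (rule poly_mapping_eqI)
  fix k
  have "lookup (\<Sum>a\<in>keys f. single a (lookup f a)) k = (\<Sum>a\<in>keys f. if a = k then lookup f a else 0)"
    by (simp add: lookup_sum lookup_single when_def)
  then show "lookup (\<Sum>a\<in>keys f. single a (lookup f a)) k = lookup f k"
    by (simp add: sum.delta in_keys_iff)
qed

context monomial_box
begin

lemma keys_deg: "(m, \<tau>) \<in> cubes i \<Longrightarrow> keys (deg m \<tau>) \<subseteq> {1..n}"
  using upward_closedD(1)[OF M, of m] keys_add[of m "ind \<tau>"] keys_ind[OF cubes_finite]
  unfolding deg_def cubes_def by blast

lemma chain_deg_le:
  assumes e: "cubical_chain n M (\<lambda>j. min (lookup a j) K) i e" and nz: "e m \<tau> \<noteq> 0"
  shows "(m, \<tau>) \<in> cubes i" "\<And>j. lookup (deg m \<tau>) j \<le> lookup a j"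
proof -
  note d = cubical_chainD[OF e nz]
  show c: "(m, \<tau>) \<in> cubes i" using d unfolding cubes_def by auto
  fix j show "lookup (deg m \<tau>) j \<le> lookup a j"
  proof (cases "j \<in> {1..n}")
    case True
    then show ?thesis using d(4)[OF True] by (simp add: lookup_deg[OF cubes_finite[OF c]])
  next
    case False
    then have "lookup (deg m \<tau>) j = 0" using keys_deg[OF c] by (meson in_keys_iff subsetD)
    then show ?thesis by simp
  qed
qed

text \<open>The inverse of decomposing into strands, for a finite set \<open>A\<close> of
  multidegrees.\<close>

definition glue :: "nat \<Rightarrow> (nat \<Rightarrow>\<^sub>0 nat) set \<Rightarrow> ((nat \<Rightarrow>\<^sub>0 nat) \<Rightarrow> 'k::field chain) \<Rightarrow> 'k mpoly vec" where
  "glue i A e = vec_of i (\<lambda>m \<tau>. \<Sum>a\<in>A. single (a - deg m \<tau>) (e a m \<tau>))"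

lemma glue_carrier [simp]: "glue i A e \<in> carrier_vec (card (cubes i))"
  unfolding glue_def vec_of_def by simp

lemma strand_glue:
  fixes e :: "(nat \<Rightarrow>\<^sub>0 nat) \<Rightarrow> 'k::field chain"
  assumes fin: "finite A" and e: "\<And>a. a \<in> A \<Longrightarrow> cubical_chain n M (\<lambda>j. min (lookup a j) K) i (e a)"
  shows "strand i (glue i A e) a m \<tau> = (if a \<in> A then e a m \<tau> else 0)"
proof (cases "(m, \<tau>) \<in> cubes i \<and> (\<forall>j. lookup (deg m \<tau>) j \<le> lookup a j)")
  case False
  have "strand i (glue i A e) a m \<tau> = 0" using False strand_nonzero(1,2) by blast
  moreover have "e a m \<tau> = 0" if "a \<in> A" using False chain_deg_le[OF e[OF that]] by blast
  ultimately show ?thesis by simp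
next
  case True
  have "strand i (glue i A e) a m \<tau> = lookup (\<Sum>a'\<in>A. single (a' - deg m \<tau>) (e a' m \<tau>)) (a - deg m \<tau>)"
    using True unfolding strand_def glue_def by (simp add: chain_of_vec_of)
  also have "\<dots> = (\<Sum>a'\<in>A. if a' = a then e a' m \<tau> else 0)"
    unfolding lookup_sum
  proof (intro sum.cong refl)
    fix a' assume a': "a' \<in> A"
    show "lookup (single (a' - deg m \<tau>) (e a' m \<tau>)) (a - deg m \<tau>) = (if a' = a then e a' m \<tau> else 0)"
    proof (cases "e a' m \<tau> = 0")
      case False
      have "a' = a" if eq: "a' - deg m \<tau> = a - deg m \<tau>"
      proof (rule poly_mapping_eqI)
        fix j
        have "lookup a' j - lookup (deg m \<tau>) j = lookup a j - lookup (deg m \<tau>) j"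
          using arg_cong[OF eq, of "\<lambda>f. lookup f j"] by (simp add: lookup_minus)
        then show "lookup a' j = lookup a j"
          using True[THEN conjunct2, rule_format, of j] chain_deg_le(2)[OF e[OF a'] False, of j] by linarith
      qed
      then show ?thesis by (auto simp: lookup_single when_def)
    qed auto
  qed
  also have "\<dots> = (if a \<in> A then e a m \<tau> else 0)" using fin by (simp add: sum.delta)
  finally show ?thesis .
qed

lemma glue_free_mod:
  assumes "\<And>a. a \<in> A \<Longrightarrow> keys a \<subseteq> {1..n}"
  shows "glue i A e \<in> free_mod n (card (cubes i))"
proof (rule free_modI)
  fix r assume r: "r < card (cubes i)"
  obtain m \<tau> where q: "cube i r = (m, \<tau>)" by fastforce
  have "glue i A e $ r = (\<Sum>a\<in>A. single (a - deg m \<tau>) (e a m \<tau>))"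
    unfolding glue_def vec_of_def using r q by simp
  moreover have "single (a - deg m \<tau>) (e a m \<tau>) \<in> mpolys n" if "a \<in> A" for a
  proof -
    have "keys (a - deg m \<tau>) \<subseteq> keys a" by (auto simp: in_keys_iff lookup_minus)
    then show ?thesis using assms[OF that] unfolding mpolys_def by auto
  qed
  ultimately show "glue i A e $ r \<in> mpolys n" by auto
qed simp

definition degs :: "nat \<Rightarrow> 'k::field mpoly vec \<Rightarrow> (nat \<Rightarrow>\<^sub>0 nat) set" where
  "degs i v = (\<Union>(m, \<tau>)\<in>cubes i. (\<lambda>k. k + deg m \<tau>) ` keys (chain_of i v m \<tau>))"

lemma finite_degs: "finite (degs i v)"
  unfolding degs_def using finite_cubes by auto

lemma strand_outside_degs:
  assumes "a \<notin> degs i v"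
  shows "strand i v a m \<tau> = 0"
proof (rule ccontr)
  assume nz: "strand i v a m \<tau> \<noteq> 0"
  note s = strand_nonzero[OF nz]
  have "a = (a - deg m \<tau>) + deg m \<tau>" using s(2) by (intro poly_mapping_eqI) (simp add: lookup_add lookup_minus)
  then have "a \<in> degs i v" unfolding degs_def using s(1,3) by blast
  then show False using assms by simp
qed

lemma keys_degs:
  assumes v: "v \<in> free_mod n (card (cubes i))" and a: "a \<in> degs i v"
  shows "keys a \<subseteq> {1..n}"
proof -
  obtain m \<tau> k where q: "(m, \<tau>) \<in> cubes i" "k \<in> keys (chain_of i v m \<tau>)" "a = k + deg m \<tau>"
    using a unfolding degs_def by auto
  have "chain_of i v m \<tau> \<in> mpolys n"
    using q(1) free_modD(2)[OF v cube_index_less[OF q(1)]] unfolding chain_of_def by simp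
  then have "keys k \<subseteq> {1..n}" using q(2) unfolding mpolys_def by blast
  then show ?thesis using q(3) keys_add[of k "deg m \<tau>"] keys_deg[OF q(1)] by blast
qed

lemma vec_eq_strand:
  assumes "v \<in> carrier_vec (card (cubes i))" "w \<in> carrier_vec (card (cubes i))"
    and eq: "\<And>a m \<tau>. strand i v a m \<tau> = strand i w a m \<tau>"
  shows "v = w"
proof (rule vec_eq_chain_of[OF assms(1,2)])
  fix m \<tau> assume "(m, \<tau>) \<in> cubes i"
  show "chain_of i v m \<tau> = chain_of i w m \<tau>"
  proof (rule poly_mapping_eqI)
    fix k
    have "strand i u (k + deg m \<tau>) m \<tau> = lookup (chain_of i u m \<tau>) k" for u
      unfolding strand_def by (simp add: lookup_add)
    then show "lookup (chain_of i v m \<tau>) k = lookup (chain_of i w m \<tau>) k" using eq by metis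
  qed
qed

text \<open>Exactness may be tested in each multidegree: \<open>v\<close> has finitely many nonzero
  strands, and their chosen preimages are glued.\<close>

lemma exact_of_strands:
  fixes v :: "'k::field mpoly vec"
  assumes v: "v \<in> free_mod n (card (cubes i))"
    and ex: "\<And>a. \<exists>e. cubical_chain n M (\<lambda>j. min (lookup a j) K) (Suc i) e \<and> strand i v a = bd n e"
  shows "v \<in> (\<lambda>w. dmat var i *\<^sub>v w) ` free_mod n (card (cubes (Suc i)))"
proof -
  obtain e where e: "\<And>a. cubical_chain n M (\<lambda>j. min (lookup a j) K) (Suc i) (e a)" "\<And>a. strand i v a = bd n (e a)"
    using ex by metis
  define w where "w = glue (Suc i) (degs i v) e"
  have w: "w \<in> free_mod n (card (cubes (Suc i)))"
    unfolding w_def using keys_degs[OF v] by (rule glue_free_mod)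
  have "dmat var i *\<^sub>v w = v"
  proof (rule vec_eq_strand[of _ i])
    fix a m \<tau>
    have "strand i (dmat var i *\<^sub>v w) a m \<tau> = bd n (strand (Suc i) w a) m \<tau>"
      using free_modD(1)[OF w] by (rule strand_dmat_mult)
    also have "strand (Suc i) w a = (\<lambda>m \<tau>. if a \<in> degs i v then e a m \<tau> else 0)"
      unfolding w_def by (intro ext strand_glue finite_degs e(1))
    also have "bd n \<dots> m \<tau> = strand i v a m \<tau>"
    proof (cases "a \<in> degs i v")
      case True
      then show ?thesis using e(2)[of a] by simp
    next
      case False
      then show ?thesis using strand_outside_degs[OF False] by (simp add: bd_def vdiff_def)
    qed
    finally show "strand i (dmat var i *\<^sub>v w) a m \<tau> = strand i v a m \<tau>" .
  qed (use free_modD(1)[OF w] free_modD(1)[OF v] in \<open>auto intro!: mult_mat_vec_carrier[OF dmat_carrier]\<close>)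
  then show ?thesis using w by blast
qed

lemma dmat_dmat_zero:
  fixes v :: "'k::field mpoly vec"
  assumes v: "v \<in> carrier_vec (card (cubes (Suc (Suc i))))"
  shows "dmat var i *\<^sub>v (dmat var (Suc i) *\<^sub>v v) = 0\<^sub>v (card (cubes i))"
proof (rule vec_eq_strand[of _ i])
  have c: "dmat var (Suc i) *\<^sub>v v \<in> carrier_vec (card (cubes (Suc i)))" by (rule mult_mat_vec_carrier[OF dmat_carrier v])
  fix a m \<tau>
  have "strand (Suc i) (dmat var (Suc i) *\<^sub>v v) a = bd n (strand (Suc (Suc i)) v a)"
    using strand_dmat_mult[OF v] by (intro ext)
  then have "strand i (dmat var i *\<^sub>v (dmat var (Suc i) *\<^sub>v v)) a m \<tau> = 0"
    using strand_dmat_mult[OF c] bd_bd by metis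
  moreover have "strand i (0\<^sub>v (card (cubes i)) :: 'k mpoly vec) a m \<tau> = 0"
    using cube_index_less[of "(m, \<tau>)" i] unfolding strand_def chain_of_def by auto
  ultimately show "strand i (dmat var i *\<^sub>v (dmat var (Suc i) *\<^sub>v v)) a m \<tau> =
    strand i (0\<^sub>v (card (cubes i))) a m \<tau>" by simp
qed (use mult_mat_vec_carrier[OF dmat_carrier mult_mat_vec_carrier[OF dmat_carrier v]] in auto)

lemma facet_coeff_mpolys: "facet_coeff var q' q \<in> mpolys n"
  unfolding facet_coeff_def
proof (rule mpolys_sum)
  fix j assume "j \<in> {1..n} - snd q'"
  then have "var j \<in> (mpolys n :: 'a mpoly set)" unfolding var_def mpolys_def by auto
  then have "(if fst q' = fst q + single j 1 then 1 else 0) - (if fst q' = fst q then var j else 0) \<in> (mpolys n :: 'a mpoly set)"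
    (is "?f \<in> _") by (intro mpolys_minus) auto
  then have "of_int (isgn n j (snd q')) * ?f \<in> mpolys n"
    using isgn_cases[of j "snd q'"] mpolys_uminus[of ?f n] by (elim disjE) (simp_all only: of_int_1 of_int_minus mult_1 mult_minus_left)
  then show "(if snd q = insert j (snd q') then of_int (isgn n j (snd q')) * ?f else 0) \<in> mpolys n" by simp
qed

lemma dmat_free_hom: "dmat var i \<in> free_hom n (card (cubes i)) (card (cubes (Suc i)))"
  by (rule free_homI) (auto simp: dmat_def facet_coeff_mpolys)

lemma exact_Suc:
  "{v \<in> free_mod n (card (cubes (Suc i))). dmat var i *\<^sub>v v = 0\<^sub>v (card (cubes i))} =
   (\<lambda>w. dmat var (Suc i) *\<^sub>v w :: 'k::field mpoly vec) ` free_mod n (card (cubes (Suc (Suc i))))"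
  (is "?L = ?R")
proof
  show "?R \<subseteq> ?L" using dmat_dmat_zero dmat_free_hom free_modD(1) by blast
  show "?L \<subseteq> ?R"
  proof
    fix v assume "v \<in> ?L"
    then have v: "v \<in> free_mod n (card (cubes (Suc i)))" and z: "dmat var i *\<^sub>v v = 0\<^sub>v (card (cubes i))" by auto
    show "v \<in> ?R"
    proof (rule exact_of_strands[OF v])
      fix a
      have "bd n (strand (Suc i) v a) m \<tau> = 0" for m \<tau>
      proof -
        have "bd n (strand (Suc i) v a) m \<tau> = strand i (0\<^sub>v (card (cubes i))) a m \<tau>"
          using strand_dmat_mult[OF free_modD(1)[OF v], of a m \<tau>] unfolding z by simp
        then show ?thesis using cube_index_less[of "(m, \<tau>)" i] unfolding strand_def chain_of_def by (auto split: if_splits)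
      qed
      then show "\<exists>e. cubical_chain n M (\<lambda>j. min (lookup a j) K) (Suc (Suc i)) e \<and> strand (Suc i) v a = bd n e"
        using cubical_exact[OF M strand_chain] by metis
    qed
  qed
qed

section \<open>The augmentation and the resolution theorem\<close>

definition aug_vec :: "'k::field mpoly vec" where
  "aug_vec = vec_of 0 (\<lambda>m \<tau>. single m 1)"

lemma cubes_0D:
  assumes "(m, \<tau>) \<in> cubes 0"
  shows "\<tau> = {}"
proof -
  have "card \<tau> = 0" using assms unfolding cubes_def by simp
  then show ?thesis using cubes_finite[OF assms] by simp
qed

lemma aug_vec_prod:
  fixes v :: "'k::field mpoly vec"
  assumes v: "v \<in> carrier_vec (card (cubes 0))"
  shows "aug_vec \<bullet> v = (\<Sum>q\<in>cubes 0. single (fst q) 1 * chain_of 0 v (fst q) (snd q))"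
proof -
  have "aug_vec \<bullet> v = (\<Sum>r<card (cubes 0). single (fst (cube 0 r)) 1 * chain_of 0 v (fst (cube 0 r)) (snd (cube 0 r)))"
    unfolding scalar_prod_def carrier_vecD[OF v] lessThan_atLeast0
  proof (intro sum.cong refl)
    fix r assume "r \<in> {0..<card (cubes 0)}"
    then have r: "r < card (cubes 0)" by simp
    obtain m \<tau> where q: "cube 0 r = (m, \<tau>)" by fastforce
    have "aug_vec $ r = (single m 1 :: 'k mpoly)" unfolding aug_vec_def vec_of_def using r q by simp
    moreover have "v $ r = chain_of 0 v m \<tau>"
      using cube_in[OF r] cube_index_cube[OF r] unfolding chain_of_def q by simp
    ultimately show "aug_vec $ r * v $ r = single (fst (cube 0 r)) 1 * chain_of 0 v (fst (cube 0 r)) (snd (cube 0 r))"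
      unfolding q by simp
  qed
  also have "\<dots> = (\<Sum>q\<in>cubes 0. single (fst q) 1 * chain_of 0 v (fst q) (snd q))"
    by (rule sum_cubes_eq)
  finally show ?thesis .
qed

lemma lookup_aug_vec_prod:
  fixes v :: "'k::field mpoly vec"
  assumes v: "v \<in> carrier_vec (card (cubes 0))"
  shows "lookup (aug_vec \<bullet> v) a = (\<Sum>m\<in>box n (\<lambda>j. min (lookup a j) K). strand 0 v a m {})"
proof -
  have "lookup (aug_vec \<bullet> v) a = (\<Sum>q\<in>cubes 0. strand 0 v a (fst q) {})"
    unfolding aug_vec_prod[OF v] lookup_sum
  proof (intro sum.cong refl)
    fix q assume "q \<in> cubes 0"
    then obtain m where q: "q = (m, {})" using cubes_0D by (metis surj_pair)
    have "deg m {} = m" unfolding deg_def ind_def by simp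
    then show "lookup (single (fst q) 1 * chain_of 0 v (fst q) (snd q)) a = strand 0 v a (fst q) {}"
      unfolding q by (simp add: lookup_times_single strand_def)
  qed
  also have "\<dots> = (\<Sum>m\<in>fst ` cubes 0. strand 0 v a m {})"
    by (rule sum.reindex[unfolded o_def, symmetric]) (auto simp: inj_on_def dest: cubes_0D)
  also have "\<dots> = (\<Sum>m\<in>fst ` cubes 0 \<inter> box n (\<lambda>j. min (lookup a j) K). strand 0 v a m {})"
  proof (rule sum.mono_neutral_right)
    show "\<forall>m\<in>fst ` cubes 0 - fst ` cubes 0 \<inter> box n (\<lambda>j. min (lookup a j) K). strand 0 v a m {} = 0"
    proof
      fix m assume m: "m \<in> fst ` cubes 0 - fst ` cubes 0 \<inter> box n (\<lambda>j. min (lookup a j) K)"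
      have "m \<in> box n (\<lambda>j. min (lookup a j) K)" if "strand 0 v a m {} \<noteq> 0"
      proof -
        note d = cubical_chainD[OF strand_chain that]
        show ?thesis using upward_closedD(1)[OF M d(1)] d(4) unfolding box_def by simp
      qed
      then show "strand 0 v a m {} = 0" using m by blast
    qed
  qed (use finite_cubes in auto)
  also have "\<dots> = (\<Sum>m\<in>box n (\<lambda>j. min (lookup a j) K). strand 0 v a m {})"
  proof (rule sum.mono_neutral_left)
    show "\<forall>m\<in>box n (\<lambda>j. min (lookup a j) K) - fst ` cubes 0 \<inter> box n (\<lambda>j. min (lookup a j) K). strand 0 v a m {} = 0"
    proof
      fix m assume m: "m \<in> box n (\<lambda>j. min (lookup a j) K) - fst ` cubes 0 \<inter> box n (\<lambda>j. min (lookup a j) K)"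
      have "m \<in> fst ` cubes 0" if "strand 0 v a m {} \<noteq> 0" using image_eqI[OF _ strand_nonzero(1)[OF that], of m fst] by simp
      then show "strand 0 v a m {} = 0" using m by blast
    qed
  qed (use finite_box in auto)
  finally show ?thesis .
qed

lemma exact_0:
  "{v \<in> free_mod n (card (cubes 0)). aug_vec \<bullet> v = 0} =
   (\<lambda>w. dmat var 0 *\<^sub>v w :: 'k::field mpoly vec) ` free_mod n (card (cubes (Suc 0)))"
  (is "?L = ?R")
proof
  show "?R \<subseteq> ?L"
  proof
    fix v assume "v \<in> ?R"
    then obtain w :: "'k mpoly vec" where w: "w \<in> free_mod n (card (cubes (Suc 0)))" "v = dmat var 0 *\<^sub>v w" by auto
    have v: "v \<in> free_mod n (card (cubes 0))" unfolding w(2) using dmat_free_hom w(1) by blast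
    have "aug_vec \<bullet> v = 0"
    proof (rule poly_mapping_eqI)
      fix a
      have "lookup (aug_vec \<bullet> v) a = (\<Sum>m\<in>box n (\<lambda>j. min (lookup a j) K). bd n (strand (Suc 0) w a) m {})"
        unfolding lookup_aug_vec_prod[OF free_modD(1)[OF v]] unfolding w(2) strand_dmat_mult[OF free_modD(1)[OF w(1)]] ..
      also have "\<dots> = 0" by (rule sum_box_bd[OF strand_chain])
      finally show "lookup (aug_vec \<bullet> v) a = lookup 0 a" by simp
    qed
    then show "v \<in> ?L" using v by simp
  qed
  show "?L \<subseteq> ?R"
  proof
    fix v assume "v \<in> ?L"
    then have v: "v \<in> free_mod n (card (cubes 0))" and z: "aug_vec \<bullet> v = 0" by auto
    show "v \<in> ?R"
    proof (rule exact_of_strands[OF v])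
      fix a
      have "(\<Sum>m\<in>box n (\<lambda>j. min (lookup a j) K). strand 0 v a m {}) = 0"
        using lookup_aug_vec_prod[OF free_modD(1)[OF v], of a] unfolding z by simp
      then show "\<exists>e. cubical_chain n M (\<lambda>j. min (lookup a j) K) (Suc 0) e \<and> strand 0 v a = bd n e"
        using cubical_exact_0[OF M strand_chain] by metis
    qed
  qed
qed

lemma aug_vec_image:
  "(\<lambda>v. aug_vec \<bullet> v) ` free_mod n (card (cubes 0)) = (mono_ideal n M :: 'k::field mpoly set)"
proof (intro equalityI subsetI)
  fix f :: "'k mpoly" assume "f \<in> (\<lambda>v. aug_vec \<bullet> v) ` free_mod n (card (cubes 0))"
  then obtain v where v: "v \<in> free_mod n (card (cubes 0))" "f = aug_vec \<bullet> v" by blast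
  have "keys f \<subseteq> M"
  proof
    fix a assume a: "a \<in> keys f"
    then have "(\<Sum>m\<in>box n (\<lambda>j. min (lookup a j) K). strand 0 v a m {}) \<noteq> 0"
      using lookup_aug_vec_prod[OF free_modD(1)[OF v(1)], of a] v(2) by (simp add: in_keys_iff)
    then obtain m where nz: "strand 0 v a m {} \<noteq> 0" by (meson sum.neutral)
    have ka: "keys a \<subseteq> {1..n}"
      using strand_outside_degs[of a 0 v m "{}"] nz keys_degs[OF v(1)] by blast
    have "m \<in> M" using cubical_chainD(1)[OF strand_chain nz] .
    moreover have "a = m + (a - m)"
      using strand_nonzero(2)[OF nz] by (intro poly_mapping_eqI) (simp add: lookup_add lookup_minus deg_def ind_def)
    moreover have "keys (a - m) \<subseteq> {1..n}" using ka by (auto simp: in_keys_iff lookup_minus)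
    ultimately show "a \<in> M" using upward_closedD(2)[OF M] by metis
  qed
  then show "f \<in> mono_ideal n M" unfolding mono_ideal_def mpolys_def using upward_closedD(1)[OF M] by blast
next
  fix f :: "'k mpoly" assume f: "f \<in> mono_ideal n M"
  then have fM: "keys f \<subseteq> M" unfolding mono_ideal_def by simp
  have "\<exists>t. m \<in> M \<longrightarrow> t \<in> M \<and> (\<forall>j. lookup t j = min (lookup m j) K)" for m using trunc by blast
  then obtain T where T: "\<And>m. m \<in> M \<Longrightarrow> T m \<in> M" "\<And>m j. m \<in> M \<Longrightarrow> lookup (T m) j = min (lookup m j) K" by metis
  \<comment> \<open>The term of \<open>f\<close> with exponent \<open>a\<close> is a multiple of the
    basis element at the truncation \<open>T a\<close>, a vertex of the ideal inside the
    box.\<close>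
  define e where "e a m \<tau> = (if m = T a \<and> \<tau> = {} then lookup f a else 0)" for a m and \<tau> :: "nat set"
  have e: "cubical_chain n M (\<lambda>j. min (lookup a j) K) 0 (e a)" if "a \<in> keys f" for a
    unfolding cubical_chain_def e_def using T fM that by auto
  define v where "v = glue 0 (keys f) e"
  have v: "v \<in> free_mod n (card (cubes 0))"
    unfolding v_def by (rule glue_free_mod) (use fM upward_closedD(1)[OF M] in blast)
  have "aug_vec \<bullet> v = f"
  proof (rule poly_mapping_eqI)
    fix a
    have "strand 0 v a m {} = (if a \<in> keys f then e a m {} else 0)" for m
      unfolding v_def by (rule strand_glue[OF finite_keys e])
    then have "lookup (aug_vec \<bullet> v) a = (\<Sum>m\<in>box n (\<lambda>j. min (lookup a j) K). if a \<in> keys f then e a m {} else 0)"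
      unfolding lookup_aug_vec_prod[OF free_modD(1)[OF v]] by simp
    also have "\<dots> = lookup f a"
    proof (cases "a \<in> keys f")
      case True
      then have "T a \<in> box n (\<lambda>j. min (lookup a j) K)"
        unfolding box_def using T(2)[of a] fM upward_closedD(1)[OF M T(1)] by (auto simp del: atLeastAtMost_iff)
      then show ?thesis using True finite_box by (simp add: e_def sum.delta)
    qed (simp add: in_keys_iff)
    finally show "lookup (aug_vec \<bullet> v) a = lookup f a" .
  qed
  then show "f \<in> (\<lambda>v. aug_vec \<bullet> v) ` free_mod n (card (cubes 0))" using v by blast
qed

lemma aug_vec_free_mod: "aug_vec \<in> free_mod n (card (cubes 0))"
proof (rule free_modI)
  fix r assume r: "r < card (cubes 0)"
  obtain m \<tau> where q: "cube 0 r = (m, \<tau>)" by fastforce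
  then have "m \<in> M" using cube_in[OF r] unfolding cubes_def by auto
  then show "aug_vec $ r \<in> mpolys n"
    using r q upward_closedD(1)[OF M] unfolding aug_vec_def vec_of_def mpolys_def by auto
qed (simp add: aug_vec_def vec_of_def)

definition cubical_diff :: "nat \<Rightarrow> 'k::field mpoly mat" where
  "cubical_diff i = (case i of 0 \<Rightarrow> mat 0 (card (cubes 0)) (\<lambda>_. 0) | Suc j \<Rightarrow> dmat var j)"

lemma cubical_diff_Suc [simp]: "cubical_diff (Suc i) = dmat var i"
  unfolding cubical_diff_def by simp

theorem cubical_resolution:
  "free_resolution n (mono_ideal n M :: 'k::field mpoly set) (\<lambda>i. card (cubes i)) aug_vec cubical_diff"
  unfolding free_resolution_def
proof (intro conjI allI impI)
  show "cubical_diff 0 \<in> free_hom n 0 (card (cubes 0))"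
    unfolding cubical_diff_def by (intro free_homI) auto
  show "{v \<in> free_mod n (card (cubes 0)). aug_vec \<bullet> v = (0 :: 'k mpoly)} =
      (\<lambda>w. cubical_diff 1 *\<^sub>v w) ` free_mod n (card (cubes 1))"
    using exact_0 by simp
  fix j :: nat assume "1 \<le> j"
  then obtain i where j: "j = Suc i" by (cases j) auto
  show "{v \<in> free_mod n (card (cubes j)). cubical_diff j *\<^sub>v v = 0\<^sub>v (card (cubes (j - 1)))} =
      (\<lambda>w. cubical_diff (Suc j) *\<^sub>v w :: 'k mpoly vec) ` free_mod n (card (cubes (Suc j)))"
    unfolding j using exact_Suc[of i] by simp
qed (simp_all only: aug_vec_free_mod dmat_free_hom aug_vec_image cubical_diff_Suc)

section \<open>Reduction modulo the variables\<close>

definition facet_mat :: "nat \<Rightarrow> int mat" where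
  "facet_mat i = dmat (\<lambda>_. 0) i"

lemma facet_mat_carrier: "facet_mat i \<in> carrier_mat (card (cubes i)) (card (cubes (Suc i)))"
  unfolding facet_mat_def by (rule dmat_carrier)

lemma facet_mat_mult_carrier: "facet_mat i *\<^sub>v e \<in> carrier_vec (card (cubes i))"
  using facet_mat_carrier[of i] by (intro carrier_vecI) simp

lemma tensor_field_dmat: "tensor_field (dmat var i) = (map_mat of_int (facet_mat i) :: 'k::field mat)"
proof -
  have "lookup (facet_coeff var q' q :: 'k mpoly) 0 = of_int (facet_coeff (\<lambda>_. 0) q' q)" for q' q
  proof -
    have "single j 1 \<noteq> (0 :: nat \<Rightarrow>\<^sub>0 nat)" for j :: nat
      by (metis lookup_single_eq lookup_zero one_neq_zero)
    then have "lookup (var j :: 'k mpoly) 0 = 0" for j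
      unfolding var_def by (simp add: lookup_single when_def)
    then show ?thesis
      unfolding facet_coeff_def lookup_sum of_int_sum
      by (intro sum.cong refl) (auto simp: lookup_isgn_times lookup_minus)
  qed
  then show ?thesis unfolding tensor_field_def facet_mat_def dmat_def by (intro eq_matI) auto
qed

text \<open>Rank-nullity, stated additively to avoid truncated subtraction. The number of cubes and
  the integer matrices are the same for all fields, so the field enters only through the two
  ranks.\<close>

theorem betti_mono_ideal:
  "betti n (mono_ideal n M :: 'k::field mpoly set) (Suc i) + vec_space.rank (card (cubes i)) (map_mat of_int (facet_mat i) :: 'k mat)
     + vec_space.rank (card (cubes (Suc i))) (map_mat of_int (facet_mat (Suc i)) :: 'k mat) = card (cubes (Suc i))"
proof -
  let ?D = "\<lambda>i. map_mat of_int (facet_mat i) :: 'k mat"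
  have c: "?D j \<in> carrier_mat (card (cubes j)) (card (cubes (Suc j)))" for j unfolding facet_mat_def by simp
  have "betti n (mono_ideal n M :: 'k mpoly set) (Suc i) = kernel_dim (?D i) - vec_space.rank (card (cubes (Suc i))) (?D (Suc i))"
  proof -
    have "dim_row (dmat var (Suc i) :: 'k mpoly mat) = card (cubes (Suc i))" by (simp add: dmat_def)
    moreover have "betti n (mono_ideal n M :: 'k mpoly set) (Suc i) = homology_dim (cubical_diff :: nat \<Rightarrow> 'k mpoly mat) (Suc i)"
      by (rule betti_eq_homology_dim[OF cubical_resolution]) simp
    ultimately show ?thesis unfolding homology_dim_def by (simp add: tensor_field_dmat)
  qed
  moreover have "kernel_dim (?D i) + vec_space.rank (card (cubes i)) (?D i) = card (cubes (Suc i))"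
    by (rule kernel_dim_add_rank[OF c])
  moreover have "vec_space.rank (card (cubes (Suc i))) (?D (Suc i)) \<le> kernel_dim (?D i)"
  proof (rule rank_le_kernel_dim[OF c c])
    interpret augmented_resolution n "mono_ideal n M :: 'k mpoly set" "case_nat 1 (\<lambda>i. card (cubes i))"
      "case_nat (mat 1 (card (cubes 0)) (\<lambda>(i,j). aug_vec $ j))
        (\<lambda>j. cubical_diff (Suc j))"
      by (rule augmented_resolution_of_free_resolution[OF cubical_resolution])
    have "(dmat var i :: 'k mpoly mat) * dmat var (Suc i) = 0\<^sub>m (card (cubes i)) (card (cubes (Suc (Suc i))))"
      using comp_zero[of "Suc i"] by simp
    then have "tensor_field ((dmat var i :: 'k mpoly mat) * dmat var (Suc i)) = 0\<^sub>m (card (cubes i)) (card (cubes (Suc (Suc i))))"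
      by (simp add: tensor_field_zero)
    then show "?D i * ?D (Suc i) = 0\<^sub>m (card (cubes i)) (card (cubes (Suc (Suc i))))"
      unfolding tensor_field_mult[OF dmat_carrier dmat_carrier] tensor_field_dmat .
  qed
  ultimately show ?thesis by simp
qed

end

section \<open>Powers of edge ideals\<close>

lemma mpoly_ring_simps:
  "carrier (mpoly_ring n) = mpolys n" "mult (mpoly_ring n) = (*)" "one (mpoly_ring n) = 1"
  "zero (mpoly_ring n) = 0" "add (mpoly_ring n) = (+)"
  unfolding mpoly_ring_def by simp_all

lemma cring_mpoly_ring: "cring (mpoly_ring n :: 'k::field mpoly ring)"
proof (rule cringI)
  show "abelian_group (mpoly_ring n :: 'k mpoly ring)"
  proof (rule abelian_groupI)
    fix x :: "'k mpoly" assume x: "x \<in> carrier (mpoly_ring n)"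
    then have "- x \<in> carrier (mpoly_ring n)" "- x + x = 0" by (auto simp: mpoly_ring_simps)
    then show "\<exists>y\<in>carrier (mpoly_ring n). y \<oplus>\<^bsub>mpoly_ring n\<^esub> x = \<zero>\<^bsub>mpoly_ring n\<^esub>"
      by (intro bexI[of _ "- x"]) (simp_all only: mpoly_ring_simps)
  qed (auto simp: mpoly_ring_simps algebra_simps)
  show "Group.comm_monoid (mpoly_ring n :: 'k mpoly ring)"
    by (rule comm_monoidI) (auto simp: mpoly_ring_simps algebra_simps)
qed (auto simp: mpoly_ring_simps algebra_simps)

lemma mono_ideal_zero [simp]: "0 \<in> mono_ideal n M"
  unfolding mono_ideal_def by simp

lemma mono_ideal_add: "f \<in> mono_ideal n M \<Longrightarrow> g \<in> mono_ideal n M \<Longrightarrow> f + g \<in> mono_ideal n M"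
  using keys_add[of f g] unfolding mono_ideal_def by blast

lemma mono_ideal_mult:
  assumes M: "upward_closed n M" and f: "f \<in> mono_ideal n M" and g: "g \<in> mpolys n"
  shows "g * f \<in> mono_ideal n M"
proof -
  have "keys (g * f) \<subseteq> M"
  proof
    fix k assume "k \<in> keys (g * f)"
    then obtain a b where ab: "a \<in> keys g" "b \<in> keys f" "k = a + b" using keys_mult by blast
    then have "b \<in> M" "keys a \<subseteq> {1..n}" using f g unfolding mono_ideal_def mpolys_def by auto
    then show "k \<in> M" using upward_closedD(2)[OF M, of b a] ab(3) by (simp add: add.commute)
  qed
  then show ?thesis using f g mpolys_mult unfolding mono_ideal_def by blast
qed

lemma ideal_mono_ideal:
  assumes M: "upward_closed n M"
  shows "ideal (mono_ideal n M :: 'k::field mpoly set) (mpoly_ring n)"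
proof -
  interpret R: cring "mpoly_ring n :: 'k mpoly ring" by (rule cring_mpoly_ring)
  have um: "- f \<in> mono_ideal n M" if "f \<in> mono_ideal n M" for f :: "'k mpoly"
    using mono_ideal_mult[OF M that, of "-1"] by (simp add: mpolys_uminus)
  show ?thesis
  proof (rule idealI[OF R.ring_axioms])
    show "subgroup (mono_ideal n M) (add_monoid (mpoly_ring n :: 'k mpoly ring))"
    proof (rule R.add.subgroupI)
      show "mono_ideal n M \<subseteq> carrier (mpoly_ring n :: 'k mpoly ring)"
        unfolding mono_ideal_def mpoly_ring_simps by auto
      show "mono_ideal n M \<noteq> {}" using mono_ideal_zero by blast
    next
      fix f :: "'k mpoly" assume f: "f \<in> mono_ideal n M"
      have "f \<in> mpolys n" using f unfolding mono_ideal_def by simp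
      then have "\<ominus>\<^bsub>mpoly_ring n\<^esub> f = - f"
        by (intro R.minus_equality) (auto simp: mpoly_ring_simps)
      then show "\<ominus>\<^bsub>mpoly_ring n\<^esub> f \<in> mono_ideal n M" using um[OF f] by simp
    next
      fix f g :: "'k mpoly" assume "f \<in> mono_ideal n M" "g \<in> mono_ideal n M"
      then show "f \<oplus>\<^bsub>mpoly_ring n\<^esub> g \<in> mono_ideal n M" by (simp add: mpoly_ring_simps mono_ideal_add)
    qed
  next
    fix f g :: "'k mpoly" assume "f \<in> mono_ideal n M" "g \<in> carrier (mpoly_ring n)"
    then show "g \<otimes>\<^bsub>mpoly_ring n\<^esub> f \<in> mono_ideal n M" "f \<otimes>\<^bsub>mpoly_ring n\<^esub> g \<in> mono_ideal n M"
      using mono_ideal_mult[OF M, of f g] by (simp_all add: mpoly_ring_simps mult.commute)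
  qed
qed

lemma mono_ideal_subset:
  fixes S :: "'k::field mpoly set"
  assumes zero: "0 \<in> S" and add: "\<And>f g. f \<in> S \<Longrightarrow> g \<in> S \<Longrightarrow> f + g \<in> S"
    and mono: "\<And>m c. m \<in> M \<Longrightarrow> single m c \<in> S"
  shows "mono_ideal n M \<subseteq> S"
proof
  fix f :: "'k mpoly" assume f: "f \<in> mono_ideal n M"
  have "(\<Sum>a\<in>A. single a (lookup f a)) \<in> S" if "finite A" "A \<subseteq> M" for A
    using that
  proof (induction A rule: finite_induct)
    case (insert a A)
    then have "single a (lookup f a) + (\<Sum>a\<in>A. single a (lookup f a)) \<in> S" by (intro add mono) auto
    then show ?case using insert.hyps by simp
  qed (simp add: zero)
  from this[of "keys f"] have "(\<Sum>a\<in>keys f. single a (lookup f a)) \<in> S" using f unfolding mono_ideal_def by simp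
  then show "f \<in> S" unfolding sum_single_lookup .
qed

lemma ideal_prod_mono_ideal:
  assumes M: "upward_closed n M" and N: "upward_closed n N"
  shows "ideal_prod (mpoly_ring n) (mono_ideal n M) (mono_ideal n N :: 'k::field mpoly set) =
    mono_ideal n {m + m' | m m'. m \<in> M \<and> m' \<in> N}" (is "?L = mono_ideal n ?MN")
proof
  show "?L \<subseteq> mono_ideal n ?MN"
  proof
    fix f :: "'k mpoly" assume "f \<in> ?L"
    then show "f \<in> mono_ideal n ?MN"
    proof (induction rule: ideal_prod.induct)
      case (prod f g)
      then have fg: "f \<in> mpolys n" "keys f \<subseteq> M" "g \<in> mpolys n" "keys g \<subseteq> N" unfolding mono_ideal_def by auto
      have "keys (f * g) \<subseteq> {a + b | a b. a \<in> keys f \<and> b \<in> keys g}" by (rule keys_mult)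
      also have "\<dots> \<subseteq> ?MN" using fg(2,4) by blast
      finally show ?case using mpolys_mult[OF fg(1,3)] unfolding mono_ideal_def mpoly_ring_simps by simp
    qed (simp add: mpoly_ring_simps mono_ideal_add)
  qed
  show "mono_ideal n ?MN \<subseteq> ?L"
  proof (rule mono_ideal_subset)
    have "0 \<otimes>\<^bsub>mpoly_ring n\<^esub> 0 \<in> ?L" by (rule ideal_prod.prod) simp_all
    then show "0 \<in> ?L" by (simp add: mpoly_ring_simps)
    fix f g assume "f \<in> ?L" "g \<in> ?L"
    then show "f + g \<in> ?L" using ideal_prod.sum[of f "mpoly_ring n" "mono_ideal n M" "mono_ideal n N" g]
      by (simp add: mpoly_ring_simps)
  next
    fix m :: "nat \<Rightarrow>\<^sub>0 nat" and c :: 'k assume "m \<in> ?MN"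
    then obtain a b where ab: "a \<in> M" "b \<in> N" "m = a + b" by blast
    have "single a c \<in> mono_ideal n M" "single b 1 \<in> (mono_ideal n N :: 'k mpoly set)"
      using ab upward_closedD(1)[OF M ab(1)] upward_closedD(1)[OF N ab(2)]
      unfolding mono_ideal_def mpolys_def by auto
    then have "single a c \<otimes>\<^bsub>mpoly_ring n\<^esub> single b 1 \<in> ?L" by (rule ideal_prod.prod)
    then show "single m c \<in> ?L" by (simp add: mpoly_ring_simps mult_single ab(3))
  qed
qed

text \<open>The arbitrary cofactor enters at level 0, which is the whole ring; every level is then
  upward closed without a further multiplication.\<close>

fun power_exps :: "nat \<Rightarrow> nat set set \<Rightarrow> nat \<Rightarrow> (nat \<Rightarrow>\<^sub>0 nat) set" where
  "power_exps n E 0 = {m. keys m \<subseteq> {1..n}}"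
| "power_exps n E (Suc h) = {m + (single i 1 + single j 1) | m i j. m \<in> power_exps n E h \<and> {i, j} \<in> E}"

declare power_exps.simps [simp del]

lemma power_exps_0_iff: "m \<in> power_exps n E 0 \<longleftrightarrow> keys m \<subseteq> {1..n}"
  by (simp add: power_exps.simps)

lemma power_exps_SucI:
  "m \<in> power_exps n E h \<Longrightarrow> {i, j} \<in> E \<Longrightarrow> m + (single i 1 + single j 1) \<in> power_exps n E (Suc h)"
  unfolding power_exps.simps by (rule CollectI, rule exI[of _ m], rule exI[of _ i], rule exI[of _ j]) simp

lemma power_exps_SucE:
  assumes "m \<in> power_exps n E (Suc h)"
  obtains m' i j where "m = m' + (single i 1 + single j 1)" "m' \<in> power_exps n E h" "{i, j} \<in> E"
  using assms unfolding power_exps.simps by blast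

lemma power_exps_1E:
  assumes "m \<in> power_exps n E 1"
  obtains m' i j where "m = m' + (single i 1 + single j 1)" "keys m' \<subseteq> {1..n}" "{i, j} \<in> E"
  using assms unfolding One_nat_def by (elim power_exps_SucE) (simp add: power_exps_0_iff)

lemma simple_graphD:
  assumes "simple_graph n E" "{i, j} \<in> E"
  shows "i \<in> {1..n}" "j \<in> {1..n}" "i \<noteq> j"
proof -
  have "{i, j} \<subseteq> {1..n}" "card {i, j} = 2" using assms unfolding simple_graph_def by blast+
  then show "i \<in> {1..n}" "j \<in> {1..n}" "i \<noteq> j" by auto
qed

lemma keys_add_subset: "keys (a :: nat \<Rightarrow>\<^sub>0 nat) \<subseteq> A \<Longrightarrow> keys b \<subseteq> A \<Longrightarrow> keys (a + b) \<subseteq> A"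
  using keys_add[of a b] by blast

lemma upward_closed_power_exps:
  assumes E: "simple_graph n E"
  shows "upward_closed n (power_exps n E h)"
proof (induction h)
  case 0
  show ?case unfolding upward_closed_def
    by (intro ballI conjI allI impI) (simp_all only: power_exps_0_iff keys_add_subset)
next
  case (Suc h)
  show ?case unfolding upward_closed_def
  proof (intro ballI conjI allI impI)
    fix m assume "m \<in> power_exps n E (Suc h)"
    then obtain m' i j where m: "m = m' + (single i 1 + single j 1)" "m' \<in> power_exps n E h" "{i, j} \<in> E"
      by (rule power_exps_SucE)
    show "keys m \<subseteq> {1..n}" unfolding m(1)
      using upward_closedD(1)[OF Suc m(2)] simple_graphD[OF E m(3)] by (intro keys_add_subset) auto
    fix r :: "nat \<Rightarrow>\<^sub>0 nat" assume "keys r \<subseteq> {1..n}"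
    then have "m' + r \<in> power_exps n E h" using upward_closedD(2)[OF Suc m(2)] by blast
    then have "(m' + r) + (single i 1 + single j 1) \<in> power_exps n E (Suc h)" using m(3) by (rule power_exps_SucI)
    moreover have "(m' + r) + (single i 1 + single j 1) = m + r" unfolding m(1) by (simp only: ac_simps)
    ultimately show "m + r \<in> power_exps n E (Suc h)" by (simp only:)
  qed
qed

lemma power_exps_edge: "{i, j} \<in> E \<Longrightarrow> single i 1 + single j 1 \<in> power_exps n E 1"
  using power_exps_SucI[of 0 n E 0 i j] by (simp add: power_exps_0_iff)

lemma edge_ideal_eq:
  assumes E: "simple_graph n E"
  shows "edge_ideal n E = (mono_ideal n (power_exps n E 1) :: 'k::field mpoly set)"
proof
  let ?G = "{var i * var j | i j. {i, j} \<in> E} :: 'k mpoly set"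
  let ?M = "power_exps n E 1"
  have M: "upward_closed n ?M" by (rule upward_closed_power_exps[OF E])
  have "?G \<subseteq> mono_ideal n ?M"
  proof
    fix f assume "f \<in> ?G"
    then obtain i j where ij: "f = var i * var j" "{i, j} \<in> E" by blast
    have f: "f = single (single i 1 + single j 1) 1" unfolding ij(1) var_def by (simp add: mult_single)
    show "f \<in> mono_ideal n ?M"
      using power_exps_edge[OF ij(2), of n] upward_closedD(1)[OF M power_exps_edge[OF ij(2)]]
      unfolding f mono_ideal_def mpolys_def by simp
  qed
  then show "edge_ideal n E \<subseteq> (mono_ideal n ?M :: 'k mpoly set)"
    unfolding edge_ideal_def genideal_def by (intro Inter_lower CollectI conjI ideal_mono_ideal[OF M])
  have le: "mono_ideal n ?M \<subseteq> J" if J: "ideal J (mpoly_ring n)" and G: "?G \<subseteq> J" for J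
  proof -
    interpret J: ideal J "mpoly_ring n :: 'k mpoly ring" by (rule J)
    show ?thesis
    proof (rule mono_ideal_subset)
      show "0 \<in> J" using additive_subgroup.zero_closed[OF ideal.axioms(1)[OF J]] by (simp add: mpoly_ring_simps)
      show "f + g \<in> J" if "f \<in> J" "g \<in> J" for f g using additive_subgroup.a_closed[OF ideal.axioms(1)[OF J] that] by (simp add: mpoly_ring_simps)
      fix m :: "nat \<Rightarrow>\<^sub>0 nat" and c :: 'k assume "m \<in> ?M"
      then obtain m' i j where m: "m = m' + (single i 1 + single j 1)" "keys m' \<subseteq> {1..n}" "{i, j} \<in> E"
        by (rule power_exps_1E)
      have "single m' c \<in> carrier (mpoly_ring n)" using m(2) by (auto simp: mpoly_ring_simps mpolys_def)
      moreover have "var i * var j \<in> J" using G m(3) by blast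
      ultimately have "single m' c \<otimes>\<^bsub>mpoly_ring n\<^esub> (var i * var j) \<in> J" by (intro J.I_l_closed)
      then show "single m c \<in> J" unfolding m(1) var_def by (simp add: mpoly_ring_simps mult_single)
    qed
  qed
  show "mono_ideal n ?M \<subseteq> (edge_ideal n E :: 'k mpoly set)"
    unfolding edge_ideal_def genideal_def by (intro Inter_greatest) (elim CollectE conjE, rule le)
qed

lemma ideal_power_eq:
  assumes E: "simple_graph n E"
  shows "ideal_power n (edge_ideal n E) h = (mono_ideal n (power_exps n E h) :: 'k::field mpoly set)"
proof (induction h)
  case 0
  have "mono_ideal n (power_exps n E 0) = (mpolys n :: 'k mpoly set)"
    unfolding mono_ideal_def mpolys_def by (auto simp: power_exps_0_iff subset_iff)
  then show ?case unfolding ideal_power_def by (simp add: ideals_set_def nat_pow_def mpoly_ring_simps)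
next
  case (Suc h)
  have sum: "{m + m' | m m'. m \<in> power_exps n E h \<and> m' \<in> power_exps n E 1} = power_exps n E (Suc h)" (is "?L = ?R")
  proof (intro equalityI subsetI)
    fix x assume "x \<in> ?L"
    then obtain m m' where x': "x = m + m'" "m \<in> power_exps n E h" "m' \<in> power_exps n E 1" by blast
    obtain r i j where r: "m' = r + (single i 1 + single j 1)" "keys r \<subseteq> {1..n}" "{i, j} \<in> E"
      using x'(3) by (rule power_exps_1E)
    note x = x'(1)[unfolded r(1)] x'(2) r(2,3)
    have "m + r \<in> power_exps n E h" using upward_closedD(2)[OF upward_closed_power_exps[OF E] x(2,3)] .
    moreover have "x = (m + r) + (single i 1 + single j 1)" unfolding x(1) by (simp add: add.assoc)
    ultimately show "x \<in> ?R" using x(4) power_exps_SucI by metis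
  next
    fix x assume "x \<in> ?R"
    then obtain m i j where x: "x = m + (single i 1 + single j 1)" "m \<in> power_exps n E h" "{i, j} \<in> E"
      by (rule power_exps_SucE)
    show "x \<in> ?L" using x(1,2) power_exps_edge[OF x(3)] by blast
  qed
  have "ideal_power n (edge_ideal n E) (Suc h) =
      ideal_prod (mpoly_ring n) (ideal_power n (edge_ideal n E) h) (edge_ideal n E :: 'k mpoly set)"
    unfolding ideal_power_def by (simp add: ideals_set_def nat_pow_def)
  also have "\<dots> = ideal_prod (mpoly_ring n) (mono_ideal n (power_exps n E h)) (mono_ideal n (power_exps n E 1))"
    unfolding Suc unfolding edge_ideal_eq[OF E] ..
  also have "\<dots> = mono_ideal n (power_exps n E (Suc h))"
    unfolding sum[symmetric]
    by (rule ideal_prod_mono_ideal) (rule upward_closed_power_exps[OF E])+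
  finally show ?case .
qed

text \<open>An edge has two different ends, so each of the \<open>h\<close> factors raises an
  exponent by at most one; no generator has an exponent above \<open>h\<close>.\<close>

lemma monomial_box_power_exps:
  assumes E: "simple_graph n E"
  shows "monomial_box n (power_exps n E h) h"
proof
  show "upward_closed n (power_exps n E h)" by (rule upward_closed_power_exps[OF E])
  show "\<exists>m'\<in>power_exps n E h. \<forall>j. lookup m' j = min (lookup m j) h" if "m \<in> power_exps n E h" for m
    using that
  proof (induction h arbitrary: m)
    case 0
    show ?case by (intro bexI[of _ 0]) (auto simp: power_exps_0_iff)
  next
    case (Suc h)
    obtain m' i j where m: "m = m' + (single i 1 + single j 1)" "m' \<in> power_exps n E h" "{i, j} \<in> E"
      using Suc.prems by (rule power_exps_SucE)
    obtain t where t: "t \<in> power_exps n E h" "\<And>k. lookup t k = min (lookup m' k) h" using Suc.IH[OF m(2)] by blast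
    note ij = simple_graphD[OF E m(3)]
    \<comment> \<open>The cofactor by which the truncated \<open>t\<close> times the new edge must
      be multiplied to reach the truncation of \<open>m\<close>.\<close>
    let ?f = "\<lambda>k. min (lookup m k) (Suc h) - (lookup t k + lookup (single i 1 + single j 1) k)"
    have le: "lookup t k + lookup (single i 1 + single j 1) k \<le> min (lookup m k) (Suc h)" for k
      using ij(3) unfolding m(1) t(2) by (auto simp: lookup_add lookup_single when_def)
    have fin: "finite {k. ?f k \<noteq> 0}"
      by (rule finite_subset[OF _ finite_keys[of m]]) (auto simp: in_keys_iff)
    define r where "r = Abs_poly_mapping ?f"
    have r: "lookup r k = ?f k" for k unfolding r_def using fin by simp
    have km: "keys m \<subseteq> {1..n}" using upward_closedD(1)[OF upward_closed_power_exps[OF E] Suc.prems] .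
    have "keys r \<subseteq> keys m" by (auto simp: in_keys_iff r)
    then have "t + r \<in> power_exps n E h"
      using upward_closedD(2)[OF upward_closed_power_exps[OF E] t(1)] km by blast
    then have "(t + r) + (single i 1 + single j 1) \<in> power_exps n E (Suc h)" using m(3) by (rule power_exps_SucI)
    moreover have "lookup ((t + r) + (single i 1 + single j 1)) k = min (lookup m k) (Suc h)" for k
      using le[of k] r[of k] by (simp only: lookup_add)
    ultimately show ?case by blast
  qed
qed

section \<open>A mod-p Moore space\<close>

definition eps :: "nat \<Rightarrow> nat \<Rightarrow> int" where
  "eps a b = sgn (int b - int a)"

lemma eps_less [simp]: "a < b \<Longrightarrow> eps a b = 1" and eps_greater [simp]: "b < a \<Longrightarrow> eps a b = -1"
  unfolding eps_def by simp_all

lemma eps_swap: "eps b a = - eps a b"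
  unfolding eps_def by (simp add: sgn_if)

lemma eps_cases: "a \<noteq> b \<Longrightarrow> eps a b = 1 \<or> eps a b = -1"
  by (cases a b rule: linorder_cases) auto

text \<open>This is -1 to the number of vertices of \<sigma> before \<open>j\<close>, the sign of
  the simplicial coboundary for the natural order of the vertices.\<close>

definition esgn :: "nat \<Rightarrow> nat set \<Rightarrow> int" where
  "esgn j \<sigma> = (\<Prod>k\<in>\<sigma> - {j}. eps j k)"

definition cobd :: "(nat set \<Rightarrow> int) \<Rightarrow> nat set \<Rightarrow> int" where
  "cobd x \<sigma> = (\<Sum>j\<in>\<sigma>. esgn j \<sigma> * x (\<sigma> - {j}))"

lemma esgn_remove:
  assumes "finite \<sigma>" "k \<in> \<sigma>" "k \<noteq> j"
  shows "esgn j \<sigma> = eps j k * esgn j (\<sigma> - {k})"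
proof -
  have "esgn j \<sigma> = eps j k * (\<Prod>l\<in>\<sigma> - {j} - {k}. eps j l)"
    unfolding esgn_def using assms by (intro prod.remove) auto
  moreover have "\<sigma> - {j} - {k} = \<sigma> - {k} - {j}" by auto
  ultimately show ?thesis unfolding esgn_def by simp
qed

lemma cobd_cobd:
  assumes fin: "finite \<sigma>"
  shows "cobd (cobd x) \<sigma> = 0"
proof -
  let ?g = "\<lambda>j k. esgn j \<sigma> * (esgn k (\<sigma> - {j}) * x (\<sigma> - {j} - {k}))"
  have "cobd (cobd x) \<sigma> = (\<Sum>j\<in>\<sigma>. \<Sum>k\<in>\<sigma> - {j}. ?g j k)"
    unfolding cobd_def sum_distrib_left ..
  also have "\<dots> = 0"
  proof (rule sum_antisym_pairs[OF fin])
    fix j k assume jk: "j \<in> \<sigma>" "k \<in> \<sigma>" "j \<noteq> k"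
    have 1: "esgn j \<sigma> = eps j k * esgn j (\<sigma> - {k})" using fin jk by (intro esgn_remove) auto
    have "esgn k \<sigma> = eps k j * esgn k (\<sigma> - {j})" using fin jk by (intro esgn_remove) auto
    then have 2: "esgn k \<sigma> = - eps j k * esgn k (\<sigma> - {j})" unfolding eps_swap[of k j] .
    have 3: "\<sigma> - {j} - {k} = \<sigma> - {k} - {j}" by auto
    show "?g j k = - ?g k j" unfolding 1 2 3 by (simp only: mult_minus_left mult_minus_right minus_minus mult_ac)
  qed
  finally show ?thesis .
qed

text \<open>The alternating extension of a cochain to ordered tuples; it allows sums over cyclically
  numbered vertices without cases on their order.\<close>

definition alt3 :: "(nat set \<Rightarrow> int) \<Rightarrow> nat \<Rightarrow> nat \<Rightarrow> nat \<Rightarrow> int" where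
  "alt3 x a b c = eps a b * eps a c * eps b c * x {a, b, c}"

definition alt4 :: "(nat set \<Rightarrow> int) \<Rightarrow> nat \<Rightarrow> nat \<Rightarrow> nat \<Rightarrow> nat \<Rightarrow> int" where
  "alt4 x a b c d = eps a b * eps a c * eps a d * eps b c * eps b d * eps c d * x {a, b, c, d}"

lemma alt4_cobd:
  assumes d: "a \<noteq> b" "a \<noteq> c" "a \<noteq> d" "b \<noteq> c" "b \<noteq> d" "c \<noteq> d"
  shows "alt4 (cobd x) a b c d = alt3 x b c d - alt3 x a c d + alt3 x a b d - alt3 x a b c"
proof -
  have s: "{a, b, c, d} - {a} = {b, c, d}" "{a, b, c, d} - {b} = {a, c, d}"
    "{a, b, c, d} - {c} = {a, b, d}" "{a, b, c, d} - {d} = {a, b, c}" using d by auto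
  have "cobd x {a, b, c, d} = eps a b * eps a c * eps a d * x {b, c, d} +
      eps b a * eps b c * eps b d * x {a, c, d} + eps c a * eps c b * eps c d * x {a, b, d} +
      eps d a * eps d b * eps d c * x {a, b, c}"
    unfolding cobd_def esgn_def using d by (simp add: s)
  then show ?thesis
    unfolding alt4_def alt3_def eps_swap[of b a] eps_swap[of c a] eps_swap[of d a] eps_swap[of c b] eps_swap[of d b] eps_swap[of d c]
    using eps_cases[OF d(1)] eps_cases[OF d(2)] eps_cases[OF d(3)] eps_cases[OF d(4)] eps_cases[OF d(5)] eps_cases[OF d(6)]
    by (elim disjE) simp_all
qed

text \<open>The mod-\<open>p\<close> Moore space as a flag complex: a disc with centre \<open>5\<close>, whose rim
  \<open>6, \<dots>, 4p + 5\<close> is attached by a strip of triangles to the 4-cycle \<open>1, 2, 3, 4\<close>, around which it runs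
  \<open>p\<close> times.\<close>

definition moore_edge :: "nat \<Rightarrow> nat \<Rightarrow> nat \<Rightarrow> bool" where
  "moore_edge p a b \<longleftrightarrow> (a, b) \<in> {(1, 2), (2, 3), (3, 4), (1, 4)} \<or> a = 5 \<and> 6 \<le> b \<or>
     6 \<le> a \<and> b = a + 1 \<or> a = 6 \<and> b = 4 * p + 5 \<or>
     1 \<le> a \<and> a \<le> 4 \<and> 6 \<le> b \<and> ((b - 6) mod 4 = a - 1 \<or> (b - 3) mod 4 = a - 1)"

definition moore_adj :: "nat \<Rightarrow> nat \<Rightarrow> nat \<Rightarrow> bool" where
  "moore_adj p a b \<longleftrightarrow> moore_edge p a b \<or> moore_edge p b a"

definition moore_face :: "nat \<Rightarrow> nat set \<Rightarrow> bool" where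
  "moore_face p \<sigma> \<longleftrightarrow> (\<forall>a\<in>\<sigma>. \<forall>b\<in>\<sigma>. a \<noteq> b \<longrightarrow> moore_adj p a b)"

lemma moore_face_subset: "moore_face p \<sigma> \<Longrightarrow> \<tau> \<subseteq> \<sigma> \<Longrightarrow> moore_face p \<tau>"
  unfolding moore_face_def by blast

text \<open>A cochain that modulo \<open>p\<close> is a cocycle, with value 1 on the 4-cycle: the winding number of
  the rim around the 4-cycle, read off along the strip.\<close>

definition winding :: "nat \<Rightarrow> nat \<Rightarrow> nat \<Rightarrow> int" where
  "winding p a b = (if a = 1 \<and> b = 4 then 1
     else if 1 \<le> a \<and> a \<le> 4 \<and> 6 \<le> b then
       (if (b - 6) mod 4 = a - 1 then int ((b - 6) div 4)
        else if b = 6 then int p - 1 else int ((b - 7) div 4))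
     else 0)"

lemma moore_edge_less: "moore_edge p a b \<Longrightarrow> p \<ge> 2 \<Longrightarrow> a < b"
  unfolding moore_edge_def by (elim disjE conjE) auto

lemma moore_adj_less: "moore_adj p a b \<Longrightarrow> a < b \<Longrightarrow> p \<ge> 2 \<Longrightarrow> moore_edge p a b"
  using moore_edge_less[of p b a] unfolding moore_adj_def by (meson less_asym)

text \<open>In the last case \<open>k\<close> is the position on the rim. The residue of
  \<open>k + 3\<close> stands for that of \<open>k\<close> - 1 and avoids truncation at
  \<open>k\<close> = 0.\<close>

lemma moore_edge_cases:
  assumes "moore_edge p a b"
  obtains "1 \<le> a" "b \<le> 4" "b = a + 1 \<or> a = 1 \<and> b = 4" | "a = 5" "6 \<le> b" | "6 \<le> a" "b = a + 1 \<or> a = 6 \<and> b = 4 * p + 5"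
  | k where "1 \<le> a" "a \<le> 4" "b = k + 6" "k mod 4 = a - 1 \<or> (k + 3) mod 4 = a - 1"
proof -
  consider "(a, b) \<in> {(1, 2), (2, 3), (3, 4), (1, 4)}" | "a = 5 \<and> 6 \<le> b" | "6 \<le> a \<and> b = a + 1" | "a = 6 \<and> b = 4 * p + 5"
    | "1 \<le> a \<and> a \<le> 4 \<and> 6 \<le> b \<and> ((b - 6) mod 4 = a - 1 \<or> (b - 3) mod 4 = a - 1)"
    using assms unfolding moore_edge_def by blast
  then show ?thesis
  proof cases
    case 5
    have "b = (b - 6) + 6" "(b - 6) + 3 = b - 3" using 5 by simp_all
    then show ?thesis using 5 that(4)[of "b - 6"] by simp
  qed (use that in auto)
qed

lemma div4_pred:
  fixes k :: nat
  assumes "k mod 4 \<noteq> 0"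
  shows "(k - 1) div 4 = k div 4"
proof (rule div_nat_eqI)
  have k: "k = 4 * (k div 4) + k mod 4" by simp
  have r: "k mod 4 < 4" by simp
  show "4 * (k div 4) \<le> k - 1" using k assms by linarith
  have "k - 1 < 4 + 4 * (k div 4)" using k r by linarith
  then show "k - 1 < 4 * Suc (k div 4)" by simp
qed

lemma div4_pred':
  fixes k :: nat
  assumes "k mod 4 = 0" "k \<noteq> 0"
  shows "k div 4 = Suc ((k - 1) div 4)"
proof -
  obtain q where k: "k = 4 * q" using assms(1) by (metis dvdE mod_0_imp_dvd)
  then obtain q' where q: "q = Suc q'" using assms(2) by (cases q) auto
  have "(k - 1) div 4 = q'" unfolding k q by (rule div_nat_eqI) auto
  then show ?thesis unfolding k q by simp
qed

lemma mod4_add3: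
  fixes k :: nat
  shows "k mod 4 = 0 \<Longrightarrow> (k + 3) mod 4 = 3" "k mod 4 \<noteq> 0 \<Longrightarrow> (k + 3) mod 4 = k mod 4 - 1"
proof -
  have m: "(k + 3) mod 4 = (k mod 4 + 3) mod 4" by (rule mod_add_left_eq[symmetric])
  have "k mod 4 < 4" by simp
  then consider "k mod 4 = 0" | "k mod 4 = 1" | "k mod 4 = 2" | "k mod 4 = 3" by linarith
  then show "k mod 4 = 0 \<Longrightarrow> (k + 3) mod 4 = 3" "k mod 4 \<noteq> 0 \<Longrightarrow> (k + 3) mod 4 = k mod 4 - 1"
    unfolding m by (cases; simp)+
qed

text \<open>An edge from the 4-cycle to the rim carries the lap number, from 0 to \<open>p\<close> -
  1, at which the strip passes its end on the 4-cycle. Within a triangle on a rim edge the lap is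
  constant; along the 4-cycle it increases only from vertex 4 to vertex 1, where the value 1 on {1,
  4} compensates. The one defect is at {1, 4, 6}, where the lap falls from \<open>p\<close> - 1 back
  to 0.\<close>

lemma cobd_winding:
  assumes p: "p \<ge> 2" and ord: "x < y" "y < z" and face: "moore_face p {x, y, z}"
  shows "winding p y z - winding p x z + winding p x y = (if x = 1 \<and> y = 4 \<and> z = 6 then int p else 0)"
proof -
  have "moore_adj p x y" "moore_adj p x z" "moore_adj p y z"
    using face ord unfolding moore_face_def by simp_all
  then have e: "moore_edge p x y" "moore_edge p x z" "moore_edge p y z"
    using moore_adj_less p ord less_trans[OF ord] by blast+
  from e(1) show ?thesis
  proof (cases rule: moore_edge_cases)
    case 1
    have "z \<noteq> x + 1" "z > 2" using ord 1 by linarith+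
    with e(2) obtain k where k: "z = k + 6" "k mod 4 = x - 1 \<or> (k + 3) mod 4 = x - 1"
    proof (cases rule: moore_edge_cases)
      case a: 1
      then have "z = 4" "x = 1" using \<open>z \<noteq> x + 1\<close> by auto
      then show ?thesis using 1(3) ord e(3) unfolding moore_edge_def by auto
    qed (use 1 ord in auto)
    from e(3) have k': "k mod 4 = y - 1 \<or> (k + 3) mod 4 = y - 1"
      by (cases rule: moore_edge_cases) (use k(1) 1(2) in auto)
    \<comment> \<open>The rim vertex \<open>z\<close> has just two neighbours on the 4-cycle, given
      by \<open>r\<close> and its cyclic predecessor \<open>R\<close>; so \<open>x\<close> and
      \<open>y\<close> are these two in some order.\<close>
    define r R where "r = k mod 4" and "R = (k + 3) mod 4"
    have R: "r = 0 \<Longrightarrow> R = 3" and R': "r \<noteq> 0 \<Longrightarrow> R = r - 1" unfolding r_def R_def by (rule mod4_add3; assumption)+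
    have x1: "1 \<le> x" "x \<le> 4" "1 \<le> y" "y \<le> 4" using 1 ord by linarith+
    have ne: "x - 1 \<noteq> y - 1" using x1(1) ord(1) by linarith
    have dx: "r = x - 1 \<or> R = x - 1" and dy: "r = y - 1 \<or> R = y - 1" using k(2) k' unfolding r_def R_def .
    have "r = y - 1 \<and> R = x - 1 \<or> r = x - 1 \<and> R = y - 1"
      using dx dy ne by metis
    then consider "r = y - 1" "R = x - 1" | "r = x - 1" "R = y - 1" by blast
    then show ?thesis
    proof cases
      case a: 1
      have r0: "r \<noteq> 0" using a(1) x1(1) ord(1) by linarith
      have x: "x = r" using a(2) R'[OF r0] r0 x1(1) by linarith
      have y: "y = x + 1" using a(1) x x1(3) by linarith
      have k0: "k mod 4 \<noteq> 0" using r0 unfolding r_def .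
      have d: "(k - 1) div 4 = k div 4" "k \<noteq> 0" using div4_pred[OF k0] k0 by auto
      have ky: "k mod 4 = y - 1" using a(1) unfolding r_def .
      have kx: "k mod 4 \<noteq> x - 1" unfolding ky using ne by (rule not_sym)
      have "winding p y z = int (k div 4)" "winding p x y = 0"
        using x1 ky y unfolding winding_def k(1) by simp_all
      moreover have "winding p x z = int ((k - 1) div 4)"
        using x1 d(2) kx unfolding winding_def k(1) by simp
      ultimately show ?thesis using d(1) y by simp
    next
      case a: 2
      have r0: "r = 0"
      proof (rule ccontr)
        assume r0: "r \<noteq> 0"
        show False using a R'[OF r0] ord(1) x1 by linarith
      qed
      have "3 = y - 1" using a(2) R[OF r0] by simp
      then have xy: "x = 1" "y = 4" using a(1) r0 x1 by linarith+
      have k0: "k mod 4 = 0" using r0 unfolding r_def .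
      have w: "winding p x y = 1" "winding p x z = int (k div 4)"
        unfolding winding_def xy k(1) by (simp_all add: k0)
      show ?thesis
      proof (cases "k = 0")
        case True
        have "winding p y z = int p - 1" unfolding winding_def xy k(1) True by simp
        then show ?thesis using w xy k(1) True by simp
      next
        case False
        then have "k div 4 = Suc ((k - 1) div 4)" using div4_pred'[OF k0] by blast
        moreover have "winding p y z = int ((k - 1) div 4)" using False unfolding winding_def xy k(1) by (simp add: k0)
        ultimately show ?thesis using w k(1) False by simp
      qed
    qed
  next
    case 2
    then show ?thesis using ord by (simp add: winding_def)
  next
    case 3
    from e(3) have "z = y + 1 \<or> y = 6 \<and> z = 4 * p + 5"
      by (cases rule: moore_edge_cases) (use 3 ord in auto)
    moreover from e(2) have "z = x + 1 \<or> x = 6 \<and> z = 4 * p + 5"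
      by (cases rule: moore_edge_cases) (use 3 ord in auto)
    ultimately show ?thesis using 3 ord p by auto
  next
    case (4 k)
    from e(2) have xz: "(z - 6) mod 4 = x - 1 \<or> (z - 3) mod 4 = x - 1"
      by (cases rule: moore_edge_cases) (use 4(1-3) ord in \<open>auto simp: add.commute\<close>)
    have w: "winding p y z = 0" using 4 by (simp add: winding_def)
    from e(3) have "z = y + 1 \<or> y = 6 \<and> z = 4 * p + 5"
      by (cases rule: moore_edge_cases) (use 4(3) in auto)
    then consider "z = y + 1" | "y = 6" "z = 4 * p + 5" by blast
    then show ?thesis
    proof cases
      case a: 1
      then have "(k + 1) mod 4 = x - 1 \<or> (k + 4) mod 4 = x - 1" using xz 4(3) by simp
      moreover have "(k + 4) mod 4 = k mod 4" "(k + 1) mod 4 \<noteq> k mod 4" "(k + 1) mod 4 \<noteq> (k + 3) mod 4" by presburger+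
      ultimately have c: "k mod 4 = x - 1" "(k + 1) mod 4 \<noteq> x - 1" using 4(4) by metis+
      show ?thesis using c 4(1-3) w a by (simp add: winding_def)
    next
      case a: 2
      \<comment> \<open>The edge that closes the rim: the only common neighbour is 4, and both of
        its edges carry \<open>p\<close> - 1, because at the rim vertex 6 the vertex 4 is counted in
        the last lap.\<close>
      have "k = 0" using 4(3) a by simp
      then have "x = 1 \<or> x = 4" using 4(1,2,4) by auto
      moreover have "4 * p - 1 = 3 + 4 * (p - 1)" using p by linarith
      then have "(4 * p - 1) mod 4 = 3" "(4 * p - 1) div 4 = p - 1" by simp_all
      moreover have "(4 * p + 2) mod 4 = 2" unfolding add.commute[of "4 * p"] mod_mult_self2 by simp
      ultimately have x: "x = 4" using xz a by auto
      have e: "z - 6 = 4 * p - 1" using a by simp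
      have "winding p x z = int p - 1" using \<open>(4 * p - 1) mod 4 = 3\<close> \<open>(4 * p - 1) div 4 = p - 1\<close> p a
        unfolding winding_def x e by simp
      moreover have "winding p x y = int p - 1" unfolding winding_def x a(1) by simp
      ultimately show ?thesis using w x by simp
    qed
  qed
qed

definition winding_cochain :: "nat \<Rightarrow> nat set \<Rightarrow> int" where
  "winding_cochain p \<sigma> = winding p (Min \<sigma>) (Max \<sigma>)"

definition facet0 :: "nat set \<Rightarrow> int" where
  "facet0 \<sigma> = (if \<sigma> = {1, 4, 6} then 1 else 0)"

text \<open>Subtracting the coboundary of the winding number makes \<open>p\<close> times
  \<open>facet0\<close> vanish on the triangles of X. Its coboundary thus exhibits the relative
  class of \<open>cobd facet0\<close> as p-torsion.\<close>

definition torsion_chain :: "nat \<Rightarrow> nat set \<Rightarrow> int" where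
  "torsion_chain p \<sigma> = int p * facet0 \<sigma> - cobd (winding_cochain p) \<sigma>"

lemma cobd_triple:
  assumes "x < y" "y < z"
  shows "cobd f {x, y, z} = f {y, z} - f {x, z} + f {x, y}"
proof -
  have s: "{x, y, z} - {x} = {y, z}" "{x, y, z} - {y} = {x, z}" "{x, y, z} - {z} = {x, y}" using assms by auto
  then show ?thesis using assms unfolding cobd_def esgn_def by (simp add: s)
qed

lemma card_3_ordered:
  fixes \<sigma> :: "nat set"
  assumes "card \<sigma> = 3"
  obtains x y z where "\<sigma> = {x, y, z}" "x < y" "y < z"
proof -
  obtain a b c where abc: "\<sigma> = {a, b, c}" "a \<noteq> b" "a \<noteq> c" "b \<noteq> c"
    using assms by (metis card_3_iff)
  consider "a < b" "b < c" | "a < c" "c < b" | "b < a" "a < c" | "b < c" "c < a" | "c < a" "a < b" | "c < b" "b < a"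
    using abc(2-4) by linarith
  then show ?thesis
    by cases (use that abc(1) in \<open>(metis insert_commute)+\<close>)
qed

lemma torsion_chain_face:
  assumes p: "p \<ge> 2" and \<sigma>: "card \<sigma> = 3" "\<sigma> \<subseteq> {1..4 * p + 5}" "moore_face p \<sigma>"
  shows "torsion_chain p \<sigma> = 0"
proof -
  obtain x y z where xyz: "\<sigma> = {x, y, z}" "x < y" "y < z" by (rule card_3_ordered[OF \<sigma>(1)])
  have "cobd (winding_cochain p) \<sigma> = winding p y z - winding p x z + winding p x y"
    unfolding xyz(1) cobd_triple[OF xyz(2,3)] winding_cochain_def using xyz by simp
  also have "\<dots> = (if x = 1 \<and> y = 4 \<and> z = 6 then int p else 0)"
    using p \<sigma> xyz by (intro cobd_winding) simp_all
  also have "(x = 1 \<and> y = 4 \<and> z = 6) \<longleftrightarrow> \<sigma> = {1, 4, 6}"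
  proof
    assume "\<sigma> = {1, 4, 6}"
    then have eq: "{x, y, z} = {1, 4, 6}" using xyz(1) by simp
    then have "x \<in> {1, 4, 6}" "y \<in> {1, 4, 6}" "z \<in> {1, 4, 6}" by blast+
    then show "x = 1 \<and> y = 4 \<and> z = 6" using xyz(2,3) by auto
  qed (use xyz in simp)
  finally show ?thesis unfolding torsion_chain_def facet0_def by simp
qed

lemma cobd_torsion_chain:
  assumes "finite \<sigma>"
  shows "cobd (torsion_chain p) \<sigma> = int p * cobd facet0 \<sigma>"
proof -
  have "cobd (torsion_chain p) \<sigma> = int p * cobd facet0 \<sigma> - cobd (cobd (winding_cochain p)) \<sigma>"
    unfolding torsion_chain_def cobd_def[of "\<lambda>\<sigma>. int p * facet0 \<sigma> - cobd (winding_cochain p) \<sigma>"]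
      cobd_def[of facet0] cobd_def[of "cobd (winding_cochain p)"]
    by (simp add: sum_distrib_left sum_subtractf algebra_simps)
  then show ?thesis unfolding cobd_cobd[OF assms] by simp
qed

text \<open>Multiplied by \<open>p\<close>, the value is the coboundary of a cochain that vanishes
  on all triangles of X, and the integers have no torsion. The cliques with four vertices are never
  enumerated.\<close>

lemma cobd_facet0_face:
  assumes p: "p \<ge> 2" and \<sigma>: "card \<sigma> = 4" "\<sigma> \<subseteq> {1..4 * p + 5}" "moore_face p \<sigma>"
  shows "cobd facet0 \<sigma> = 0"
proof -
  have fin: "finite \<sigma>" using \<sigma>(2) finite_subset by blast
  have "torsion_chain p (\<sigma> - {j}) = 0" if "j \<in> \<sigma>" for j
  proof (rule torsion_chain_face[OF p])
    show "card (\<sigma> - {j}) = 3" using \<sigma>(1) that fin by simp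
    show "\<sigma> - {j} \<subseteq> {1..4 * p + 5}" "moore_face p (\<sigma> - {j})" using \<sigma>(2,3) moore_face_subset by blast+
  qed
  then have "cobd (torsion_chain p) \<sigma> = 0" unfolding cobd_def by simp
  then show ?thesis using cobd_torsion_chain[OF fin, of p] p by simp
qed

section \<open>Pairing with the cone over the strip\<close>

text \<open>Cyclic numbering along the strip: \<open>rim p i\<close> is joined to
  \<open>cyc i\<close> and to its predecessor, written \<open>cyc (i + 3)\<close>.\<close>

definition rim :: "nat \<Rightarrow> nat \<Rightarrow> nat" where "rim p i = 6 + i mod (4 * p)"

definition cyc :: "nat \<Rightarrow> nat" where "cyc i = 1 + i mod 4"

text \<open>Evaluation on the cone from \<open>5\<close> over the strip. Its two kinds of triangles
  get opposite signs so that the edges inside the strip cancel in the boundary.\<close>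

definition strip_functional :: "nat \<Rightarrow> (nat set \<Rightarrow> int) \<Rightarrow> int" where
  "strip_functional p y = (\<Sum>i<4 * p. alt4 y 5 (cyc (i + 3)) (cyc i) (rim p i) - alt4 y 5 (cyc i) (rim p i) (rim p (i + 1)))"

lemma rim_neq: "p \<ge> 2 \<Longrightarrow> rim p i \<noteq> rim p (i + 1)"
proof
  assume p: "p \<ge> 2" and "rim p i = rim p (i + 1)"
  then have "(i + 1) mod (4 * p) = i mod (4 * p)" unfolding rim_def by simp
  moreover have "(i + 1) mod (4 * p) = (if i mod (4 * p) + 1 = 4 * p then 0 else i mod (4 * p) + 1)"
    using p by (simp add: mod_Suc)
  ultimately show False using p by (auto split: if_splits)
qed


lemma cyc_range: "cyc i \<in> {1, 2, 3, 4}"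
proof -
  have "i mod 4 < 4" by simp
  then show ?thesis unfolding cyc_def by auto
qed

lemma cyc_add_3: "(cyc i, cyc (i + 3)) \<in> {(1, 4), (2, 1), (3, 2), (4, 3)}"
proof -
  have m: "(i + 3) mod 4 = (i mod 4 + 3) mod 4" by (rule mod_add_left_eq[symmetric])
  have "i mod 4 < 4" by simp
  then consider "i mod 4 = 0" | "i mod 4 = 1" | "i mod 4 = 2" | "i mod 4 = 3" by linarith
  then show ?thesis unfolding cyc_def m by cases simp_all
qed

lemma cyc_bounds: "1 \<le> cyc i" "cyc i \<le> 4" "cyc (i + 3) \<noteq> cyc i"
  using cyc_range[of i] cyc_add_3[of i] by auto

lemma rim_bounds:
  assumes p: "p \<ge> 2"
  shows "6 \<le> rim p i" "rim p i \<le> 4 * p + 5"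
proof -
  have "i mod (4 * p) < 4 * p" by (rule mod_less_divisor) (use p in simp)
  then show "6 \<le> rim p i" "rim p i \<le> 4 * p + 5" unfolding rim_def by linarith+
qed

lemma moore_adj_rim: "p \<ge> 2 \<Longrightarrow> moore_adj p (rim p i) (rim p (i + 1))"
proof -
  assume p: "p \<ge> 2"
  have "(i + 1) mod (4 * p) = (if i mod (4 * p) + 1 = 4 * p then 0 else i mod (4 * p) + 1)"
    using p by (simp add: mod_Suc)
  then show ?thesis using p unfolding moore_adj_def moore_edge_def rim_def by (auto split: if_splits)
qed

lemma rim_mod_4: "(rim p i - 6) mod 4 = i mod 4" "(rim p i - 3) mod 4 = (i + 3) mod 4"
proof -
  have m: "i mod (4 * p) mod 4 = i mod 4" by (simp add: mod_mod_cancel)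
  then show "(rim p i - 6) mod 4 = i mod 4" unfolding rim_def by simp
  have "rim p i - 3 = i mod (4 * p) + 3" unfolding rim_def by simp
  then show "(rim p i - 3) mod 4 = (i + 3) mod 4" using m by (metis mod_add_left_eq)
qed

lemma moore_adj_spokes:
  assumes p: "p \<ge> 2"
  shows "moore_adj p (cyc i) (rim p i)" "moore_adj p (cyc (i + 3)) (rim p i)"
    "moore_adj p 5 (rim p i)" "moore_adj p (cyc (i + 3)) (cyc i)"
proof -
  have e: "(rim p i - 6) mod 4 = cyc i - 1" "(rim p i - 3) mod 4 = cyc (i + 3) - 1"
    using rim_mod_4[of p i] unfolding cyc_def by simp_all
  show "moore_adj p (cyc i) (rim p i)"
    unfolding moore_adj_def moore_edge_def using e(1) cyc_bounds(1,2)[of i] rim_bounds(1)[OF p, of i] by blast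
  show "moore_adj p (cyc (i + 3)) (rim p i)"
    unfolding moore_adj_def moore_edge_def using e(2) cyc_bounds(1,2)[of "i + 3"] rim_bounds(1)[OF p, of i] by blast
  show "moore_adj p 5 (rim p i)" using rim_bounds[OF p, of i] unfolding moore_adj_def moore_edge_def by simp
  show "moore_adj p (cyc (i + 3)) (cyc i)" using cyc_add_3[of i] unfolding moore_adj_def moore_edge_def by auto
qed

lemma moore_adj_sym: "moore_adj p a b \<longleftrightarrow> moore_adj p b a"
  unfolding moore_adj_def by blast

lemma moore_faces:
  assumes p: "p \<ge> 2"
  shows "moore_face p {cyc (i + 3), cyc i, rim p i}" "moore_face p {cyc i, rim p i, rim p (i + 1)}"
    "moore_face p {5, rim p i, rim p (i + 1)}"
proof -
  have "cyc (i + 1 + 3) = cyc i" unfolding cyc_def by simp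
  then have "moore_adj p (cyc i) (rim p (i + 1))" using moore_adj_spokes(2)[OF p, of "i + 1"] by simp
  note a = this moore_adj_spokes[OF p, of i] moore_adj_spokes(3)[OF p, of "i + 1"] moore_adj_rim[OF p, of i]
  show "moore_face p {cyc (i + 3), cyc i, rim p i}" "moore_face p {cyc i, rim p i, rim p (i + 1)}"
    "moore_face p {5, rim p i, rim p (i + 1)}"
    unfolding moore_face_def using a moore_adj_sym by blast+
qed

lemma strip_functional_expand:
  assumes p: "p \<ge> 2"
  shows "strip_functional p (cobd x) = (\<Sum>i<4 * p.
    (alt3 x (cyc (i + 3)) (cyc i) (rim p i) - alt3 x 5 (cyc i) (rim p i) + alt3 x 5 (cyc (i + 3)) (rim p i) - alt3 x 5 (cyc (i + 3)) (cyc i)) -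
    (alt3 x (cyc i) (rim p i) (rim p (i + 1)) - alt3 x 5 (rim p i) (rim p (i + 1)) + alt3 x 5 (cyc i) (rim p (i + 1)) - alt3 x 5 (cyc i) (rim p i)))"
proof -
  note b = cyc_bounds(1,2) rim_bounds[OF p] cyc_bounds(3) rim_neq[OF p]
  have "cyc i < 5" "cyc i < rim p j" "5 < rim p j" for i j using b(2)[of i] b(3)[of j] by linarith+
  then have ne: "5 \<noteq> cyc i" "cyc i \<noteq> rim p j" "5 \<noteq> rim p j" for i j by (metis less_irrefl)+
  have "alt4 (cobd x) 5 (cyc (i + 3)) (cyc i) (rim p i) = alt3 x (cyc (i + 3)) (cyc i) (rim p i) - alt3 x 5 (cyc i) (rim p i) +
      alt3 x 5 (cyc (i + 3)) (rim p i) - alt3 x 5 (cyc (i + 3)) (cyc i)" for i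
    by (intro alt4_cobd ne b(5))
  moreover have "alt4 (cobd x) 5 (cyc i) (rim p i) (rim p (i + 1)) = alt3 x (cyc i) (rim p i) (rim p (i + 1)) -
      alt3 x 5 (rim p i) (rim p (i + 1)) + alt3 x 5 (cyc i) (rim p (i + 1)) - alt3 x 5 (cyc i) (rim p i)" for i
    by (intro alt4_cobd ne b(6))
  ultimately show ?thesis unfolding strip_functional_def by (simp only:)
qed

text \<open>The boundary of the cone consists of the strip and the cone over the boundary of the
  strip. The strip lies in X, as does the cone over the rim, which is the disc; \<open>x\<close>
  vanishes on both. The cone over the inner boundary runs \<open>p\<close> times around the 4-cycle.
  The interior edges disappear by cancellation and by telescoping around the closed rim.\<close>

lemma p_dvd_strip_functional:
  assumes p: "p \<ge> 2" and x: "\<And>\<sigma>. moore_face p \<sigma> \<Longrightarrow> x \<sigma> = 0"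
  shows "int p dvd strip_functional p (cobd x)"
proof -
  let ?F = "\<lambda>a b. alt3 x 5 a b"
  let ?a = "\<lambda>i. ?F (cyc (i + 3)) (rim p i)" and ?c = "\<lambda>i. ?F (cyc (i + 3)) (cyc i)"
  have z: "alt3 x (cyc (i + 3)) (cyc i) (rim p i) = 0" "alt3 x (cyc i) (rim p i) (rim p (i + 1)) = 0"
    "?F (rim p i) (rim p (i + 1)) = 0" for i
    unfolding alt3_def using x moore_faces[OF p, of i] by simp_all
  have a: "?F (cyc i) (rim p (i + 1)) = ?a (Suc i)" for i
  proof -
    have "cyc (Suc i + 3) = cyc i" unfolding cyc_def by simp
    then show ?thesis by (simp only: Suc_eq_plus1)
  qed
  have "strip_functional p (cobd x) = (\<Sum>i<4 * p. (?a i - ?a (Suc i)) - ?c i)"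
    unfolding strip_functional_expand[OF p] z a by (intro sum.cong refl) linarith
  also have "\<dots> = (\<Sum>i<4 * p. ?a i - ?a (Suc i)) - (\<Sum>i<4 * p. ?c i)" by (rule sum_subtractf)
  also have "(\<Sum>i<4 * p. ?a i - ?a (Suc i)) = ?a 0 - ?a (4 * p)" by (rule sum_lessThan_telescope')
  also have "?a (4 * p) = ?a 0"
  proof -
    have "cyc (4 * p + 3) = cyc (0 + 3)" "rim p (4 * p) = rim p 0" unfolding cyc_def rim_def by simp_all
    then show ?thesis by simp
  qed
  also have "(\<Sum>i<4 * p. ?c i) = (\<Sum>m<p. \<Sum>i\<in>{m * 4..<m * 4 + 4}. ?c i)"
    using sum.nat_group[of ?c 4 p] by (simp add: mult.commute)
  also have "\<dots> = (\<Sum>m<p. \<Sum>i<4. ?c i)"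
  proof (rule sum.cong[OF refl])
    fix m
    have "(\<Sum>i\<in>{m * 4..<m * 4 + 4}. ?c i) = (\<Sum>i\<in>{0..<4}. ?c (i + m * 4))"
      using sum.shift_bounds_nat_ivl[of ?c 0 "m * 4" 4] by (simp add: add.commute)
    moreover have "?c (i + m * 4) = ?c i" for i
    proof -
      have "i + m * 4 + 3 = i + 3 + m * 4" by simp
      then show ?thesis unfolding cyc_def by (simp only: mod_mult_self1)
    qed
    ultimately show "(\<Sum>i\<in>{m * 4..<m * 4 + 4}. ?c i) = (\<Sum>i<4. ?c i)" by (simp add: lessThan_atLeast0)
  qed
  also have "\<dots> = int p * (\<Sum>i<4. ?c i)" by simp
  finally show ?thesis by simp
qed

text \<open>Only the tetrahedron at i = 0 has {1, 4, 6} opposite to \<open>5\<close>; the sign comes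
  from the order 4, 1, 6 along the strip.\<close>

lemma strip_functional_facet0:
  assumes p: "p \<ge> 2"
  shows "strip_functional p (cobd facet0) = -1"
proof -
  have z5: "alt3 facet0 5 a b = 0" for a b
  proof -
    have "5 \<in> {5, a, b}" "5 \<notin> {1, 4, 6 :: nat}" by simp_all
    then have "{5, a, b} \<noteq> {1, 4, 6}" by metis
    then show ?thesis unfolding alt3_def facet0_def by simp
  qed
  have z2: "alt3 facet0 (cyc i) (rim p i) (rim p (i + 1)) = 0" for i
  proof -
    have "{cyc i, rim p i, rim p (i + 1)} \<noteq> {1, 4, 6}"
    proof
      assume eq: "{cyc i, rim p i, rim p (i + 1)} = {1, 4, 6}"
      then have "rim p i \<in> {1, 4, 6}" "rim p (i + 1) \<in> {1, 4, 6}" by blast+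
      then have "rim p i = 6" "rim p (i + 1) = 6"
        using rim_bounds(1)[OF p, of i] rim_bounds(1)[OF p, of "i + 1"] by auto
      then show False using rim_neq[OF p, of i] by simp
    qed
    then show ?thesis unfolding alt3_def facet0_def by simp
  qed
  have "strip_functional p (cobd facet0) = (\<Sum>i<4 * p. alt3 facet0 (cyc (i + 3)) (cyc i) (rim p i))"
    unfolding strip_functional_expand[OF p] z5 z2 by (simp only: diff_0_right add_0_right)
  also have "\<dots> = (\<Sum>i\<in>{0}. alt3 facet0 (cyc (i + 3)) (cyc i) (rim p i))"
  proof (rule sum.mono_neutral_right)
    show "\<forall>i\<in>{..<4 * p} - {0}. alt3 facet0 (cyc (i + 3)) (cyc i) (rim p i) = 0"
    proof
      fix i assume i: "i \<in> {..<4 * p} - {0}"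
      then have "rim p i > 6" unfolding rim_def by simp
      then have "rim p i \<notin> {1, 4, 6}" by auto
      then have "{cyc (i + 3), cyc i, rim p i} \<noteq> {1, 4, 6}" by blast
      then show "alt3 facet0 (cyc (i + 3)) (cyc i) (rim p i) = 0" unfolding alt3_def facet0_def by simp
    qed
  qed (use p in auto)
  also have "\<dots> = alt3 facet0 4 1 6" unfolding cyc_def rim_def by simp
  also have "\<dots> = -1"
  proof -
    have "{4, 1, 6 :: nat} = {1, 4, 6}" by blast
    then show ?thesis unfolding alt3_def facet0_def by simp
  qed
  finally show ?thesis .
qed

section \<open>The complement of the Moore space with an isolated edge\<close>

definition moore_graph :: "nat \<Rightarrow> nat set set" where
  "moore_graph p = insert {4 * p + 6, 4 * p + 7}
     {{a, b} | a b. a \<in> {1..4 * p + 5} \<and> b \<in> {1..4 * p + 5} \<and> a \<noteq> b \<and> \<not> moore_adj p a b}"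

lemma moore_graph_iff:
  "{i, j} \<in> moore_graph p \<longleftrightarrow> {i, j} = {4 * p + 6, 4 * p + 7} \<or>
     i \<in> {1..4 * p + 5} \<and> j \<in> {1..4 * p + 5} \<and> i \<noteq> j \<and> \<not> moore_adj p i j"
  unfolding moore_graph_def by (auto simp: doubleton_eq_iff moore_adj_sym)

lemma simple_graph_moore_graph: "simple_graph (4 * p + 7) (moore_graph p)"
  unfolding simple_graph_def moore_graph_def by (auto simp: card_insert_if)

text \<open>The isolated edge \<open>{4p + 6, 4p + 7}\<close> must account for all factors of a monomial in the \<open>h\<close>-th
  power that do not involve the exceptional vertices \<open>B\<close>.\<close>

lemma power_exps_moore_graph_bound:
  assumes B: "finite B" and y: "y \<in> {4 * p + 6, 4 * p + 7}"
    and m: "m \<in> power_exps (4 * p + 7) (moore_graph p) h"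
    and face: "moore_face p (keys m \<inter> {1..4 * p + 5} - B)"
  shows "h \<le> (\<Sum>b\<in>insert y B. lookup m b)"
  using m face
proof (induction h arbitrary: m)
  case (Suc h)
  obtain m' i j where m: "m = m' + (single i 1 + single j 1)" "m' \<in> power_exps (4 * p + 7) (moore_graph p) h"
    "{i, j} \<in> moore_graph p" by (rule power_exps_SucE[OF Suc.prems(1)])
  have sub: "keys m' \<subseteq> keys m" unfolding m(1) by (auto simp: in_keys_iff lookup_add)
  have "moore_face p (keys m' \<inter> {1..4 * p + 5} - B)"
    by (rule moore_face_subset[OF Suc.prems(2)]) (use sub in blast)
  then have IH: "h \<le> (\<Sum>b\<in>insert y B. lookup m' b)" by (rule Suc.IH[OF m(2)])
  have ij: "i \<in> keys m" "j \<in> keys m" unfolding m(1) by (simp_all add: in_keys_iff lookup_add lookup_single)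
  \<comment> \<open>A factor is either the isolated edge, which contains \<open>y\<close>, or a
    non-edge of X, which cannot lie in the face that remains off \<open>B\<close>.\<close>
  have "i \<in> insert y B \<or> j \<in> insert y B"
  proof (rule ccontr)
    assume n: "\<not> ?thesis"
    show False
    proof (cases "{i, j} = {4 * p + 6, 4 * p + 7}")
      case True
      then show False using y n by (auto simp: doubleton_eq_iff)
    next
      case False
      then have e: "i \<in> {1..4 * p + 5}" "j \<in> {1..4 * p + 5}" "i \<noteq> j" "\<not> moore_adj p i j"
        using m(3) unfolding moore_graph_iff by simp_all
      have "i \<in> keys m \<inter> {1..4 * p + 5} - B" "j \<in> keys m \<inter> {1..4 * p + 5} - B" using e ij n by simp_all
      then show False using Suc.prems(2) e(3,4) unfolding moore_face_def by simp
    qed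
  qed
  then have "1 \<le> (\<Sum>b\<in>insert y B. lookup (single i 1 :: nat \<Rightarrow>\<^sub>0 nat) b) + (\<Sum>b\<in>insert y B. lookup (single j 1 :: nat \<Rightarrow>\<^sub>0 nat) b)"
    using B by (auto simp: lookup_single when_def sum.delta')
  moreover have "(\<Sum>b\<in>insert y B. lookup m b) = (\<Sum>b\<in>insert y B. lookup m' b) +
     ((\<Sum>b\<in>insert y B. lookup (single i 1) b) + (\<Sum>b\<in>insert y B. lookup (single j 1) b))"
    unfolding m(1) by (simp only: lookup_add sum.distrib)
  ultimately show ?case using IH by linarith
qed simp

locale moore_power =
  fixes p h :: nat
  assumes p: "p \<ge> 2" and h: "h \<ge> 1"
begin

abbreviation "n \<equiv> 4 * p + 7"
abbreviation "V \<equiv> {1..4 * p + 5}"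
abbreviation "M \<equiv> power_exps n (moore_graph p) h"

sublocale B: monomial_box n M h
  by (rule monomial_box_power_exps[OF simple_graph_moore_graph])

text \<open>The cubes with top vertex \<open>\<Sum>\<^bsub>v \<in> V\<^esub> e\<^sub>v + (h - 1)(e\<^bsub>4p+6\<^esub> + e\<^bsub>4p+7\<^esub>)\<close> are indexed by the complements \<open>\<sigma>\<close>
  in \<open>V\<close> of their directions.\<close>

definition vtx :: "nat set \<Rightarrow> nat \<Rightarrow>\<^sub>0 nat" where
  "vtx \<sigma> = ind \<sigma> + (single (4 * p + 6) (h - 1) + single (4 * p + 7) (h - 1))"

lemma lookup_vtx:
  assumes "\<sigma> \<subseteq> V"
  shows "lookup (vtx \<sigma>) j = (if j \<in> \<sigma> then 1 else if j = 4 * p + 6 \<or> j = 4 * p + 7 then h - 1 else 0)"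
proof -
  have "finite \<sigma>" using assms finite_subset by blast
  moreover have "4 * p + 6 \<notin> \<sigma>" "4 * p + 7 \<notin> \<sigma>" using assms by auto
  ultimately show ?thesis by (auto simp: vtx_def lookup_add lookup_ind lookup_single when_def)
qed

lemma keys_vtx: "\<sigma> \<subseteq> V \<Longrightarrow> keys (vtx \<sigma>) \<inter> V = \<sigma>"
  by (auto simp: in_keys_iff lookup_vtx split: if_splits)

text \<open>The exponent \<open>h\<close> - 1 of the first end of the isolated edge accounts for at
  most \<open>h\<close> - 1 of the factors, so one factor must be a non-edge inside \<sigma>.
  Conversely, such a factor completes the \<open>h\<close> - 1 copies of the isolated edge.\<close>

lemma vtx_mem_iff:
  assumes \<sigma>: "\<sigma> \<subseteq> V"
  shows "vtx \<sigma> \<in> M \<longleftrightarrow> \<not> moore_face p \<sigma>"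
proof
  assume m: "vtx \<sigma> \<in> M"
  show "\<not> moore_face p \<sigma>"
  proof
    assume "moore_face p \<sigma>"
    then have "h \<le> lookup (vtx \<sigma>) (4 * p + 6)"
      using power_exps_moore_graph_bound[of "{}" "4 * p + 6" p "vtx \<sigma>" h] m keys_vtx[OF \<sigma>] by simp
    moreover have "lookup (vtx \<sigma>) (4 * p + 6) = h - 1" using \<sigma> by (auto simp: lookup_vtx[OF \<sigma>])
    ultimately show False using h by simp
  qed
next
  assume "\<not> moore_face p \<sigma>"
  then obtain a b where ab: "a \<in> \<sigma>" "b \<in> \<sigma>" "a \<noteq> b" "\<not> moore_adj p a b" unfolding moore_face_def by blast
  let ?y = "4 * p + 6" and ?z = "4 * p + 7"
  have fin: "finite \<sigma>" using \<sigma> finite_subset by blast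
  have yz: "{?y, ?z} \<in> moore_graph p" unfolding moore_graph_iff by simp
  have pw: "r + (single ?y k + single ?z k) \<in> power_exps n (moore_graph p) (l + k)"
    if "r \<in> power_exps n (moore_graph p) l" for r l k
  proof (induction k)
    case (Suc k)
    have "r + (single ?y k + single ?z k) + (single ?y 1 + single ?z 1) \<in> power_exps n (moore_graph p) (Suc (l + k))"
      by (rule power_exps_SucI[OF Suc yz])
    moreover have "r + (single ?y k + single ?z k) + (single ?y 1 + single ?z 1) = r + (single ?y (Suc k) + single ?z (Suc k))"
      by (intro poly_mapping_eqI) (auto simp: lookup_add lookup_single when_def)
    ultimately show ?case by simp
  qed (use that in simp)
  have "{a, b} \<in> moore_graph p" using ab \<sigma> unfolding moore_graph_iff by blast
  then have "ind (\<sigma> - {a, b}) + (single a 1 + single b 1) \<in> power_exps n (moore_graph p) (Suc 0)"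
    by (intro power_exps_SucI) (use \<sigma> fin in \<open>auto simp: power_exps_0_iff keys_ind\<close>)
  moreover have "ind (\<sigma> - {a, b}) + (single a 1 + single b 1) = ind \<sigma>"
    using fin ab by (intro poly_mapping_eqI) (auto simp: lookup_add lookup_ind lookup_single when_def)
  ultimately have "ind \<sigma> \<in> power_exps n (moore_graph p) (Suc 0)" by (simp only:)
  then show "vtx \<sigma> \<in> M" using pw[of "ind \<sigma>" "Suc 0" "h - 1"] h unfolding vtx_def by simp
qed

lemma vtx_update:
  assumes "\<sigma> \<subseteq> V" "j \<in> \<sigma>"
  shows "update j (lookup (vtx \<sigma>) j - 1) (vtx \<sigma>) = vtx (\<sigma> - {j})"
proof (rule poly_mapping_eqI)
  fix k
  have "\<sigma> - {j} \<subseteq> V" using assms by blast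
  then show "lookup (update j (lookup (vtx \<sigma>) j - 1) (vtx \<sigma>)) k = lookup (vtx (\<sigma> - {j})) k"
    using assms by (auto simp: lookup_update lookup_vtx)
qed

lemma vtx_cube_iff:
  assumes \<sigma>: "\<sigma> \<subseteq> V" and i: "card \<sigma> + i = 4 * p + 5"
  shows "(vtx \<sigma>, V - \<sigma>) \<in> B.cubes i \<longleftrightarrow> \<not> moore_face p \<sigma>"
proof -
  have "finite \<sigma>" using \<sigma> finite_subset by blast
  then have "card (V - \<sigma>) = i" using card_Diff_subset[of \<sigma> V] \<sigma> i by simp
  moreover have "V - \<sigma> \<subseteq> {1..n}" by auto
  moreover have "lookup (vtx \<sigma>) j \<le> h" for j using h by (auto simp: lookup_vtx[OF \<sigma>])
  moreover have "Suc (lookup (vtx \<sigma>) j) \<le> h" if "j \<le> 4 * p + 5" "j \<notin> \<sigma>" for j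
    using that h by (auto simp: lookup_vtx[OF \<sigma>])
  ultimately show ?thesis unfolding B.cubes_def using vtx_mem_iff[OF \<sigma>] by simp
qed

text \<open>The isolated edge carries the two largest labels, so its ends contribute no
  sign.\<close>

lemma isgn_eq_esgn:
  assumes \<sigma>: "\<sigma> \<subseteq> V" and j: "j \<in> \<sigma>"
  shows "isgn n j (V - \<sigma>) = esgn j \<sigma>"
proof -
  have "{1..n} - (V - \<sigma>) - {j} = (\<sigma> - {j}) \<union> {4 * p + 6, 4 * p + 7}" using \<sigma> j by auto
  then have "isgn n j (V - \<sigma>) = (\<Prod>k\<in>(\<sigma> - {j}) \<union> {4 * p + 6, 4 * p + 7}. if k < j then -1 else 1)"
    unfolding isgn_def by simp
  also have "\<dots> = (\<Prod>k\<in>\<sigma> - {j}. if k < j then -1 else 1)"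
    by (rule prod.mono_neutral_right) (use \<sigma> j in \<open>auto intro: finite_subset\<close>)
  also have "\<dots> = esgn j \<sigma>"
    unfolding esgn_def by (intro prod.cong refl) (auto simp: eps_def sgn_if)
  finally show ?thesis .
qed

definition on_vtx :: "(nat set \<Rightarrow> int) \<Rightarrow> int chain" where
  "on_vtx x m \<tau> = (if \<tau> \<subseteq> V \<and> m = vtx (V - \<tau>) then x (V - \<tau>) else 0)"

text \<open>With weight 0 only upper facets count. A coface in a direction of \<sigma> removes a
  vertex from \<sigma>, which gives the coboundary; cofaces in the two directions of the isolated
  edge leave the subcomplex and are excluded by \<open>yz\<close>. For \<open>h\<close> = 1 there
  are none of these.\<close>

lemma wbd_vtx:
  fixes e :: "int chain"
  assumes \<sigma>: "\<sigma> \<subseteq> V"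
    and yz: "\<And>j m. j \<in> {4 * p + 6, 4 * p + 7} \<Longrightarrow> 2 \<le> h \<Longrightarrow> m = update j (h - 2) (vtx \<sigma>) \<Longrightarrow> e m (insert j (V - \<sigma>)) = 0"
  shows "B.wbd (\<lambda>_. 0) e (vtx \<sigma>) (V - \<sigma>) = cobd (\<lambda>\<sigma>. e (vtx \<sigma>) (V - \<sigma>)) \<sigma>"
proof -
  let ?t = "\<lambda>j. of_int (isgn n j (V - \<sigma>)) * ((if 0 < lookup (vtx \<sigma>) j
    then e (update j (lookup (vtx \<sigma>) j - 1) (vtx \<sigma>)) (insert j (V - \<sigma>)) else 0) - 0 * e (vtx \<sigma>) (insert j (V - \<sigma>)))"
  have set: "{1..n} - (V - \<sigma>) = \<sigma> \<union> {4 * p + 6, 4 * p + 7}" using \<sigma> by auto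
  have "?t j = 0" if j: "j \<in> {4 * p + 6, 4 * p + 7}" for j
  proof -
    have l: "lookup (vtx \<sigma>) j = h - 1" using j \<sigma> by (auto simp: lookup_vtx[OF \<sigma>])
    have "e (update j (lookup (vtx \<sigma>) j - 1) (vtx \<sigma>)) (insert j (V - \<sigma>)) = 0" if "0 < lookup (vtx \<sigma>) j"
      by (rule yz[OF j]) (use that l in \<open>auto simp: numeral_2_eq_2\<close>)
    then show ?thesis by simp
  qed
  then have "B.wbd (\<lambda>_. 0) e (vtx \<sigma>) (V - \<sigma>) = (\<Sum>j\<in>\<sigma>. ?t j)"
    unfolding B.wbd_def set
  proof (intro sum.mono_neutral_right ballI)
    fix j assume "j \<in> \<sigma> \<union> {4 * p + 6, 4 * p + 7} - \<sigma>"
    then show "?t j = 0" using \<open>\<And>j. j \<in> {4 * p + 6, 4 * p + 7} \<Longrightarrow> ?t j = 0\<close> by blast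
  qed (use \<sigma> in \<open>auto intro: finite_subset\<close>)
  also have "\<dots> = cobd (\<lambda>\<sigma>. e (vtx \<sigma>) (V - \<sigma>)) \<sigma>"
    unfolding cobd_def
  proof (intro sum.cong refl)
    fix j assume j: "j \<in> \<sigma>"
    have "insert j (V - \<sigma>) = V - (\<sigma> - {j})" using j \<sigma> by auto
    moreover have "0 < lookup (vtx \<sigma>) j" using j by (simp add: lookup_vtx[OF \<sigma>])
    ultimately show "?t j = esgn j \<sigma> * e (vtx (\<sigma> - {j})) (V - (\<sigma> - {j}))"
      using vtx_update[OF \<sigma> j] isgn_eq_esgn[OF \<sigma> j] by simp
  qed
  finally show ?thesis .
qed

text \<open>Upper facets keep the top vertex, so these chains form a subcomplex, with the simplicial
  coboundary as boundary map.\<close>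

lemma wbd_on_vtx: "B.wbd (\<lambda>_. 0) (on_vtx x) m \<tau> = on_vtx (cobd x) m \<tau>"
proof (cases "\<tau> \<subseteq> V \<and> m = vtx (V - \<tau>)")
  case True
  define \<sigma> where "\<sigma> = V - \<tau>"
  have \<sigma>: "\<sigma> \<subseteq> V" "V - \<sigma> = \<tau>" "m = vtx \<sigma>" using True unfolding \<sigma>_def by auto
  have "B.wbd (\<lambda>_. 0) (on_vtx x) (vtx \<sigma>) (V - \<sigma>) = cobd (\<lambda>\<sigma>. on_vtx x (vtx \<sigma>) (V - \<sigma>)) \<sigma>"
    by (rule wbd_vtx[OF \<sigma>(1)]) (auto simp: on_vtx_def)
  also have "\<dots> = cobd x \<sigma>"
    unfolding cobd_def
  proof (intro sum.cong refl arg_cong2[where f = times])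
    fix j
    have "V - (V - (\<sigma> - {j})) = \<sigma> - {j}" using \<sigma>(1) by auto
    then show "on_vtx x (vtx (\<sigma> - {j})) (V - (\<sigma> - {j})) = x (\<sigma> - {j})" unfolding on_vtx_def by auto
  qed
  finally show ?thesis unfolding \<sigma>(2,3) using \<sigma> \<sigma>_def True by (simp add: on_vtx_def)
next
  case False
  have "(if 0 < lookup m j then on_vtx x (update j (lookup m j - 1) m) (insert j \<tau>) else 0) = 0"
    if j: "j \<in> {1..n} - \<tau>" for j
  proof (rule ccontr)
    assume "\<not> ?thesis"
    then have a: "0 < lookup m j" "insert j \<tau> \<subseteq> V" "update j (lookup m j - 1) m = vtx (V - insert j \<tau>)"
      unfolding on_vtx_def by (auto split: if_splits)
    have "m = update j (lookup m j - 1) m + single j 1" by (rule single_update_lookup[OF a(1)])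
    also have "\<dots> = vtx (V - \<tau>)" unfolding a(3)
    proof (rule poly_mapping_eqI)
      fix k
      have "V - insert j \<tau> \<subseteq> V" "V - \<tau> \<subseteq> V" by auto
      note l = lookup_vtx[OF this(1)] lookup_vtx[OF this(2)]
      show "lookup (vtx (V - insert j \<tau>) + single j 1) k = lookup (vtx (V - \<tau>)) k"
        using a(2) j unfolding lookup_add l by (auto simp: lookup_single when_def)
    qed
    finally show False using False a(2) by blast
  qed
  then have "B.wbd (\<lambda>_. 0) (on_vtx x) m \<tau> = 0" unfolding B.wbd_def by (intro sum.neutral) auto
  then show ?thesis using False by (auto simp: on_vtx_def)
qed

end

lemma strip_functional_sum:
  assumes "finite R"
  shows "strip_functional p (\<lambda>\<sigma>. \<Sum>r\<in>R. f r \<sigma> * u r) = (\<Sum>r\<in>R. strip_functional p (f r) * u r)"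
  using assms
proof induction
  case empty
  show ?case by (simp add: strip_functional_def alt4_def)
next
  case (insert r R)
  have "strip_functional p (\<lambda>\<sigma>. f r \<sigma> * u r + g \<sigma>) = strip_functional p (f r) * u r + strip_functional p g" for g
    unfolding strip_functional_def alt4_def sum_distrib_right sum.distrib[symmetric]
    by (rule sum.cong[OF refl]) (simp add: algebra_simps)
  then show ?case using insert by simp
qed

text \<open>Every set evaluated consists of \<open>5\<close> and a triangle of the strip, which is a
  face of X. This is the only fact about the support that the argument below uses.\<close>

lemma strip_functional_cong:
  assumes p: "p \<ge> 2"
    and e: "\<And>\<sigma>. \<sigma> \<subseteq> {1..4 * p + 5} \<Longrightarrow> card \<sigma> = 4 \<Longrightarrow> moore_face p (\<sigma> - {5}) \<Longrightarrow> y \<sigma> = y' \<sigma>"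
  shows "strip_functional p y = strip_functional p y'"
proof -
  have "alt4 y 5 (cyc (i + 3)) (cyc i) (rim p i) = alt4 y' 5 (cyc (i + 3)) (cyc i) (rim p i)"
    "alt4 y 5 (cyc i) (rim p i) (rim p (i + 1)) = alt4 y' 5 (cyc i) (rim p i) (rim p (i + 1))" for i
  proof -
    note b = cyc_bounds[of i] cyc_bounds(1,2)[of "i + 3"] rim_bounds[OF p, of i] rim_bounds[OF p, of "i + 1"] rim_neq[OF p, of i]
    have c: "card {5, cyc (i + 3), cyc i, rim p i} = 4" "card {5, cyc i, rim p i, rim p (i + 1)} = 4"
      using b by (auto simp: card_insert_if)
    have "{5, cyc (i + 3), cyc i, rim p i} - {5} = {cyc (i + 3), cyc i, rim p i}"
      "{5, cyc i, rim p i, rim p (i + 1)} - {5} = {cyc i, rim p i, rim p (i + 1)}" using b by auto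
    then have "y {5, cyc (i + 3), cyc i, rim p i} = y' {5, cyc (i + 3), cyc i, rim p i}"
      "y {5, cyc i, rim p i, rim p (i + 1)} = y' {5, cyc i, rim p i, rim p (i + 1)}"
      by (rule_tac [!] e) (use b c moore_faces[OF p, of i] in \<open>simp_all\<close>)
    then show "alt4 y 5 (cyc (i + 3)) (cyc i) (rim p i) = alt4 y' 5 (cyc (i + 3)) (cyc i) (rim p i)"
      "alt4 y 5 (cyc i) (rim p i) (rim p (i + 1)) = alt4 y' 5 (cyc i) (rim p i) (rim p (i + 1))"
      by (simp_all add: alt4_def)
  qed
  then show ?thesis unfolding strip_functional_def by simp
qed

section \<open>The torsion class in the cubical complex of a power\<close>

context moore_power begin

text \<open>The torsion of the second cohomology of X appears in degree 3 relative to the simplex,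
  on sets \<sigma> with four elements; their cubes have 4p + 5 - 4 directions.\<close>

abbreviation "d \<equiv> Suc (4 * p)"

definition torsion_vec :: "int vec" where
  "torsion_vec = B.vec_of (Suc d) (on_vtx (\<lambda>\<sigma>. if card \<sigma> = 3 then torsion_chain p \<sigma> else 0))"

definition facet0_vec :: "int vec" where
  "facet0_vec = B.vec_of d (on_vtx (\<lambda>\<sigma>. if card \<sigma> = 4 then cobd facet0 \<sigma> else 0))"

text \<open>Passing to vectors forgets the values at cubes that do not start in the ideal; a cochain
  that vanishes on the faces of X has no such values.\<close>

lemma chain_of_vec_of_on_vtx:
  assumes "\<And>\<sigma>. \<sigma> \<subseteq> V \<Longrightarrow> x \<sigma> \<noteq> 0 \<Longrightarrow> card \<sigma> + i = 4 * p + 5 \<and> \<not> moore_face p \<sigma>"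
  shows "B.chain_of i (B.vec_of i (on_vtx x)) = on_vtx x"
proof (intro ext)
  fix m \<tau>
  show "B.chain_of i (B.vec_of i (on_vtx x)) m \<tau> = on_vtx x m \<tau>"
  proof (cases "(m, \<tau>) \<in> B.cubes i")
    case False
    have "on_vtx x m \<tau> = 0"
    proof (rule ccontr)
      assume "on_vtx x m \<tau> \<noteq> 0"
      then have a: "\<tau> \<subseteq> V" "m = vtx (V - \<tau>)" "x (V - \<tau>) \<noteq> 0" unfolding on_vtx_def by (auto split: if_splits)
      have s: "V - \<tau> \<subseteq> V" "V - (V - \<tau>) = \<tau>" using a(1) by auto
      show False using vtx_cube_iff[OF s(1), of i] assms[OF s(1) a(3)] False unfolding s(2) a(2) by blast
    qed
    then show ?thesis using False unfolding B.chain_of_def by simp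
  qed (rule B.chain_of_vec_of)
qed

lemma facet_mat_torsion_vec: "B.facet_mat d *\<^sub>v torsion_vec = int p \<cdot>\<^sub>v facet0_vec"
proof (rule B.vec_eq_chain_of[where i = d])
  show "B.facet_mat d *\<^sub>v torsion_vec \<in> carrier_vec (card (B.cubes d))"
    by (rule B.facet_mat_mult_carrier)
  show "int p \<cdot>\<^sub>v facet0_vec \<in> carrier_vec (card (B.cubes d))"
    unfolding facet0_vec_def B.vec_of_def by simp
  fix m \<tau> assume q: "(m, \<tau>) \<in> B.cubes d"
  let ?x = "\<lambda>\<sigma>. if card \<sigma> = 3 then torsion_chain p \<sigma> else 0" and ?y = "\<lambda>\<sigma>. if card \<sigma> = 4 then cobd facet0 \<sigma> else 0"
  have "B.chain_of (Suc d) torsion_vec = on_vtx ?x"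
    unfolding torsion_vec_def
    by (rule chain_of_vec_of_on_vtx) (use torsion_chain_face[OF p] in \<open>auto split: if_splits\<close>)
  then have "B.chain_of d (B.facet_mat d *\<^sub>v torsion_vec) m \<tau> = B.wbd (\<lambda>_. 0) (on_vtx ?x) m \<tau>"
    unfolding B.facet_mat_def using B.chain_of_dmat_mult[OF _ q, of torsion_vec "\<lambda>_. 0"]
    by (simp add: torsion_vec_def B.vec_of_def)
  also have "\<dots> = on_vtx (cobd ?x) m \<tau>" by (rule wbd_on_vtx)
  also have "\<dots> = int p * on_vtx ?y m \<tau>"
  proof (cases "\<tau> \<subseteq> V \<and> m = vtx (V - \<tau>)")
    case True
    have "card \<tau> = d" using q unfolding B.cubes_def by simp
    then have c: "card (V - \<tau>) = 4" using True card_Diff_subset[of \<tau> V] finite_subset[of \<tau> V] by simp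
    have "cobd ?x (V - \<tau>) = cobd (torsion_chain p) (V - \<tau>)"
      unfolding cobd_def by (rule sum.cong[OF refl]) (use c in simp)
    then show ?thesis using True c cobd_torsion_chain[of "V - \<tau>" p] by (simp add: on_vtx_def)
  qed (auto simp: on_vtx_def)
  also have "\<dots> = B.chain_of d (int p \<cdot>\<^sub>v facet0_vec) m \<tau>"
  proof -
    have "on_vtx ?y m \<tau> = B.chain_of d facet0_vec m \<tau>"
      unfolding facet0_vec_def by (rule B.chain_of_vec_of[OF q, symmetric])
    moreover have "facet0_vec \<in> carrier_vec (card (B.cubes d))" unfolding facet0_vec_def B.vec_of_def by simp
    ultimately show ?thesis using q B.cube_index_less[OF q] unfolding B.chain_of_def by simp
  qed
  finally show "B.chain_of d (B.facet_mat d *\<^sub>v torsion_vec) m \<tau> = B.chain_of d (int p \<cdot>\<^sub>v facet0_vec) m \<tau>" .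
qed

text \<open>The functional in coordinates: the entry at a cube is the functional of its indicator,
  so cubes outside the subcomplex get 0.\<close>

definition strip_vec :: "int vec" where
  "strip_vec = vec (card (B.cubes d)) (\<lambda>r. strip_functional p (\<lambda>\<sigma>. if B.cube d r = (vtx \<sigma>, V - \<sigma>) then 1 else 0))"

lemma strip_vec_scalar_prod:
  assumes u: "u \<in> carrier_vec (card (B.cubes d))"
  shows "strip_vec \<bullet> u = strip_functional p (\<lambda>\<sigma>. B.chain_of d u (vtx \<sigma>) (V - \<sigma>))"
proof -
  have c: "B.chain_of d u m \<tau> = (\<Sum>r<card (B.cubes d). (if B.cube d r = (m, \<tau>) then 1 else 0) * u $ r)" for m \<tau>
  proof (cases "(m, \<tau>) \<in> B.cubes d")
    case True
    have "(\<Sum>r<card (B.cubes d). (if B.cube d r = (m, \<tau>) then 1 else 0) * u $ r) =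
      (\<Sum>r<card (B.cubes d). if r = B.cube_index d (m, \<tau>) then u $ r else 0)"
    proof (rule sum.cong[OF refl])
      fix r assume "r \<in> {..<card (B.cubes d)}"
      then have "B.cube d r = (m, \<tau>) \<longleftrightarrow> r = B.cube_index d (m, \<tau>)"
        using B.cube_index_cube[of r d] B.cube_cube_index[OF True] by auto
      then show "(if B.cube d r = (m, \<tau>) then 1 else 0) * u $ r = (if r = B.cube_index d (m, \<tau>) then u $ r else 0)" by simp
    qed
    then show ?thesis using B.cube_index_less[OF True] True by (simp add: B.chain_of_def)
  next
    case False
    then have "B.cube d r \<noteq> (m, \<tau>)" if "r < card (B.cubes d)" for r using B.cube_in[OF that] by auto
    then show ?thesis using False by (simp add: B.chain_of_def)
  qed
  have "strip_vec \<bullet> u = (\<Sum>r<card (B.cubes d). strip_functional p (\<lambda>\<sigma>. if B.cube d r = (vtx \<sigma>, V - \<sigma>) then 1 else 0) * u $ r)"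
    using u unfolding scalar_prod_def strip_vec_def by (auto simp: lessThan_atLeast0 intro!: sum.cong)
  then show ?thesis unfolding c by (simp add: strip_functional_sum)
qed

text \<open>Here \<open>e\<close> ranges over the whole complex. On the sets seen by the functional,
  only the part \<open>x\<close> of \<open>e\<close> in the subcomplex contributes to the boundary,
  and \<open>x\<close> vanishes on faces of X, so that \<open>p_dvd_strip_functional\<close>
  applies.\<close>

lemma p_dvd_strip_vec:
  assumes e: "e \<in> carrier_vec (card (B.cubes (Suc d)))"
  shows "int p dvd strip_vec \<bullet> (B.facet_mat d *\<^sub>v e)"
proof -
  let ?e = "B.chain_of (Suc d) e"
  define x where "x \<sigma> = (if \<sigma> \<subseteq> V then ?e (vtx \<sigma>) (V - \<sigma>) else 0)" for \<sigma>
  have x: "x \<sigma> = 0" if "moore_face p \<sigma>" for \<sigma>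
    using that vtx_mem_iff unfolding x_def B.chain_of_def B.cubes_def by auto
  have "B.chain_of d (B.facet_mat d *\<^sub>v e) (vtx \<sigma>) (V - \<sigma>) = cobd x \<sigma>"
    if \<sigma>: "\<sigma> \<subseteq> V" "card \<sigma> = 4" "moore_face p (\<sigma> - {5})" for \<sigma>
  proof (cases "moore_face p \<sigma>")
    case True
    then have "(vtx \<sigma>, V - \<sigma>) \<notin> B.cubes d" using vtx_mem_iff[OF \<sigma>(1)] unfolding B.cubes_def by auto
    moreover have "x (\<sigma> - {j}) = 0" for j by (rule x, rule moore_face_subset[OF True]) auto
    ultimately show ?thesis unfolding B.chain_of_def cobd_def by simp
  next
    case False
    then have q: "(vtx \<sigma>, V - \<sigma>) \<in> B.cubes d" using vtx_cube_iff[OF \<sigma>(1), of d] \<sigma>(2) by simp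
    have "B.chain_of d (B.facet_mat d *\<^sub>v e) (vtx \<sigma>) (V - \<sigma>) = B.wbd (\<lambda>_. 0) ?e (vtx \<sigma>) (V - \<sigma>)"
      unfolding B.facet_mat_def by (rule B.chain_of_dmat_mult[OF e q])
    also have "\<dots> = cobd (\<lambda>\<sigma>. ?e (vtx \<sigma>) (V - \<sigma>)) \<sigma>"
    proof (rule wbd_vtx[OF \<sigma>(1)])
      fix j m assume j: "j \<in> {4 * p + 6, 4 * p + 7}" and h2: "2 \<le> h" and m: "m = update j (h - 2) (vtx \<sigma>)"
      have jV: "j \<notin> V" using j by auto
      have l: "lookup m k = (if k = j then h - 2 else lookup (vtx \<sigma>) k)" for k unfolding m by (simp add: lookup_update)
      have "keys m \<inter> V = keys (vtx \<sigma>) \<inter> V" using jV by (auto simp: in_keys_iff l)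
      then have k: "keys m \<inter> V - {5} = \<sigma> - {5}" by (simp only: keys_vtx[OF \<sigma>(1)])
      \<comment> \<open>Every edge factor must use \<open>j\<close>, with exponent \<open>h\<close>
        - 2, or the vertex \<open>5\<close>, with exponent at most 1; this allows at most
        \<open>h\<close> - 1 factors.\<close>
      have "m \<notin> M"
      proof
        assume mM: "m \<in> M"
        have f: "moore_face p (keys m \<inter> {1..4 * p + 5} - {5})" unfolding k by (rule \<sigma>(3))
        have "h \<le> (\<Sum>b\<in>insert j {5}. lookup m b)"
          by (rule power_exps_moore_graph_bound[OF _ j mM f]) simp
        moreover have "j \<noteq> 5" using jV by auto
        moreover have "lookup (vtx \<sigma>) 5 \<le> 1" by (auto simp: lookup_vtx[OF \<sigma>(1)])
        ultimately show False using h2 l[of j] l[of 5] by simp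
      qed
      then show "?e m (insert j (V - \<sigma>)) = 0" unfolding B.chain_of_def B.cubes_def by simp
    qed
    also have "\<dots> = cobd x \<sigma>"
      unfolding cobd_def by (rule sum.cong[OF refl]) (use \<sigma>(1) in \<open>auto simp: x_def\<close>)
    finally show ?thesis .
  qed
  then have "strip_functional p (\<lambda>\<sigma>. B.chain_of d (B.facet_mat d *\<^sub>v e) (vtx \<sigma>) (V - \<sigma>)) = strip_functional p (cobd x)"
    by (intro strip_functional_cong p)
  then show ?thesis
    using p_dvd_strip_functional[OF p x] by (simp add: strip_vec_scalar_prod[OF B.facet_mat_mult_carrier])
qed

lemma strip_vec_facet0_vec: "strip_vec \<bullet> facet0_vec = -1"
proof -
  let ?y = "\<lambda>\<sigma>. if card \<sigma> = 4 then cobd facet0 \<sigma> else 0"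
  have c: "facet0_vec \<in> carrier_vec (card (B.cubes d))" unfolding facet0_vec_def B.vec_of_def by simp
  have "B.chain_of d facet0_vec = on_vtx ?y"
    unfolding facet0_vec_def
    by (rule chain_of_vec_of_on_vtx) (use cobd_facet0_face[OF p] in \<open>auto split: if_splits\<close>)
  then have "strip_vec \<bullet> facet0_vec = strip_functional p (\<lambda>\<sigma>. on_vtx ?y (vtx \<sigma>) (V - \<sigma>))"
    using strip_vec_scalar_prod[OF c] by simp
  also have "\<dots> = strip_functional p (cobd facet0)"
  proof (rule strip_functional_cong[OF p])
    fix \<sigma> assume \<sigma>: "\<sigma> \<subseteq> {1..4 * p + 5}" "card \<sigma> = 4"
    then have "V - (V - \<sigma>) = \<sigma>" by auto
    then show "on_vtx ?y (vtx \<sigma>) (V - \<sigma>) = cobd facet0 \<sigma>" using \<sigma>(2) unfolding on_vtx_def by simp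
  qed
  also have "\<dots> = -1" by (rule strip_functional_facet0[OF p])
  finally show ?thesis .
qed

lemma rank_facet_mat_less:
  assumes pr: "prime p" and card: "CARD('k::field) = p"
  shows "vec_space.rank (card (B.cubes d)) (map_mat of_int (B.facet_mat d) :: 'k mat)
    < vec_space.rank (card (B.cubes d)) (map_mat of_int (B.facet_mat d) :: rat mat)"
proof (rule rank_mod_less_rank_rat[OF pr card, where w = torsion_vec and v = facet0_vec and \<phi> = "map_vec of_int strip_vec :: 'k vec"])
  show A: "B.facet_mat d \<in> carrier_mat (card (B.cubes d)) (card (B.cubes (Suc d)))"
    by (rule B.facet_mat_carrier)
  show "torsion_vec \<in> carrier_vec (card (B.cubes (Suc d)))" unfolding torsion_vec_def B.vec_of_def by simp
  show v: "facet0_vec \<in> carrier_vec (card (B.cubes d))" unfolding facet0_vec_def B.vec_of_def by simp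
  show "B.facet_mat d *\<^sub>v torsion_vec = int p \<cdot>\<^sub>v facet0_vec" by (rule facet_mat_torsion_vec)
  show "map_vec of_int strip_vec \<in> carrier_vec (card (B.cubes d))" unfolding strip_vec_def by simp
  have hom: "(map_vec of_int strip_vec :: 'k vec) \<bullet> map_vec of_int u = of_int (strip_vec \<bullet> u)"
    if "u \<in> carrier_vec (card (B.cubes d))" for u
    using that by (simp add: scalar_prod_def strip_vec_def)
  show "(map_vec of_int strip_vec :: 'k vec) \<bullet> map_vec of_int facet0_vec \<noteq> 0"
    unfolding hom[OF v] strip_vec_facet0_vec by simp
  fix j assume j: "j < card (B.cubes (Suc d))"
  have "int p dvd strip_vec \<bullet> col (B.facet_mat d) j"
    using p_dvd_strip_vec[of "unit_vec (card (B.cubes (Suc d))) j"] mat_mult_unit_vec[OF A j] by simp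
  then show "(map_vec of_int strip_vec :: 'k vec) \<bullet> map_vec of_int (col (B.facet_mat d) j) = 0"
    using hom[of "col (B.facet_mat d) j"] B.facet_mat_carrier[of d] of_int_eq_0_iff_dvd[OF pr card] by (simp add: carrier_vecI)
qed

end

theorem corollary4p8:
  fixes p :: nat
  assumes "prime p" and "CARD('k::field) = p"
  shows "\<exists>n E. simple_graph n E \<and>
           (\<exists>i\<ge>1. \<forall>h\<ge>1.
              betti n (ideal_power n (edge_ideal n E :: 'k mpoly set) h) i
              \<noteq> betti n (ideal_power n (edge_ideal n E :: rat mpoly set) h) i)"
proof -
  have "betti (4 * p + 7) (ideal_power (4 * p + 7) (edge_ideal (4 * p + 7) (moore_graph p) :: 'k mpoly set) h) (Suc (4 * p))
     \<noteq> betti (4 * p + 7) (ideal_power (4 * p + 7) (edge_ideal (4 * p + 7) (moore_graph p) :: rat mpoly set) h) (Suc (4 * p))"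
    if "h \<ge> 1" for h
  proof -
    interpret moore_power p h by unfold_locales (use prime_ge_2_nat[OF assms(1)] that in auto)
    \<comment> \<open>Of the two ranks subtracted from the number of cubes, this one can only weakly
      decrease modulo \<open>p\<close> and the one in degree \<open>d\<close> strictly decreases;
      the Betti number over \<open>'k\<close> is therefore strictly larger.\<close>
    have "vec_space.rank (card (B.cubes (4 * p))) (map_mat of_int (B.facet_mat (4 * p)) :: 'k mat)
      \<le> vec_space.rank (card (B.cubes (4 * p))) (map_mat of_int (B.facet_mat (4 * p)) :: rat mat)"
      by (rule rank_mod_le_rank_rat[OF assms B.facet_mat_carrier])
    moreover note rank_facet_mat_less[OF assms]
    moreover have "betti n (mono_ideal n M :: 'k mpoly set) d
        + vec_space.rank (card (B.cubes (4 * p))) (map_mat of_int (B.facet_mat (4 * p)) :: 'k mat)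
        + vec_space.rank (card (B.cubes d)) (map_mat of_int (B.facet_mat d) :: 'k mat) = card (B.cubes d)"
      "betti n (mono_ideal n M :: rat mpoly set) d
        + vec_space.rank (card (B.cubes (4 * p))) (map_mat of_int (B.facet_mat (4 * p)) :: rat mat)
        + vec_space.rank (card (B.cubes d)) (map_mat of_int (B.facet_mat d) :: rat mat) = card (B.cubes d)"
      by (rule B.betti_mono_ideal)+
    ultimately show ?thesis unfolding ideal_power_eq[OF simple_graph_moore_graph] by linarith
  qed
  then show ?thesis using simple_graph_moore_graph by (intro exI[of _ "4 * p + 7"] exI[of _ "moore_graph p"] conjI exI[of _ "Suc (4 * p)"]) auto
qed

end
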